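(* For $0<s<s'<1/2$ there is a constant $M$ such that for all $h$ and all $u\in X_h$: $$\lfloor u\rfloor_{s'}\le M\,h^{s-s'}\,\lfloor u\rfloor_s .$$
   Context: Domain: $S=\mathbb R^n/\mathbb L$, $\mathbb L=\sum_{i=1}^n\mathbb Z e_i$ for a basis $(e_i)$ of $\mathbb R^n$, with the flat Euclidean metric. $O=\mathrm L^2\mathrm{Alt}^\bullet(S)$ is the space of $\mathrm L^2$ differential forms of all degrees, with norm $|\cdot|$; $\mathrm d$ is the exterior derivative; $X=\{u\in O:\mathrm d u\in O\}$. For $s\in\,]0,1[$ the Slobodetskij semi-norm is $\lfloor u\rfloor_s^2=\iint_{S\times S}\frac{|u(x)-u(y)|^2}{|x-y|^{n+2s}}\,\mathrm dx\,\mathrm dy$ (forms are identified with their coefficient fields). Meshes: $(\mathcal T_h)$ is a sequence of cellular complexes on $S$, indexed by $h>0$ with $h\to0$, where $h$ is the largest diameter of a cell of $\mathcal T_h$. It is quasi-uniform: each $\mathcal T_h$ has a simplicial refinement, these refinements being quasi-uniform in the usual sense (uniformly shape-regular simplices with diameters uniformly comparable to $h$), and each cell of $\mathcal T_h$ is composed of a uniformly bounded number of simplices. Finite element spaces: for each $h$, $X_h=\bigoplus_{k=0}^n X_h^k\subset X$ is the space of a finite element system on $\mathcal T_h$: to each cell $T$ (of any dimension) and each $k$ is attached a finite dimensional space $X^k(T)$ of $k$-forms on $T$, smooth up to the boundary, such that $\mathrm d X^k(T)\subset X^{k+1}(T)$ and pullback to a subcell $T'\subset T$ maps $X^k(T)$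 into $X^k(T')$; $X_h^k$ consists of the $k$-forms on $S$ having, on every cell $T$, a single-valued pullback belonging to $X^k(T)$. The system is compatible: for each $T$ the sequence $0\to\mathbb R\to X^0(T)\to\cdots\to X^{\dim T}(T)\to0$ (with maps $\mathrm d$) is exact, and any family of elements of the $X^k(T')$, $T'$ ranging over proper subcells of $T$, compatible under pullback, extends to an element of $X^k(T)$. In the $h$-setting: after scaling by $h^{-1}$, the macro-elements (unions of cells touching a given cell) with their local spaces range in a compact family (finitely many combinatorial types, uniformly bounded dimensions). The local spaces contain the polynomial forms of degree up to a fixed integer $p\ge0$. *)

theory Defs
  imports "HOL-Analysis.Analysis"
begin

text \<open>
  Conventions.  The torus \<open>S = \<real>\<^sup>n / L\<close> is handled through its universal cover: functions and forms
  on \<open>S\<close> are \<open>L\<close>-periodic objects on \<open>real ^ 'n\<close> (\<open>n = CARD('n)\<close>), integrals over \<open>S\<close> are integrals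
  over the fundamental parallelepiped, distances in \<open>S\<close> are quotient distances, and a cellular
  complex on \<open>S\<close> is the \<open>L\<close>-invariant family of all lifts of its cells.
\<close>

section \<open>The flat torus\<close>

definition lattice_basis :: "('n::finite \<Rightarrow> real ^ 'n) \<Rightarrow> bool" where
  "lattice_basis e \<longleftrightarrow> inj e \<and> independent (range e)"

definition lattice :: "('n::finite \<Rightarrow> real ^ 'n) \<Rightarrow> (real ^ 'n) set" where
  "lattice e = {\<Sum>i\<in>UNIV. of_int (z i) *\<^sub>R e i | z. True}"

definition fundamental_domain :: "('n::finite \<Rightarrow> real ^ 'n) \<Rightarrow> (real ^ 'n) set" where
  "fundamental_domain e = {\<Sum>i\<in>UNIV. t i *\<^sub>R e i | t. \<forall>i. 0 \<le> t i \<and> t i < 1}"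

definition torus_dist :: "('n::finite \<Rightarrow> real ^ 'n) \<Rightarrow> real ^ 'n \<Rightarrow> real ^ 'n \<Rightarrow> real" where
  "torus_dist e x y = (INF l\<in>lattice e. norm (x - y - l))"

definition torus_diam :: "('n::finite \<Rightarrow> real ^ 'n) \<Rightarrow> (real ^ 'n) set \<Rightarrow> real" where
  "torus_diam e T = (SUP (x, y)\<in>T \<times> T. torus_dist e x y)"


section \<open>Differential forms\<close>

text \<open>
  An alternating form on \<open>\<real>\<^sup>n\<close> of mixed degree is a function on lists of vectors; its degree \<open>k\<close>
  part is its restriction to lists of length \<open>k\<close>.
\<close>

type_synonym 'n form = "real ^ 'n \<Rightarrow> (real ^ 'n) list \<Rightarrow> real"

definition alternating :: "((real ^ 'n) list \<Rightarrow> real) \<Rightarrow> bool" where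
  "alternating \<phi> \<longleftrightarrow>
     (\<forall>vs. \<forall>i<length vs. linear (\<lambda>v. \<phi> (vs[i := v]))) \<and>
     (\<forall>vs. \<forall>j<length vs. \<forall>i<j. vs ! i = vs ! j \<longrightarrow> \<phi> vs = 0)"

definition homogeneous :: "nat \<Rightarrow> ((real ^ 'n) list \<Rightarrow> real) \<Rightarrow> bool" where
  "homogeneous k \<phi> \<longleftrightarrow> (\<forall>vs. length vs \<noteq> k \<longrightarrow> \<phi> vs = 0)"

text \<open>
  Euclidean norm of the coefficients in the basis \<open>dx\<^sub>I\<close>: each increasing multi-index of length
  \<open>k\<close> is counted \<open>k!\<close> times among all lists of indices, and repeated indices contribute 0.
\<close>

definition alt_norm :: "((real ^ 'n) list \<Rightarrow> real) \<Rightarrow> real" where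
  "alt_norm \<phi> =
     sqrt (\<Sum>k\<le>CARD('n). (\<Sum>I\<in>{I :: 'n list. length I = k}. (\<phi> (map (\<lambda>i. axis i 1) I))\<^sup>2) / fact k)"

fun iterated_deriv :: "(real ^ 'n) list \<Rightarrow> (real ^ 'n \<Rightarrow> real) \<Rightarrow> real ^ 'n \<Rightarrow> real" where
  "iterated_deriv [] f = f"
| "iterated_deriv (v # vs) f = (\<lambda>x. frechet_derivative (iterated_deriv vs f) (at x) v)"

definition smooth :: "(real ^ 'n \<Rightarrow> real) \<Rightarrow> bool" where
  "smooth f \<longleftrightarrow> (\<forall>vs x. iterated_deriv vs f differentiable (at x))"

definition smooth_form :: "nat \<Rightarrow> ('n::finite) form \<Rightarrow> bool" where
  "smooth_form k \<omega> \<longleftrightarrow>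
     (\<forall>x. alternating (\<omega> x) \<and> homogeneous k (\<omega> x)) \<and> (\<forall>vs. smooth (\<lambda>x. \<omega> x vs))"

definition ext_deriv :: "('n::finite) form \<Rightarrow> ('n::finite) form" where
  "ext_deriv \<omega> = (\<lambda>x vs. \<Sum>i<length vs.
     (-1) ^ i * frechet_derivative (\<lambda>y. \<omega> y (take i vs @ drop (Suc i) vs)) (at x) (vs ! i))"

text \<open>
  Forms on a cell \<open>T\<close>, which may be of any dimension and consist of several flat pieces.  Vectors are
  jointly tangent to \<open>T\<close> at \<open>x\<close> if they lie in the direction space of one convex subset of \<open>T\<close> through
  \<open>x\<close>.  For a union of simplices this means: in the direction space of one simplex of \<open>T\<close> containing
  \<open>x\<close>.  A form on \<open>T\<close> is only evaluated on such lists and is normalised to 0 elsewhere, so that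
  pullback to \<open>T\<close> is a restriction.
\<close>

definition tangent_to :: "(real ^ 'n) set \<Rightarrow> real ^ 'n \<Rightarrow> (real ^ 'n) list \<Rightarrow> bool" where
  "tangent_to T x vs \<longleftrightarrow>
     (\<exists>C. convex C \<and> C \<subseteq> T \<and> x \<in> C \<and> set vs \<subseteq> span ((\<lambda>y. y - x) ` C))"

definition pullback :: "(real ^ 'n) set \<Rightarrow> ('n::finite) form \<Rightarrow> ('n::finite) form" where
  "pullback T u = (\<lambda>x vs. if tangent_to T x vs then u x vs else 0)"

text \<open>\<open>k\<close>-forms on \<open>T\<close> that are smooth up to the boundary.\<close>

definition smooth_forms_on :: "nat \<Rightarrow> (real ^ 'n) set \<Rightarrow> ('n::finite) form set" where
  "smooth_forms_on k T = {pullback T \<omega> | \<omega>. smooth_form k \<omega>}"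

text \<open>
  Exterior derivative on \<open>T\<close>.  Since \<open>ext_deriv\<close> commutes with pullback, the result does not depend
  on the smooth extension \<open>\<omega>\<close>, which justifies the description.
\<close>

definition ext_deriv_on :: "(real ^ 'n) set \<Rightarrow> ('n::finite) form \<Rightarrow> ('n::finite) form" where
  "ext_deriv_on T u =
     (THE w. \<exists>k \<omega>. smooth_form k \<omega> \<and> u = pullback T \<omega> \<and> w = pullback T (ext_deriv \<omega>))"

definition zero_form :: "('n::finite) form" where
  "zero_form = (\<lambda>x vs. 0)"

definition const_form :: "real \<Rightarrow> ('n::finite) form" where
  "const_form c = (\<lambda>x vs. if vs = [] then c else 0)"

definition poly_fun :: "nat \<Rightarrow> (real ^ 'n \<Rightarrow> real) \<Rightarrow> bool" where
  "poly_fun p f \<longleftrightarrow> (\<exists>c :: ('n \<Rightarrow> nat) \<Rightarrow> real. \<forall>x.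
     f x = (\<Sum>\<alpha>\<in>{\<alpha>. (\<Sum>i\<in>UNIV. \<alpha> i) \<le> p}. c \<alpha> * (\<Prod>i\<in>UNIV. (x $ i) ^ \<alpha> i)))"

definition poly_forms_on :: "nat \<Rightarrow> nat \<Rightarrow> (real ^ 'n) set \<Rightarrow> ('n::finite) form set" where
  "poly_forms_on p k T = {pullback T \<omega> | \<omega>.
     (\<forall>x. alternating (\<omega> x) \<and> homogeneous k (\<omega> x)) \<and> (\<forall>vs. poly_fun p (\<lambda>x. \<omega> x vs))}"

definition form_span :: "nat \<Rightarrow> (nat \<Rightarrow> ('n::finite) form) \<Rightarrow> ('n::finite) form set" where
  "form_span N b = {\<lambda>x vs. \<Sum>i<N. c i * b i x vs | c. True}"

definition form_independent :: "nat \<Rightarrow> (nat \<Rightarrow> ('n::finite) form) \<Rightarrow> bool" where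
  "form_independent N b \<longleftrightarrow>
     (\<forall>c. (\<lambda>x vs. \<Sum>i<N. c i * b i x vs) = zero_form \<longrightarrow> (\<forall>i<N. c i = 0))"

definition finite_dim :: "('n::finite) form set \<Rightarrow> bool" where
  "finite_dim Y \<longleftrightarrow> (\<exists>N b. Y = form_span N b)"

definition translate_form :: "real ^ 'n \<Rightarrow> ('n::finite) form \<Rightarrow> ('n::finite) form" where
  "translate_form l u = (\<lambda>x vs. u (x - l) vs)"


section \<open>Square integrable forms and the Slobodetskij semi-norm\<close>

definition L2_forms :: "('n::finite \<Rightarrow> real ^ 'n) \<Rightarrow> ('n::finite) form set" where
  "L2_forms e = {u.
     (\<forall>x. alternating (u x)) \<and>
     (\<forall>l\<in>lattice e. translate_form l u = u) \<and>
     (\<forall>vs. (\<lambda>x. u x vs) \<in> borel_measurable lebesgue) \<and>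
     (\<integral>\<^sup>+x\<in>fundamental_domain e. ennreal ((alt_norm (u x))\<^sup>2) \<partial>lebesgue) < \<infinity>}"

definition ennreal_sqrt :: "ennreal \<Rightarrow> ennreal" where
  "ennreal_sqrt a = (if a = \<infinity> then \<infinity> else ennreal (sqrt (enn2real a)))"

text \<open>The value \<open>\<infinity>\<close> stands for a divergent integral.\<close>

definition slobodetskij :: "('n::finite \<Rightarrow> real ^ 'n) \<Rightarrow> real \<Rightarrow> ('n::finite) form \<Rightarrow> ennreal" where
  "slobodetskij e s u = ennreal_sqrt
     (\<integral>\<^sup>+x\<in>fundamental_domain e. (\<integral>\<^sup>+y\<in>fundamental_domain e.
        ennreal ((alt_norm (\<lambda>vs. u x vs - u y vs))\<^sup>2 / torus_dist e x y powr (real CARD('n) + 2 * s))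
      \<partial>lebesgue) \<partial>lebesgue)"


section \<open>Cellular complexes\<close>

text \<open>A cell is a homeomorphic image of the closed unit ball of a \<open>k\<close>-dimensional space, here
  realised as a subspace \<open>V\<close> of \<open>\<real>\<^sup>n\<close>.\<close>

definition is_cell :: "(real ^ 'n) set \<Rightarrow> bool" where
  "is_cell T \<longleftrightarrow> (\<exists>V :: (real ^ 'n) set. subspace V \<and> (V \<inter> cball 0 1) homeomorphic T)"

text \<open>By invariance of domain the boundary does not depend on the homeomorphism.\<close>

definition cell_boundary :: "(real ^ 'n) set \<Rightarrow> (real ^ 'n) set" where
  "cell_boundary T = {x. \<exists>(V :: (real ^ 'n) set) f g. subspace V \<and> homeomorphism (V \<inter> cball 0 1) T f g \<and>
     x \<in> f ` (V \<inter> sphere 0 1)}"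

definition cell_interior :: "(real ^ 'n) set \<Rightarrow> (real ^ 'n) set" where
  "cell_interior T = T - cell_boundary T"

definition cell_complex :: "(real ^ 'n) set set \<Rightarrow> bool" where
  "cell_complex \<T> \<longleftrightarrow>
     (\<forall>T\<in>\<T>. is_cell T) \<and>
     (\<forall>T\<in>\<T>. \<forall>T'\<in>\<T>. T \<noteq> T' \<longrightarrow> cell_interior T \<inter> cell_interior T' = {}) \<and>
     (\<forall>T\<in>\<T>. \<exists>\<B>\<subseteq>\<T>. cell_boundary T = \<Union>\<B>)"

text \<open>
  The third condition says that a cell embeds into the torus, the fourth that there are finitely
  many cells modulo the lattice.
\<close>

definition torus_complex :: "('n::finite \<Rightarrow> real ^ 'n) \<Rightarrow> (real ^ 'n) set set \<Rightarrow> bool" where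
  "torus_complex e \<T> \<longleftrightarrow>
     cell_complex \<T> \<and>
     (\<forall>T\<in>\<T>. \<forall>l\<in>lattice e. (+) l ` T \<in> \<T>) \<and>
     (\<forall>T\<in>\<T>. \<forall>l\<in>lattice e. l \<noteq> 0 \<longrightarrow> T \<inter> (+) l ` T = {}) \<and>
     finite {T\<in>\<T>. T \<inter> fundamental_domain e \<noteq> {}} \<and>
     \<Union>\<T> = UNIV"

definition mesh_size :: "('n::finite \<Rightarrow> real ^ 'n) \<Rightarrow> (real ^ 'n) set set \<Rightarrow> real" where
  "mesh_size e \<T> = (SUP T\<in>\<T>. torus_diam e T)"

definition simplicial_torus_complex :: "('n::finite \<Rightarrow> real ^ 'n) \<Rightarrow> (real ^ 'n) set set \<Rightarrow> bool" where
  "simplicial_torus_complex e \<U> \<longleftrightarrow>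
     torus_complex e \<U> \<and>
     (\<forall>\<sigma>\<in>\<U>. \<exists>k. k simplex \<sigma>) \<and>
     (\<forall>\<sigma>\<in>\<U>. \<forall>F. F face_of \<sigma> \<and> F \<noteq> {} \<longrightarrow> F \<in> \<U>) \<and>
     (\<forall>\<sigma>\<in>\<U>. \<forall>\<tau>\<in>\<U>. (\<sigma> \<inter> \<tau>) face_of \<sigma>)"

definition simplicial_refinement ::
  "('n::finite \<Rightarrow> real ^ 'n) \<Rightarrow> (real ^ 'n) set set \<Rightarrow> (real ^ 'n) set set \<Rightarrow> bool" where
  "simplicial_refinement e \<U> \<T> \<longleftrightarrow>
     simplicial_torus_complex e \<U> \<and> (\<forall>T\<in>\<T>. T = \<Union>{\<sigma>\<in>\<U>. \<sigma> \<subseteq> T})"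

text \<open>
  Shape-regularity is expressed by inscribed balls, for the \<open>n\<close>-simplices; the lower dimensional
  simplices are faces of these and inherit the bounds.
\<close>

definition quasi_uniform :: "('n::finite \<Rightarrow> real ^ 'n) \<Rightarrow> (nat \<Rightarrow> (real ^ 'n) set set) \<Rightarrow> bool" where
  "quasi_uniform e \<T> \<longleftrightarrow> (\<exists>C>0. \<exists>N::nat. \<forall>m. \<exists>\<U>.
     simplicial_refinement e \<U> (\<T> m) \<and>
     (\<forall>\<sigma>\<in>\<U>. int CARD('n) simplex \<sigma> \<longrightarrow>
        (\<exists>a r. ball a r \<subseteq> \<sigma> \<and> diameter \<sigma> \<le> C * r) \<and>
        mesh_size e (\<T> m) \<le> C * diameter \<sigma> \<and> diameter \<sigma> \<le> C * mesh_size e (\<T> m)) \<and>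
     (\<forall>T\<in>\<T> m. finite {\<sigma>\<in>\<U>. \<sigma> \<subseteq> T} \<and> card {\<sigma>\<in>\<U>. \<sigma> \<subseteq> T} \<le> N))"


section \<open>Finite element systems\<close>

definition local_spaces :: "(real ^ 'n) set \<Rightarrow> (nat \<Rightarrow> ('n::finite) form set) \<Rightarrow> bool" where
  "local_spaces T Y \<longleftrightarrow> (\<forall>k. finite_dim (Y k) \<and> Y k \<subseteq> smooth_forms_on k T)"

text \<open>The last condition says that the system lives on the torus.\<close>

definition fe_system :: "('n::finite \<Rightarrow> real ^ 'n) \<Rightarrow> (real ^ 'n) set set \<Rightarrow>
    ((real ^ 'n) set \<Rightarrow> nat \<Rightarrow> ('n::finite) form set) \<Rightarrow> bool" where
  "fe_system e \<T> X \<longleftrightarrow>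
     (\<forall>T\<in>\<T>. local_spaces T (X T)) \<and>
     (\<forall>T\<in>\<T>. \<forall>k. ext_deriv_on T ` X T k \<subseteq> X T (Suc k)) \<and>
     (\<forall>T\<in>\<T>. \<forall>T'\<in>\<T>. T' \<subseteq> T \<longrightarrow> (\<forall>k. pullback T' ` X T k \<subseteq> X T' k)) \<and>
     (\<forall>T\<in>\<T>. \<forall>l\<in>lattice e. \<forall>k. X ((+) l ` T) k = translate_form l ` X T k)"

text \<open>
  Exactness at \<open>X\<^sup>k(T)\<close>.  No bound on \<open>k\<close> is needed: on \<open>T\<close> all forms of degree greater than \<open>dim T\<close>
  vanish, so exactness at the last space is surjectivity of the last \<open>d\<close>.
\<close>

definition exact_on :: "(real ^ 'n) set \<Rightarrow> (nat \<Rightarrow> ('n::finite) form set) \<Rightarrow> bool" where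
  "exact_on T Y \<longleftrightarrow>
     {u \<in> Y 0. ext_deriv_on T u = zero_form} = range (\<lambda>c. pullback T (const_form c)) \<and>
     (\<forall>k. {u \<in> Y (Suc k). ext_deriv_on T u = zero_form} = ext_deriv_on T ` Y k)"

definition extension_property ::
  "(real ^ 'n) set set \<Rightarrow> ((real ^ 'n) set \<Rightarrow> nat \<Rightarrow> ('n::finite) form set) \<Rightarrow> (real ^ 'n) set \<Rightarrow> bool" where
  "extension_property \<T> X T \<longleftrightarrow> (\<forall>k w.
     (\<forall>T'\<in>\<T>. T' \<subset> T \<longrightarrow> w T' \<in> X T' k) \<and>
     (\<forall>T'\<in>\<T>. \<forall>T''\<in>\<T>. T' \<subset> T \<and> T'' \<subseteq> T' \<longrightarrow> pullback T'' (w T') = w T'')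
     \<longrightarrow> (\<exists>u\<in>X T k. \<forall>T'\<in>\<T>. T' \<subset> T \<longrightarrow> pullback T' u = w T'))"

definition compatible_fe_system :: "('n::finite \<Rightarrow> real ^ 'n) \<Rightarrow> (real ^ 'n) set set \<Rightarrow>
    ((real ^ 'n) set \<Rightarrow> nat \<Rightarrow> ('n::finite) form set) \<Rightarrow> bool" where
  "compatible_fe_system e \<T> X \<longleftrightarrow>
     fe_system e \<T> X \<and> (\<forall>T\<in>\<T>. exact_on T (X T) \<and> extension_property \<T> X T)"

text \<open>
  The global space in degree \<open>k\<close>: \<open>L\<^sup>2\<close> forms given on the cells by a family \<open>w\<close> which is
  single-valued, i.e. compatible under pullback.  As \<open>u\<close> is an \<open>L\<^sup>2\<close> object, it is compared with \<open>w\<close>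
  almost everywhere; this only concerns the \<open>n\<close>-dimensional cells, the others being null sets.
\<close>

definition fe_space_deg :: "('n::finite \<Rightarrow> real ^ 'n) \<Rightarrow> (real ^ 'n) set set \<Rightarrow>
    ((real ^ 'n) set \<Rightarrow> nat \<Rightarrow> ('n::finite) form set) \<Rightarrow> nat \<Rightarrow> ('n::finite) form set" where
  "fe_space_deg e \<T> X k = {u \<in> L2_forms e. (\<forall>x. homogeneous k (u x)) \<and>
     (\<exists>w. (\<forall>T\<in>\<T>. w T \<in> X T k) \<and>
          (\<forall>T\<in>\<T>. \<forall>T'\<in>\<T>. T' \<subseteq> T \<longrightarrow> pullback T' (w T) = w T') \<and>
          (\<forall>T\<in>\<T>. AE x in lebesgue. x \<in> T \<longrightarrow> u x = w T x))}"

definition fe_space :: "('n::finite \<Rightarrow> real ^ 'n) \<Rightarrow> (real ^ 'n) set set \<Rightarrow>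
    ((real ^ 'n) set \<Rightarrow> nat \<Rightarrow> ('n::finite) form set) \<Rightarrow> ('n::finite) form set" where
  "fe_space e \<T> X = {\<lambda>x vs. \<Sum>k\<le>CARD('n). w k x vs | w. \<forall>k\<le>CARD('n). w k \<in> fe_space_deg e \<T> X k}"


section \<open>Compactness of the scaled macro-elements\<close>

text \<open>
  A macro-element is a finite cellular complex with local spaces; its cells are enumerated by a list,
  so that macro-elements of the same combinatorial type can be compared cell by cell.
\<close>

type_synonym 'n macro = "((real ^ 'n) set \<times> (nat \<Rightarrow> ('n::finite) form set)) list"

definition macro_element :: "('n::finite) macro \<Rightarrow> bool" where
  "macro_element M \<longleftrightarrow>
     distinct (map fst M) \<and> cell_complex (set (map fst M)) \<and> (\<forall>(T, Y)\<in>set M. local_spaces T Y)"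

definition hausdorff_converges :: "(nat \<Rightarrow> (real ^ 'n) set) \<Rightarrow> (real ^ 'n) set \<Rightarrow> bool" where
  "hausdorff_converges Ts T \<longleftrightarrow> (\<forall>\<epsilon>>0. \<forall>\<^sub>F j in sequentially.
     Ts j \<subseteq> (\<Union>x\<in>T. ball x \<epsilon>) \<and> T \<subseteq> (\<Union>x\<in>Ts j. ball x \<epsilon>))"

text \<open>Convergence of smooth forms in \<open>C\<^sup>1\<close>, locally uniformly.\<close>

definition C1_converges :: "(nat \<Rightarrow> ('n::finite) form) \<Rightarrow> ('n::finite) form \<Rightarrow> bool" where
  "C1_converges \<omega> \<eta> \<longleftrightarrow> (\<forall>r vs v.
     uniform_limit (cball 0 r) (\<lambda>j x. \<omega> j x vs) (\<lambda>x. \<eta> x vs) sequentially \<and>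
     uniform_limit (cball 0 r) (\<lambda>j x. frechet_derivative (\<lambda>y. \<omega> j y vs) (at x) v)
       (\<lambda>x. frechet_derivative (\<lambda>y. \<eta> y vs) (at x) v) sequentially)"

text \<open>
  Spaces of \<open>k\<close>-forms on \<open>Ts j\<close> converge to a space on \<open>T\<close> if they have bases converging to a basis.
  The \<open>C\<^sup>1\<close> topology is the coarsest of the usual ones for which the exterior derivative is continuous;
  compactness in a finer one (such as \<open>C\<^sup>\<infinity>\<close>) implies compactness in this one.
\<close>

definition spaces_converge ::
  "nat \<Rightarrow> (nat \<Rightarrow> (real ^ 'n) set) \<Rightarrow> (nat \<Rightarrow> ('n::finite) form set) \<Rightarrow> (real ^ 'n) set \<Rightarrow> ('n::finite) form set \<Rightarrow> bool" where
  "spaces_converge k Ts Ys T Y \<longleftrightarrow> (\<exists>N \<omega> \<eta>.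
     (\<forall>i<N. smooth_form k (\<eta> i) \<and> (\<forall>j. smooth_form k (\<omega> j i)) \<and> C1_converges (\<lambda>j. \<omega> j i) (\<eta> i)) \<and>
     Y = form_span N (\<lambda>i. pullback T (\<eta> i)) \<and>
     form_independent N (\<lambda>i. pullback T (\<eta> i)) \<and>
     (\<forall>\<^sub>F j in sequentially. Ys j = form_span N (\<lambda>i. pullback (Ts j) (\<omega> j i))))"

text \<open>The combinatorial type (number of cells and their incidences) is eventually constant.\<close>

definition macro_converges :: "(nat \<Rightarrow> ('n::finite) macro) \<Rightarrow> ('n::finite) macro \<Rightarrow> bool" where
  "macro_converges Ms M \<longleftrightarrow>
     (\<forall>\<^sub>F j in sequentially. length (Ms j) = length M \<and>
        (\<forall>a<length M. \<forall>b<length M.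
           fst (Ms j ! a) \<subseteq> fst (Ms j ! b) \<longleftrightarrow> fst (M ! a) \<subseteq> fst (M ! b))) \<and>
     (\<forall>a<length M. hausdorff_converges (\<lambda>j. fst (Ms j ! a)) (fst (M ! a)) \<and>
        (\<forall>k. spaces_converge k (\<lambda>j. fst (Ms j ! a)) (\<lambda>j. snd (Ms j ! a) k)
               (fst (M ! a)) (snd (M ! a) k)))"

text \<open>
  Sequential compactness.  It contains the finiteness of the number of combinatorial types and the
  boundedness of dimensions, since both are locally constant for the above convergence.
\<close>

definition compact_family :: "('n::finite) macro set \<Rightarrow> bool" where
  "compact_family \<K> \<longleftrightarrow>
     (\<forall>M\<in>\<K>. macro_element M) \<and>
     (\<forall>Ms :: nat \<Rightarrow> 'n macro. (\<forall>j. Ms j \<in> \<K>) \<longrightarrow> (\<exists>M\<in>\<K>. \<exists>r. strict_mono r \<and> macro_converges (Ms \<circ> r) M))"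

text \<open>The cells touching \<open>T\<close>, together with their subcells.\<close>

definition macro_cells :: "(real ^ 'n) set set \<Rightarrow> (real ^ 'n) set \<Rightarrow> (real ^ 'n) set set" where
  "macro_cells \<T> T = {T'\<in>\<T>. \<exists>T''\<in>\<T>. T'' \<inter> T \<noteq> {} \<and> T' \<subseteq> T''}"

text \<open>Scaling by \<open>1/h\<close> about the point \<open>a\<close>, i.e. pullback by the map sending \<open>y\<close> to \<open>a + h y\<close>.\<close>

definition scale_cell :: "real ^ 'n \<Rightarrow> real \<Rightarrow> (real ^ 'n) set \<Rightarrow> (real ^ 'n) set" where
  "scale_cell a h T = (\<lambda>y. a + h *\<^sub>R y) -` T"

definition scale_form :: "real ^ 'n \<Rightarrow> real \<Rightarrow> ('n::finite) form \<Rightarrow> ('n::finite) form" where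
  "scale_form a h u = (\<lambda>y vs. u (a + h *\<^sub>R y) (map (\<lambda>v. h *\<^sub>R v) vs))"

definition scaled_macro :: "real ^ 'n \<Rightarrow> real \<Rightarrow> (real ^ 'n) set list \<Rightarrow>
    ((real ^ 'n) set \<Rightarrow> nat \<Rightarrow> ('n::finite) form set) \<Rightarrow> ('n::finite) macro" where
  "scaled_macro a h Ts X = map (\<lambda>T. (scale_cell a h T, \<lambda>k. scale_form a h ` X T k)) Ts"

definition h_setting :: "('n::finite \<Rightarrow> real ^ 'n) \<Rightarrow> (nat \<Rightarrow> (real ^ 'n) set set) \<Rightarrow>
    (nat \<Rightarrow> (real ^ 'n) set \<Rightarrow> nat \<Rightarrow> ('n::finite) form set) \<Rightarrow> bool" where
  "h_setting e \<T> X \<longleftrightarrow> (\<exists>\<K>. compact_family \<K> \<and>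
     (\<forall>m. \<forall>T\<in>\<T> m. \<exists>a Ts. distinct Ts \<and> set Ts = macro_cells (\<T> m) T \<and>
        scaled_macro a (mesh_size e (\<T> m)) Ts (X m) \<in> \<K>))"

end

theory Submission
  imports Defs
begin

text \<open>
  Split the double integral at \<open>|x - y| = h\<close>.  Far from the diagonal the kernels differ by the factor
  \<open>h powr (2 * s - 2 * s')\<close>.  Near it, a compactness argument on the scaled macro-elements bounds the
  values and the Lipschitz constant of \<open>u - u(z)\<close> on a cell by its \<open>L\<^sup>2\<close> norm, constants being contained
  in the local spaces.  Hence for \<open>x\<close> and \<open>z\<close> in one simplex \<open>\<sigma>\<close>, the difference \<open>u(x) - u(y)\<close> is controlled
  by \<open>A(z) = \<integral> |u(y') - u(z)|\<^sup>2 dy'\<close> over a ball of radius \<open>R h\<close>, with an additional factor \<open>|x - y| / h\<close>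
  if \<open>y\<close> also lies in \<open>\<sigma>\<close>.  The points \<open>x\<close> of \<open>\<sigma>\<close> at distance less than \<open>t\<close> from its complement fill only a
  fraction \<open>O(t / h)\<close> of \<open>\<sigma>\<close>, so the jumps across the boundary are integrable since \<open>2 * s' < 1\<close>.
  Averaging over \<open>z\<close> in \<open>\<sigma>\<close> and bounding \<open>A\<close> by the \<open>s\<close>-energy concludes.
\<close>

text \<open>Scaling by \<open>1 / h\<close> multiplies a \<open>k\<close>-form by
  \<open>h ^ k\<close>. The estimates obtained by compactness are homogeneous in the form, so the
  degrees are treated separately and these powers cancel. The compactness acts on coefficients: in
  bases that converge to a basis of the limit space, normalised coefficients converge along a
  subsequence, and independence keeps the limit form nonzero at some point. Near that point the
  approximating forms stay bounded away from 0 on a ball of fixed radius; integrating over it turns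
  pointwise bounds into L2 bounds. Cells need not be convex, so the Lipschitz bound holds only along
  segments inside a cell; this is why the dyadic shells are studied on simplices, where a
  contraction towards an inscribed ball measures the boundary layer. The final power of
  \<open>h\<close> is the product of \<open>h powr (- 2 * s')\<close> from the shells,
  \<open>h powr (- n)\<close> from the passage to the L2 norm and \<open>h powr (n + 2 * s)\<close>
  from bounding \<open>A\<close> by the \<open>s\<close>-energy.\<close>

section \<open>Integrals over dyadic shells around the points of a convex cell\<close>

text \<open>Contract \<open>K\<close> towards \<open>a\<close> with ratio
  \<open>l = 1 - t / r\<close>. Convexity with \<open>ball a r\<close> keeps a ball of radius
  \<open>(1 - l) * r = t\<close> around each point of the image inside \<open>K\<close>, and
  Bernoulli's inequality bounds the lost fraction of volume \<open>1 - l ^ n\<close> by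
  \<open>n * t / r\<close>.\<close>

lemma convex_inner_layer:
  fixes K :: "'a::euclidean_space set" and r t :: real
  assumes K: "convex K" "compact K" and r: "ball a r \<subseteq> K" "0 < r" and t: "0 < t"
  obtains B where "B \<in> sets borel" "B \<subseteq> K"
    "emeasure lborel B \<le> ennreal (DIM('a) * t / r) * emeasure lborel K"
    "\<And>x. x \<in> K - B \<Longrightarrow> ball x t \<subseteq> K"
proof (cases "r \<le> t")
  \<comment> \<open>Here no contraction exists, but the claimed fraction is at least 1, so all of
    \<open>K\<close> may be discarded.\<close>
  case True
  have "1 * r \<le> real DIM('a) * t"
    using True r t DIM_positive[where 'a='a] by (intro mult_mono) auto
  then have "1 \<le> ennreal (DIM('a) * t / r)"
    using r by (simp add: field_simps)
  then have "1 * emeasure lborel K \<le> ennreal (DIM('a) * t / r) * emeasure lborel K"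
    by (intro mult_right_mono) auto
  then show ?thesis
    using K by (intro that[of K]) (auto intro: borel_compact)
next
  case False
  define l where "l = 1 - t / r"
  have l: "0 < l" "l < 1" "t = (1 - l) * r"
    using False r t by (auto simp: l_def field_simps)
  define f where "f = (\<lambda>x. l *\<^sub>R x + (1 - l) *\<^sub>R a)"
  have a: "a \<in> K" using r by auto
  have sub: "f ` K \<subseteq> K"
    using K(1) a l by (auto simp: f_def intro!: convexD)
  have cpt: "compact (f ` K)"
    unfolding f_def by (intro compact_continuous_image continuous_intros K)
  have fin: "emeasure lborel K < \<infinity>"
    using emeasure_bounded_finite[of K] K by (simp add: compact_imp_bounded)
  have em: "emeasure lborel (f ` K) = ennreal (l ^ DIM('a)) * emeasure lborel K"
  proof -
    have "emeasure lebesgue (f ` K) = ennreal (\<bar>l\<bar> ^ DIM('a)) * emeasure lebesgue K"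
      using emeasure_lebesgue_affine[of l "(1 - l) *\<^sub>R a" K] by (simp add: f_def)
    then show ?thesis
      using K cpt l by (simp add: borel_compact)
  qed
  have "1 + real DIM('a) * (l - 1) \<le> (1 + (l - 1)) ^ DIM('a)"
    by (rule Bernoulli_inequality) (use l in auto)
  then have bern: "1 - l ^ DIM('a) \<le> DIM('a) * t / r"
    using r by (simp add: l_def)
  have "emeasure lborel (K - f ` K) = emeasure lborel K - emeasure lborel (f ` K)"
    using sub K cpt emeasure_bounded_finite[of "f ` K"] compact_imp_bounded[OF cpt]
    by (intro emeasure_Diff) (auto simp: borel_compact)
  also have "\<dots> = ennreal (1 - l ^ DIM('a)) * emeasure lborel K"
  proof -
    obtain m where m: "emeasure lborel K = ennreal m" "0 \<le> m"
      using fin by (cases "emeasure lborel K") auto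
    have "ennreal m - ennreal (l ^ DIM('a)) * ennreal m = ennreal ((1 - l ^ DIM('a)) * m)"
      using l m by (simp add: ennreal_mult[symmetric] ennreal_minus algebra_simps)
    then show ?thesis
      using m l by (simp add: em ennreal_mult power_le_one)
  qed
  also have "\<dots> \<le> ennreal (DIM('a) * t / r) * emeasure lborel K"
    using bern by (intro mult_right_mono) (auto intro: ennreal_leI)
  finally have meas: "emeasure lborel (K - f ` K) \<le> ennreal (DIM('a) * t / r) * emeasure lborel K" .
  have "ball x t \<subseteq> K" if x: "x \<in> f ` K" for x
  proof
    fix y assume y: "y \<in> ball x t"
    obtain p where p: "p \<in> K" "x = l *\<^sub>R p + (1 - l) *\<^sub>R a" using x by (auto simp: f_def)
    \<comment> \<open>The displacement \<open>y - x\<close> is blown up by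
      \<open>1 / (1 - l)\<close>, so that \<open>q\<close> lies in \<open>ball a r\<close> and
      \<open>y\<close> is a convex combination of \<open>p\<close> and \<open>q\<close>.\<close>
    define q where "q = a + (1 / (1 - l)) *\<^sub>R (y - x)"
    have "norm (y - x) < (1 - l) * r" using y l by (simp add: dist_norm norm_minus_commute)
    then have "q \<in> ball a r"
      using l by (simp add: q_def dist_norm) (simp add: field_simps)
    then have "q \<in> K" using r by auto
    moreover have "y = l *\<^sub>R p + (1 - l) *\<^sub>R q"
      using l p by (simp add: q_def algebra_simps)
    ultimately show "y \<in> K"
      using K(1) p l by (auto intro!: convexD)
  qed
  then show ?thesis
    using meas K cpt by (intro that[of "K - f ` K"]) (auto intro: borel_compact)
qed

lemma dyadic_shell:
  fixes h t :: real
  assumes "0 < t" "t < h"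
  obtains j :: nat where "h / 2 ^ Suc j \<le> t" "t < h / 2 ^ j"
proof -
  have "(\<lambda>j. h / 2 ^ j) \<longlonglongrightarrow> 0"
    by real_asymp
  then have ev: "\<exists>j. h / 2 ^ j \<le> t"
    using assms(1) by (metis (mono_tags, lifting) order_tendstoD(2) eventually_sequentially le_refl less_imp_le)
  define j where "j = (LEAST j. h / 2 ^ j \<le> t)"
  have 1: "h / 2 ^ j \<le> t" unfolding j_def using ev by (rule LeastI_ex)
  have 2: "j \<noteq> 0" using 1 assms by (intro notI) auto
  then obtain i where i: "j = Suc i" by (cases j) auto
  have "\<not> h / 2 ^ i \<le> t"
    using not_less_Least[of i "\<lambda>j. h / 2 ^ j \<le> t"] i j_def by auto
  then show ?thesis using 1 i by (intro that[of i]) auto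
qed

lemma ennreal_le_suminf: "f j \<le> suminf f" for f :: "nat \<Rightarrow> ennreal"
  using sum_le_suminf[OF summableI, of "{j}" f] by simp

text \<open>On the shell \<open>h / 2 ^ Suc j \<le> dist x y < h / 2 ^ j\<close> the weight is
  largest at the inner radius. Multiplied by the volume of the outer ball it gives
  \<open>h powr (- 2 * s)\<close> times a geometric term of ratio \<open>2 powr (2 * s)\<close>. The
  bound \<open>b j\<close> refers to the whole outer ball, not only to the shell.\<close>

lemma shell_integral:
  fixes x :: "'a::euclidean_space" and q :: "'a \<Rightarrow> real" and b :: "nat \<Rightarrow> ennreal" and h s :: real
  assumes h: "0 < h" and s: "0 \<le> s" and q0: "\<And>y. 0 \<le> q y"
    and b: "\<And>j. AE y in lborel. dist x y < h / 2 ^ j \<longrightarrow> ennreal (q y) \<le> b j"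
  shows "(\<integral>\<^sup>+y\<in>ball x h. ennreal (q y / dist x y powr (DIM('a) + 2 * s)) \<partial>lborel)
    \<le> (\<Sum>j. ennreal (unit_ball_vol DIM('a) * 2 powr (DIM('a) + 2 * s) * h powr (- 2 * s)
              * (2 powr (2 * s)) ^ j) * b j)"
proof -
  let ?p = "DIM('a) + 2 * s"
  let ?g = "\<lambda>j y. b j * ennreal ((h / 2 ^ Suc j) powr (- ?p)) * indicator (ball x (h / 2 ^ j)) y"
  have "AE y in lborel. ennreal (q y / dist x y powr ?p) * indicator (ball x h) y \<le> (\<Sum>j. ?g j y)"
  proof -
    have "AE y in lborel. \<forall>j. dist x y < h / 2 ^ j \<longrightarrow> ennreal (q y) \<le> b j"
      using b by (simp add: AE_all_countable)
    then show ?thesis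
    proof (eventually_elim)
      case (elim y)
      show ?case
      proof (cases "y = x \<or> h \<le> dist x y")
        case True
        \<comment> \<open>For \<open>y = x\<close> the integrand is a division by 0, hence 0.\<close>
        then show ?thesis by (auto simp: indicator_def)
      next
        case False
        then obtain j where j: "h / 2 ^ Suc j \<le> dist x y" "dist x y < h / 2 ^ j"
          using dyadic_shell[of "dist x y" h] by auto
        have "1 / dist x y powr ?p \<le> (h / 2 ^ Suc j) powr (- ?p)"
        proof -
          have "(h / 2 ^ Suc j) powr ?p \<le> dist x y powr ?p" "0 < (h / 2 ^ Suc j) powr ?p"
            using powr_mono2[of ?p "h / 2 ^ Suc j" "dist x y"] j s h by auto
          then show ?thesis
            unfolding powr_minus_divide by (intro frac_le) auto
        qed
        then have "q y / dist x y powr ?p \<le> q y * (h / 2 ^ Suc j) powr (- ?p)"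
          using mult_left_mono[OF _ q0[of y]] by fastforce
        then have "ennreal (q y / dist x y powr ?p) \<le> ennreal (q y) * ennreal ((h / 2 ^ Suc j) powr (- ?p))"
          using q0 by (simp add: ennreal_mult[symmetric] ennreal_leI)
        also have "\<dots> \<le> ?g j y"
          using elim j by (auto intro!: mult_right_mono simp: indicator_def)
        also have "\<dots> \<le> (\<Sum>j. ?g j y)"
          by (rule ennreal_le_suminf)
        finally show ?thesis using False by (simp add: indicator_def)
      qed
    qed
  qed
  then have "(\<integral>\<^sup>+y\<in>ball x h. ennreal (q y / dist x y powr ?p) \<partial>lborel) \<le> (\<integral>\<^sup>+y. (\<Sum>j. ?g j y) \<partial>lborel)"
    by (rule nn_integral_mono_AE)
  also have "\<dots> = (\<Sum>j. \<integral>\<^sup>+y. ?g j y \<partial>lborel)"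
    by (rule nn_integral_suminf)
       (intro borel_measurable_times_ennreal borel_measurable_const borel_measurable_indicator, simp)
  also have "\<dots> = (\<Sum>j. ennreal (unit_ball_vol DIM('a) * 2 powr ?p * h powr (- 2 * s)
              * (2 powr (2 * s)) ^ j) * b j)"
  proof (rule suminf_cong)
    fix j :: nat
    have pw: "(h / 2 ^ Suc j) powr (- ?p) * (unit_ball_vol DIM('a) * (h / 2 ^ j) ^ DIM('a))
       = unit_ball_vol DIM('a) * 2 powr ?p * h powr (- 2 * s) * (2 powr (2 * s)) ^ j"
    proof -
      define d where "d = h / 2 ^ j"
      have d: "0 < d" using h by (simp add: d_def)
      have "(d / 2) powr (- ?p) = 2 powr ?p * d powr (- ?p)"
        using d by (simp only: powr_divide powr_minus) (simp add: divide_inverse)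
      moreover have "d ^ DIM('a) = d powr DIM('a)"
        using d by (simp add: powr_realpow)
      ultimately have "(d / 2) powr (- ?p) * d ^ DIM('a) = 2 powr ?p * (d powr (- ?p) * d powr DIM('a))"
        by (simp only: mult.assoc)
      also have "d powr (- ?p) * d powr DIM('a) = d powr (- 2 * s)"
        by (simp add: powr_add[symmetric])
      also have "d powr (- 2 * s) = h powr (- 2 * s) * (2 powr (2 * s)) ^ j"
      proof -
        have "((2::real) ^ j) powr (- 2 * s) = inverse ((2 powr (2 * s)) ^ j)"
          by (simp add: powr_realpow[symmetric] powr_powr powr_minus mult.commute)
        then show ?thesis
          using h unfolding d_def by (subst powr_divide) (auto simp: divide_inverse)
      qed
      finally have "(d / 2) powr (- ?p) * d ^ DIM('a) = 2 powr ?p * (h powr (- 2 * s) * (2 powr (2 * s)) ^ j)" .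
      moreover have "h / 2 ^ Suc j = d / 2" by (simp add: d_def)
      ultimately show ?thesis
        unfolding d_def[symmetric] by (simp only: mult_ac)
    qed
    have "(\<integral>\<^sup>+y. ?g j y \<partial>lborel) = b j * ennreal ((h / 2 ^ Suc j) powr (- ?p)) * emeasure lborel (ball x (h / 2 ^ j))"
      by (rule nn_integral_cmult_indicator) auto
    also have "\<dots> = ennreal ((h / 2 ^ Suc j) powr (- ?p) * (unit_ball_vol DIM('a) * (h / 2 ^ j) ^ DIM('a))) * b j"
      using h by (subst emeasure_ball) (auto simp: ennreal_mult mult_ac)
    finally show "(\<integral>\<^sup>+y. ?g j y \<partial>lborel) = ennreal (unit_ball_vol DIM('a) * 2 powr ?p * h powr (- 2 * s)
              * (2 powr (2 * s)) ^ j) * b j"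
      unfolding pw .
  qed
  finally show ?thesis .
qed

text \<open>In shell \<open>j\<close>, \<open>1 / 4 ^ j\<close> is the squared Lipschitz gain for
  pairs inside the cell, and \<open>n / (c * 2 ^ j)\<close> is the volume fraction of the points
  whose ball of radius \<open>h / 2 ^ j\<close> may leave the cell.\<close>

definition shell_sum :: "real \<Rightarrow> real \<Rightarrow> real \<Rightarrow> real" where
  "shell_sum n c s = (\<Sum>j. (2 powr (2 * s)) ^ j * (1 / 4 ^ j + n / (c * 2 ^ j)))"

text \<open>Two geometric series of ratios \<open>2 powr (2 * s) / 4\<close> and
  \<open>2 powr (2 * s) / 2\<close>. The second one, due to the jumps across the boundary, is what
  forces \<open>s < 1/2\<close>.\<close>

lemma shell_sum_summable:
  assumes "s < 1/2"
  shows "summable (\<lambda>j. (2 powr (2 * s)) ^ j * (1 / 4 ^ j + n / (c * 2 ^ j)) :: real)"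
proof -
  have lt: "2 powr (2 * s) < (2::real)"
    using powr_less_mono[of "2 * s" 1 "2::real"] assms by simp
  have "summable (\<lambda>j. (2 powr (2 * s) / 4) ^ j + n / c * (2 powr (2 * s) / 2) ^ j)"
    using lt by (intro summable_add summable_mult summable_geometric) auto
  moreover have "(2 powr (2 * s) / 4) ^ j + n / c * (2 powr (2 * s) / 2) ^ j
      = (2 powr (2 * s)) ^ j * (1 / 4 ^ j + n / (c * 2 ^ j))" for j
    by (simp add: power_divide distrib_left)
  ultimately show ?thesis by simp
qed

text \<open>Outside the boundary layer \<open>D j\<close> the ball of radius
  \<open>h / 2 ^ j\<close> stays in \<open>K\<close>, so \<open>E2\<close> gives the factor
  \<open>1 / 4 ^ j\<close>; on \<open>D j\<close> only \<open>E1\<close> is available, but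
  \<open>D j\<close> is small. The integral over \<open>x\<close> is taken shell by shell, before
  the sum over \<open>j\<close> is evaluated, so that this smallness counts.\<close>

lemma cell_integral:
  fixes Q :: "'a::euclidean_space \<Rightarrow> 'a \<Rightarrow> real" and B :: ennreal and c h r s :: real
  assumes K: "convex K" "compact K" "ball a r \<subseteq> K"
    and c: "0 < c" "c * h \<le> r" and h: "0 < h" and s: "0 \<le> s" "s < 1/2"
    and Q0: "\<And>x y. 0 \<le> Q x y"
    and G: "AE y in lborel. y \<in> G"
    and E1: "\<And>x y. x \<in> G \<Longrightarrow> x \<in> K \<Longrightarrow> y \<in> G \<Longrightarrow> dist x y < h \<Longrightarrow> ennreal (Q x y) \<le> B"
    and E2: "\<And>x y. x \<in> G \<Longrightarrow> x \<in> K \<Longrightarrow> y \<in> G \<Longrightarrow> y \<in> K \<Longrightarrow>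
      ennreal (Q x y) \<le> ennreal ((dist x y / h)\<^sup>2) * B"
  shows "(\<integral>\<^sup>+x\<in>K. (\<integral>\<^sup>+y\<in>ball x h. ennreal (Q x y / dist x y powr (DIM('a) + 2 * s)) \<partial>lborel) \<partial>lborel)
    \<le> ennreal (unit_ball_vol DIM('a) * 2 powr (DIM('a) + 2 * s) * h powr (- 2 * s)
        * shell_sum DIM('a) c s) * B * emeasure lborel K"
proof -
  let ?n = "real DIM('a)"
  have r: "0 < r" using c h by (metis mult_pos_pos less_le_trans)
  have "\<exists>D. D \<in> sets borel \<and> D \<subseteq> K \<and>
     emeasure lborel D \<le> ennreal (?n / (c * 2 ^ j)) * emeasure lborel K \<and>
     (\<forall>x\<in>K - D. ball x (h / 2 ^ j) \<subseteq> K)" for j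
  proof -
    have t: "0 < h / 2 ^ j" using h by simp
    obtain D where D: "D \<in> sets borel" "D \<subseteq> K"
      "emeasure lborel D \<le> ennreal (?n * (h / 2 ^ j) / r) * emeasure lborel K"
      "\<And>x. x \<in> K - D \<Longrightarrow> ball x (h / 2 ^ j) \<subseteq> K"
      using convex_inner_layer[OF K r t] by blast
    have "?n * (h / 2 ^ j) / r \<le> ?n * (h / 2 ^ j) / (c * h)"
      using c h r by (intro divide_left_mono) auto
    also have "\<dots> = ?n / (c * 2 ^ j)" using h by simp
    finally have "ennreal (?n * (h / 2 ^ j) / r) * emeasure lborel K \<le> ennreal (?n / (c * 2 ^ j)) * emeasure lborel K"
      by (intro mult_right_mono ennreal_leI) auto
    then show ?thesis using D by (meson order_trans)
  qed
  then obtain D where D: "\<And>j. D j \<in> sets borel" "\<And>j. D j \<subseteq> K"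
      "\<And>j. emeasure lborel (D j) \<le> ennreal (?n / (c * 2 ^ j)) * emeasure lborel K"
      "\<And>j x. x \<in> K - D j \<Longrightarrow> ball x (h / 2 ^ j) \<subseteq> K"
    by metis
  define w where "w = (\<lambda>j::nat. unit_ball_vol ?n * 2 powr (?n + 2 * s) * h powr (- 2 * s) * (2 powr (2 * s)) ^ j)"
  have w0: "0 \<le> w j" for j by (simp add: w_def)
  \<comment> \<open>An upper bound for \<open>Q x y\<close> on the ball of radius
    \<open>h / 2 ^ j\<close>: the small Lipschitz term everywhere, and the full \<open>B\<close>
    only for \<open>x\<close> in the layer.\<close>
  define b where "b = (\<lambda>x j. B * (ennreal (1 / 4 ^ j) + indicator (D j) x))"
  have "(\<integral>\<^sup>+y\<in>ball x h. ennreal (Q x y / dist x y powr (?n + 2 * s)) \<partial>lborel)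
      \<le> (\<Sum>j. ennreal (w j) * b x j)" if x: "x \<in> G" "x \<in> K" for x
    unfolding w_def
  proof (rule shell_integral[OF h s(1) Q0])
    fix j
    show "AE y in lborel. dist x y < h / 2 ^ j \<longrightarrow> ennreal (Q x y) \<le> b x j"
      using G
    proof eventually_elim
      case (elim y)
      show ?case
      proof
        assume d: "dist x y < h / 2 ^ j"
        have "h / 2 ^ j \<le> h / 1" using h by (intro divide_left_mono) auto
        then have dh: "dist x y < h" using d by simp
        show "ennreal (Q x y) \<le> b x j"
        proof (cases "x \<in> D j")
          case True
          have "ennreal (Q x y) \<le> B * 1" using E1[OF x elim dh] by simp
          also have "\<dots> \<le> b x j" unfolding b_def using True by (intro mult_left_mono) auto
          finally show ?thesis .
        next
          case False
          then have "y \<in> K" using D(4)[of x j] x d by auto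
          then have "ennreal (Q x y) \<le> ennreal ((dist x y / h)\<^sup>2) * B"
            using E2 x elim by blast
          also have "(dist x y / h)\<^sup>2 \<le> (1 / 2 ^ j)\<^sup>2"
            using d h by (intro power_mono) (auto simp: field_simps)
          also have "(1 / 2 ^ j)\<^sup>2 = (1 / 4 ^ j :: real)"
            by (simp add: power2_eq_square power_divide power_mult_distrib[symmetric])
          also have "ennreal (1 / 4 ^ j) * B \<le> b x j"
            unfolding b_def by (subst mult.commute, intro mult_left_mono) auto
          finally show ?thesis by (simp add: ennreal_leI mult_right_mono)
        qed
      qed
    qed
  qed
  then have "(\<integral>\<^sup>+x\<in>K. (\<integral>\<^sup>+y\<in>ball x h. ennreal (Q x y / dist x y powr (?n + 2 * s)) \<partial>lborel) \<partial>lborel)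
     \<le> (\<integral>\<^sup>+x. (\<Sum>j. ennreal (w j) * b x j) * indicator K x \<partial>lborel)"
    using G by (intro nn_integral_mono_AE) (auto simp: indicator_def elim: eventually_mono)
  also have "\<dots> = (\<integral>\<^sup>+x. (\<Sum>j. ennreal (w j) * b x j * indicator K x) \<partial>lborel)"
    by simp
  also have "\<dots> = (\<Sum>j. \<integral>\<^sup>+x. ennreal (w j) * b x j * indicator K x \<partial>lborel)"
    unfolding b_def
    by (rule nn_integral_suminf)
      (intro borel_measurable_times_ennreal borel_measurable_const borel_measurable_indicator
        borel_measurable_add, use D K in \<open>auto simp: borel_compact\<close>)
  also have "\<dots> \<le> (\<Sum>j. ennreal (w j * (1 / 4 ^ j + ?n / (c * 2 ^ j))) * (B * emeasure lborel K))"
  proof (rule suminf_le)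
    fix j
    have K': "K \<in> sets lborel" "D j \<in> sets lborel" using K D by (auto simp: borel_compact)
    have "(\<integral>\<^sup>+x. ennreal (w j) * b x j * indicator K x \<partial>lborel)
       = (\<integral>\<^sup>+x. ennreal (w j) * B * (ennreal (1 / 4 ^ j) * indicator K x + indicator (D j) x) \<partial>lborel)"
      unfolding b_def using D(2)[of j]
      by (intro nn_integral_cong) (auto simp: indicator_def algebra_simps)
    also have "\<dots> = ennreal (w j) * B * (ennreal (1 / 4 ^ j) * emeasure lborel K + emeasure lborel (D j))"
      using K' by (simp add: nn_integral_cmult nn_integral_add)
    also have "\<dots> \<le> ennreal (w j) * B * (ennreal (1 / 4 ^ j) * emeasure lborel K + ennreal (?n / (c * 2 ^ j)) * emeasure lborel K)"
      by (intro mult_left_mono add_left_mono D(3)) auto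
    also have "\<dots> = ennreal (w j) * ennreal (1 / 4 ^ j + ?n / (c * 2 ^ j)) * (B * emeasure lborel K)"
      using c by (subst ennreal_plus) (auto simp: algebra_simps)
    also have "\<dots> = ennreal (w j * (1 / 4 ^ j + ?n / (c * 2 ^ j))) * (B * emeasure lborel K)"
      using c w0 by (subst ennreal_mult) auto
    finally show "(\<integral>\<^sup>+x. ennreal (w j) * b x j * indicator K x \<partial>lborel)
       \<le> ennreal (w j * (1 / 4 ^ j + ?n / (c * 2 ^ j))) * (B * emeasure lborel K)" .
  qed (auto intro: summableI)
  also have "\<dots> = (\<Sum>j. ennreal (w j * (1 / 4 ^ j + ?n / (c * 2 ^ j)))) * (B * emeasure lborel K)"
    by simp
  also have "(\<Sum>j. ennreal (w j * (1 / 4 ^ j + ?n / (c * 2 ^ j))))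
     = ennreal (\<Sum>j. unit_ball_vol ?n * 2 powr (?n + 2 * s) * h powr (- 2 * s) *
          ((2 powr (2 * s)) ^ j * (1 / 4 ^ j + ?n / (c * 2 ^ j))))"
    unfolding w_def mult.assoc using c
    by (intro suminf_ennreal2) (auto intro!: summable_mult shell_sum_summable[OF s(2)])
  also have "\<dots> = ennreal (unit_ball_vol ?n * 2 powr (?n + 2 * s) * h powr (- 2 * s) * shell_sum ?n c s)"
    unfolding shell_sum_def by (subst suminf_mult[OF shell_sum_summable[OF s(2)]]) simp
  finally show ?thesis by (simp add: mult.assoc)
qed

text \<open>The left side does not depend on \<open>z\<close>, so the bound with
  \<open>B = C * A z\<close> may be integrated over \<open>z\<close> in \<open>K\<close>. The
  resulting factor \<open>emeasure lborel K\<close> cancels, being finite and, thanks to the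
  inscribed ball, positive.\<close>

lemma cell_integral_average:
  fixes Q :: "'a::euclidean_space \<Rightarrow> 'a \<Rightarrow> real" and A :: "'a \<Rightarrow> ennreal" and C :: ennreal and c h r s :: real
  assumes K: "convex K" "compact K" "ball a r \<subseteq> K"
    and c: "0 < c" "c * h \<le> r" and h: "0 < h" and s: "0 \<le> s" "s < 1/2"
    and Q0: "\<And>x y. 0 \<le> Q x y"
    and G: "AE y in lborel. y \<in> G"
    and A: "A \<in> borel_measurable borel"
    and E1: "\<And>x y z. x \<in> G \<Longrightarrow> x \<in> K \<Longrightarrow> y \<in> G \<Longrightarrow> z \<in> G \<Longrightarrow> z \<in> K \<Longrightarrow> dist x y < h \<Longrightarrow>
      ennreal (Q x y) \<le> C * A z"
    and E2: "\<And>x y z. x \<in> G \<Longrightarrow> x \<in> K \<Longrightarrow> y \<in> G \<Longrightarrow> y \<in> K \<Longrightarrow> z \<in> G \<Longrightarrow> z \<in> K \<Longrightarrow>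
      ennreal (Q x y) \<le> ennreal ((dist x y / h)\<^sup>2) * (C * A z)"
  shows "(\<integral>\<^sup>+x\<in>K. (\<integral>\<^sup>+y\<in>ball x h. ennreal (Q x y / dist x y powr (DIM('a) + 2 * s)) \<partial>lborel) \<partial>lborel)
    \<le> ennreal (unit_ball_vol DIM('a) * 2 powr (DIM('a) + 2 * s) * h powr (- 2 * s)
        * shell_sum DIM('a) c s) * C * (\<integral>\<^sup>+z\<in>K. A z \<partial>lborel)"
    (is "?I \<le> ?W * C * _")
proof -
  have r: "0 < r" using c h by (metis mult_pos_pos less_le_trans)
  have Km: "K \<in> sets lborel" using K by (simp add: borel_compact)
  have "emeasure lborel (ball a r) \<le> emeasure lborel K"
    using K Km by (intro emeasure_mono) auto
  moreover have "0 < emeasure lborel (ball a r)"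
    using r by (subst emeasure_ball) auto
  ultimately have pos: "emeasure lborel K \<noteq> 0" by auto
  have fin: "emeasure lborel K \<noteq> \<infinity>"
    using emeasure_bounded_finite[of K] K by (simp add: compact_imp_bounded less_top)
  have "emeasure lborel K * ?I = (\<integral>\<^sup>+z. ?I * indicator K z \<partial>lborel)"
    using Km by (subst nn_integral_cmult_indicator) (auto simp: mult.commute)
  also have "\<dots> \<le> (\<integral>\<^sup>+z. ?W * C * emeasure lborel K * (A z * indicator K z) \<partial>lborel)"
  proof (rule nn_integral_mono_AE, use G in eventually_elim)
    case (elim z)
    have "?I \<le> ?W * (C * A z) * emeasure lborel K" if "z \<in> K"
      using that elim by (intro cell_integral[OF K c h s Q0 G E1 E2])
    then show ?case by (auto simp: indicator_def mult_ac)
  qed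
  also have "\<dots> = ?W * C * emeasure lborel K * (\<integral>\<^sup>+z\<in>K. A z \<partial>lborel)"
    using A Km by (intro nn_integral_cmult) auto
  finally have "emeasure lborel K * ?I \<le> emeasure lborel K * (?W * C * (\<integral>\<^sup>+z\<in>K. A z \<partial>lborel))"
    by (simp add: mult_ac)
  then show ?thesis
    using pos fin by (simp add: ennreal_mult_le_mult_iff)
qed

section \<open>The lattice and the torus distance\<close>

locale torus_lattice =
  fixes e :: "'n::finite \<Rightarrow> real ^ 'n"
  assumes basis: "lattice_basis e"
begin

definition coord :: "real ^ 'n \<Rightarrow> real ^ 'n" where
  "coord = inv (\<lambda>t. \<Sum>i\<in>UNIV. t $ i *\<^sub>R e i)"

lemma linear_combination: "linear (\<lambda>t::real ^ 'n. \<Sum>i\<in>UNIV. t $ i *\<^sub>R e i)"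
  by (rule linearI) (simp_all add: scaleR_add_left sum.distrib scaleR_sum_right)

lemma inj_combination: "inj (\<lambda>t::real ^ 'n. \<Sum>i\<in>UNIV. t $ i *\<^sub>R e i)"
  unfolding linear_injective_0[OF linear_combination]
proof (intro allI impI)
  fix t :: "real ^ 'n" assume t: "(\<Sum>i\<in>UNIV. t $ i *\<^sub>R e i) = 0"
  have inj: "inj e" and ind: "independent (range e)" using basis by (auto simp: lattice_basis_def)
  have "(\<Sum>v\<in>range e. t $ inv e v *\<^sub>R v) = 0"
    using t inj by (subst sum.reindex) simp_all
  then have "t $ inv e v = 0" if "v \<in> range e" for v
    using independentD[OF ind finite_imageI[OF finite] subset_refl, of "\<lambda>v. t $ inv e v"] that by simp
  then show "t = 0" using inj by (auto simp: vec_eq_iff) (metis inv_f_f rangeI)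
qed

lemma coord_combination [simp]: "coord (\<Sum>i\<in>UNIV. t i *\<^sub>R e i) = (\<chi> i. t i)"
  using inv_f_f[OF inj_combination, of "\<chi> i. t i"] by (simp add: coord_def)

lemma combination_coord [simp]: "(\<Sum>i\<in>UNIV. coord x $ i *\<^sub>R e i) = x"
  using surj_f_inv_f[OF linear_injective_imp_surjective[OF linear_combination inj_combination], of x]
  by (simp add: coord_def)

lemma linear_coord: "linear coord"
proof (rule linearI)
  fix x y
  have "coord (\<Sum>i\<in>UNIV. (coord x $ i + coord y $ i) *\<^sub>R e i) = coord x + coord y"
    by (subst coord_combination) (simp add: vec_eq_iff)
  then show "coord (x + y) = coord x + coord y"
    by (simp only: scaleR_add_left sum.distrib combination_coord)
next
  fix r x
  have "coord (\<Sum>i\<in>UNIV. (r * coord x $ i) *\<^sub>R e i) = r *\<^sub>R coord x"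
    by (subst coord_combination) (simp add: vec_eq_iff)
  then show "coord (r *\<^sub>R x) = r *\<^sub>R coord x"
    by (simp only: scaleR_scaleR[symmetric] scaleR_sum_right[symmetric] combination_coord)
qed

lemmas coord_add = linear_add[OF linear_coord]
  and coord_diff = linear_diff[OF linear_coord]

lemma mem_lattice_iff: "x \<in> lattice e \<longleftrightarrow> (\<forall>i. coord x $ i \<in> \<int>)"
proof
  assume "\<forall>i. coord x $ i \<in> \<int>"
  then have "\<forall>i. \<exists>z. coord x $ i = of_int z" by (auto elim!: Ints_cases)
  then obtain z where "\<And>i. coord x $ i = of_int (z i)" by metis
  then have "x = (\<Sum>i\<in>UNIV. of_int (z i) *\<^sub>R e i)"
    using combination_coord[of x] by simp
  then show "x \<in> lattice e" by (auto simp: lattice_def)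
qed (auto simp: lattice_def)

lemma mem_fundamental_domain_iff: "x \<in> fundamental_domain e \<longleftrightarrow> (\<forall>i. 0 \<le> coord x $ i \<and> coord x $ i < 1)"
proof
  assume "\<forall>i. 0 \<le> coord x $ i \<and> coord x $ i < 1"
  then show "x \<in> fundamental_domain e"
    unfolding fundamental_domain_def using combination_coord[of x]
    by (intro CollectI exI[of _ "\<lambda>i. coord x $ i"]) simp
qed (auto simp: fundamental_domain_def)

lemma lattice_0: "0 \<in> lattice e"
  and lattice_minus: "x \<in> lattice e \<Longrightarrow> - x \<in> lattice e"
  by (auto simp: mem_lattice_iff linear_0[OF linear_coord] coord_add linear_neg[OF linear_coord])

lemma continuous_on_coord: "continuous_on S (\<lambda>x. coord x $ i)"
  by (intro continuous_intros linear_continuous_on linear_conv_bounded_linear[THEN iffD1] linear_coord)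

lemma coord_measurable [measurable]: "(\<lambda>x. coord x $ i) \<in> borel_measurable borel"
  by (intro borel_measurable_continuous_onI continuous_on_coord)

lemma fundamental_domain_measurable [measurable]: "fundamental_domain e \<in> sets borel"
proof -
  have "fundamental_domain e = {x \<in> space borel. \<forall>i. 0 \<le> coord x $ i \<and> coord x $ i < 1}"
    by (auto simp: mem_fundamental_domain_iff)
  then show ?thesis by simp
qed

lemma bounded_fundamental_domain: "bounded (fundamental_domain e)"
proof (rule boundedI)
  fix x assume "x \<in> fundamental_domain e"
  then obtain t where t: "x = (\<Sum>i\<in>UNIV. t i *\<^sub>R e i)" "\<And>i. 0 \<le> t i \<and> t i < 1"
    by (auto simp: fundamental_domain_def)
  have "norm x \<le> (\<Sum>i\<in>UNIV. norm (t i *\<^sub>R e i))" unfolding t by (rule norm_sum)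
  also have "\<dots> \<le> (\<Sum>i\<in>UNIV. norm (e i))"
    using t by (intro sum_mono) (auto simp: mult_left_le_one_le less_imp_le)
  finally show "norm x \<le> (\<Sum>i\<in>UNIV. norm (e i))" .
qed

lemma finite_lattice_ball: "finite {l \<in> lattice e. norm l \<le> R}"
proof -
  obtain B where B: "\<And>x. norm (coord x) \<le> B * norm x" "B > 0"
    using linear_bounded_pos[OF linear_coord] by auto
  define Z where "Z = {- \<lceil>B * R\<rceil> .. \<lceil>B * R\<rceil>}"
  have "{l \<in> lattice e. norm l \<le> R} \<subseteq>
     (\<lambda>z. \<Sum>i\<in>UNIV. of_int (z i) *\<^sub>R e i) ` (UNIV \<rightarrow>\<^sub>E Z)"
  proof safe
    fix l assume l: "l \<in> lattice e" "norm l \<le> R"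
    then obtain z where z: "l = (\<Sum>i\<in>UNIV. of_int (z i) *\<^sub>R e i)" by (auto simp: lattice_def)
    have "z i \<in> Z" for i
    proof -
      have "\<bar>of_int (z i)\<bar> \<le> norm (coord l)"
        using component_le_norm_cart[of "coord l" i] unfolding z by simp
      also have "\<dots> \<le> B * R" using B(1)[of l] B(2) l(2) by (smt (verit) mult_left_mono)
      finally show ?thesis unfolding Z_def by (auto simp: abs_le_iff) linarith+
    qed
    then show "l \<in> (\<lambda>z. \<Sum>i\<in>UNIV. of_int (z i) *\<^sub>R e i) ` (UNIV \<rightarrow>\<^sub>E Z)"
      using z by auto
  qed
  then show ?thesis
    by (rule finite_subset) (auto simp: Z_def intro!: finite_PiE)
qed

lemma countable_lattice: "countable (lattice e)"
proof -
  have "lattice e = range (\<lambda>z. \<Sum>i\<in>UNIV. of_int (z i) *\<^sub>R e i)" by (auto simp: lattice_def)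
  then show ?thesis by simp
qed

definition reduce :: "real ^ 'n \<Rightarrow> real ^ 'n" where
  "reduce x = (\<Sum>i\<in>UNIV. frac (coord x $ i) *\<^sub>R e i)"

lemma reduce_mem: "reduce x \<in> fundamental_domain e"
  by (auto simp: reduce_def mem_fundamental_domain_iff frac_lt_1)

lemma reduce_lattice: "x - reduce x \<in> lattice e"
  by (auto simp: mem_lattice_iff coord_diff reduce_def frac_def)

lemma reduce_translate: "l \<in> lattice e \<Longrightarrow> reduce (x + l) = reduce x"
  unfolding reduce_def mem_lattice_iff
  by (intro sum.cong refl) (auto simp: coord_add elim!: Ints_cases dest!: spec intro!: arg_cong2[where f="scaleR"] simp: frac_def)

lemma reduce_measurable [measurable]: "reduce \<in> borel_measurable borel"
  unfolding reduce_def frac_def by measurable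

lemma torus_dist_bdd: "bdd_below ((\<lambda>l. norm (x - y - l)) ` lattice e)"
  by (rule bdd_belowI[of _ 0]) auto

lemma torus_dist_le: "l \<in> lattice e \<Longrightarrow> torus_dist e x y \<le> norm (x - y - l)"
  unfolding torus_dist_def by (rule cINF_lower[OF torus_dist_bdd])

lemma torus_dist_nonneg: "0 \<le> torus_dist e x y"
  unfolding torus_dist_def using lattice_0 by (intro cINF_greatest) auto

text \<open>Only finitely many lattice vectors do at least as well as 0, so the infimum is a
  minimum. It allows the torus distance to be replaced by a Euclidean distance to a suitable
  lift.\<close>

lemma torus_dist_attained:
  obtains l where "l \<in> lattice e" "torus_dist e x y = norm (x - y - l)"
proof -
  let ?d = "\<lambda>l. norm (x - y - l)"
  define F where "F = {l \<in> lattice e. ?d l \<le> ?d 0}"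
  have "F \<subseteq> {l \<in> lattice e. norm l \<le> 2 * norm (x - y)}"
  proof
    fix l assume l: "l \<in> F"
    have "norm l \<le> norm (x - y) + norm (x - y - l)"
      using norm_triangle_ineq4[of "x - y" "x - y - l"] by simp
    then show "l \<in> {l \<in> lattice e. norm l \<le> 2 * norm (x - y)}"
      using l by (auto simp: F_def)
  qed
  then have fin: "finite F"
    by (rule finite_subset[OF _ finite_lattice_ball])
  have ne: "0 \<in> F" using lattice_0 by (simp add: F_def)
  define l where "l = arg_min_on ?d F"
  have l: "l \<in> F" "\<And>k. k \<in> F \<Longrightarrow> ?d l \<le> ?d k"
    using arg_min_if_finite[OF fin, of ?d] ne by (auto simp: l_def not_less)
  have "?d l \<le> ?d k" if "k \<in> lattice e" for k
    using l(2)[of k] l(2)[OF ne] that by (cases "?d k \<le> ?d 0") (auto simp: F_def)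
  then have "?d l \<le> torus_dist e x y"
    unfolding torus_dist_def using lattice_0 by (intro cINF_greatest) auto
  then show ?thesis
    using l(1) torus_dist_le[of l x y] by (intro that[of l]) (auto simp: F_def)
qed

lemma torus_dist_measurable [measurable]:
  "(\<lambda>p. torus_dist e (fst p) (snd p)) \<in> borel_measurable (borel \<Otimes>\<^sub>M borel)"
  unfolding torus_dist_def using countable_lattice
  by (intro borel_measurable_cINF torus_dist_bdd) auto

end

section \<open>The near-diagonal estimate for periodic kernels\<close>

lemma ball_measurable [measurable]: "ball x r \<in> sets borel"
  by simp

lemma nn_integral_translate:
  fixes f :: "'a::euclidean_space \<Rightarrow> ennreal"
  assumes [measurable]: "f \<in> borel_measurable borel"
  shows "(\<integral>\<^sup>+x. f (x + l) \<partial>lborel) = (\<integral>\<^sup>+x. f x \<partial>lborel)"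
proof -
  have "(\<integral>\<^sup>+x. f x \<partial>lborel) = (\<integral>\<^sup>+x. f x \<partial>distr lborel borel ((+) l))"
    by (simp add: lborel_distr_plus)
  also have "\<dots> = (\<integral>\<^sup>+x. f (l + x) \<partial>lborel)"
    by (rule nn_integral_distr) auto
  finally show ?thesis by (simp add: add.commute)
qed

text \<open>Neighbouring simplices share faces; overlaps of measure zero do not spoil
  additivity.\<close>

lemma sum_nn_integral_le_Union:
  fixes f :: "'a::euclidean_space \<Rightarrow> ennreal"
  assumes S: "finite S" "\<And>K. K \<in> S \<Longrightarrow> K \<in> sets borel"
    and disj: "\<And>K L. K \<in> S \<Longrightarrow> L \<in> S \<Longrightarrow> K \<noteq> L \<Longrightarrow> K \<inter> L \<in> null_sets lborel"
    and f: "f \<in> borel_measurable borel"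
  shows "(\<Sum>K\<in>S. \<integral>\<^sup>+x\<in>K. f x \<partial>lborel) \<le> (\<integral>\<^sup>+x\<in>\<Union>S. f x \<partial>lborel)"
proof -
  have "(\<Sum>K\<in>S. \<integral>\<^sup>+x\<in>K. f x \<partial>lborel) = (\<integral>\<^sup>+x. (\<Sum>K\<in>S. f x * indicator K x) \<partial>lborel)"
    using S f by (intro nn_integral_sum[symmetric]) auto
  also have "\<dots> \<le> (\<integral>\<^sup>+x\<in>\<Union>S. f x \<partial>lborel)"
  proof (rule nn_integral_mono_AE)
    have "AE x in lborel. \<forall>K\<in>S. \<forall>L\<in>S. K \<noteq> L \<longrightarrow> x \<notin> K \<inter> L"
      using disj by (intro AE_finite_allI S(1) AE_impI AE_not_in)
    then show "AE x in lborel. (\<Sum>K\<in>S. f x * indicator K x) \<le> f x * indicator (\<Union>S) x"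
    proof eventually_elim
      case (elim x)
      show ?case
      proof (cases "x \<in> \<Union>S")
        case True
        then obtain K where K: "K \<in> S" "x \<in> K" by auto
        have "(\<Sum>L\<in>S. f x * indicator L x) = (\<Sum>L\<in>{K}. f x * indicator L x)"
          using K elim S(1) by (intro sum.mono_neutral_right) (auto simp: indicator_def)
        then show ?thesis using K by (auto simp: indicator_def)
      next
        case False
        then have "(\<Sum>L\<in>S. f x * indicator L x) = 0"
          by (intro sum.neutral) (auto simp: indicator_def)
        then show ?thesis by simp
      qed
    qed
  qed
  finally show ?thesis .
qed

section \<open>Folding integrals onto the fundamental domain\<close>

context torus_lattice begin

text \<open>\<open>L\<close> collects the lattice vectors that bring points of \<open>U\<close> back
  to the fundamental domain, so \<open>U\<close> is covered by the translates of the domain by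
  \<open>L\<close>.\<close>

lemma nn_integral_cover:
  assumes L: "finite L" and U: "\<And>y. y \<in> U \<Longrightarrow> y - reduce y \<in> L"
    and f[measurable]: "f \<in> borel_measurable borel"
  shows "(\<integral>\<^sup>+y\<in>U. f y \<partial>lborel) \<le> (\<Sum>l\<in>L. \<integral>\<^sup>+y\<in>fundamental_domain e. f (y + l) \<partial>lborel)"
proof -
  let ?F = "fundamental_domain e"
  have "(\<integral>\<^sup>+y\<in>U. f y \<partial>lborel) \<le> (\<integral>\<^sup>+y. (\<Sum>l\<in>L. f y * indicator ?F (y - l)) \<partial>lborel)"
  proof (rule nn_integral_mono)
    fix y
    show "f y * indicator U y \<le> (\<Sum>l\<in>L. f y * indicator ?F (y - l))"
    proof (cases "y \<in> U")
      case True
      have "f y = f y * indicator ?F (y - (y - reduce y))"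
        using reduce_mem[of y] by simp
      also have "\<dots> \<le> (\<Sum>l\<in>L. f y * indicator ?F (y - l))"
        by (rule member_le_sum[OF U[OF True]]) (auto simp: L)
      finally show ?thesis using True by simp
    qed simp
  qed
  also have "\<dots> = (\<Sum>l\<in>L. \<integral>\<^sup>+y. f y * indicator ?F (y - l) \<partial>lborel)"
    by (rule nn_integral_sum) measurable
  also have "\<dots> = (\<Sum>l\<in>L. \<integral>\<^sup>+y\<in>?F. f (y + l) \<partial>lborel)"
  proof (rule sum.cong[OF refl])
    fix l
    show "(\<integral>\<^sup>+y. f y * indicator ?F (y - l) \<partial>lborel) = (\<integral>\<^sup>+y\<in>?F. f (y + l) \<partial>lborel)"
      by (subst nn_integral_translate[symmetric, of _ l]) simp_all
  qed
  finally show ?thesis .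
qed

text \<open>The squared semi-norm, with \<open>Q x y\<close> in place of the squared difference of
  the forms and with Borel instead of Lebesgue measure, as suits iterated integrals.\<close>

definition slobodetskij_energy :: "real \<Rightarrow> (real ^ 'n \<Rightarrow> real ^ 'n \<Rightarrow> real) \<Rightarrow> ennreal" where
  "slobodetskij_energy s Q = (\<integral>\<^sup>+x\<in>fundamental_domain e. (\<integral>\<^sup>+y\<in>fundamental_domain e.
        ennreal (Q x y / torus_dist e x y powr (real CARD('n) + 2 * s)) \<partial>lborel) \<partial>lborel)"

end
text \<open>\<open>Q x y\<close> stands for the squared norm of \<open>u(x) - u(y)\<close>. The
  analytic half of the argument sees forms only through such a kernel.\<close>

locale periodic_kernel = torus_lattice e for e :: "'n::finite \<Rightarrow> real ^ 'n" +
  fixes Q :: "real ^ 'n \<Rightarrow> real ^ 'n \<Rightarrow> real"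
  assumes Qm: "case_prod Q \<in> borel_measurable (borel \<Otimes>\<^sub>M borel)"
    and Q0: "0 \<le> Q x y" and Q_same: "Q x x = 0" and Q_sym: "Q x y = Q y x"
    and Q_per: "l \<in> lattice e \<Longrightarrow> Q x (y + l) = Q x y"
begin

lemma Q_measurable [measurable (raw)]:
  assumes "f \<in> borel_measurable M" "g \<in> borel_measurable M"
  shows "(\<lambda>p. Q (f p) (g p)) \<in> borel_measurable M"
  using measurable_compose[OF measurable_Pair[OF assms] Qm] by simp

definition near_integral :: "real \<Rightarrow> real \<Rightarrow> real ^ 'n \<Rightarrow> ennreal" where
  "near_integral h s x =
    (\<integral>\<^sup>+y\<in>ball x h. ennreal (Q x y / dist x y powr (real CARD('n) + 2 * s)) \<partial>lborel)"

text \<open>This is the quantity called \<open>A\<close> in the overview, for a ball of radius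
  \<open>r\<close> in the universal cover.\<close>

definition local_energy :: "real \<Rightarrow> real ^ 'n \<Rightarrow> ennreal" where
  "local_energy r z = (\<integral>\<^sup>+y\<in>ball z r. ennreal (Q y z) \<partial>lborel)"

lemma near_integral_measurable [measurable]: "near_integral h s \<in> borel_measurable borel"
proof -
  have "near_integral h s = (\<lambda>x. \<integral>\<^sup>+y. ennreal (Q x y / dist x y powr (real CARD('n) + 2 * s)) * (if dist x y < h then 1 else 0) \<partial>lborel)"
    unfolding near_integral_def by (intro ext nn_integral_cong) auto
  then show ?thesis by simp
qed

lemma local_energy_measurable [measurable]: "local_energy r \<in> borel_measurable borel"
proof -
  have "local_energy r = (\<lambda>z. \<integral>\<^sup>+y. ennreal (Q y z) * (if dist z y < r then 1 else 0) \<partial>lborel)"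
    unfolding local_energy_def by (intro ext nn_integral_cong) auto
  then show ?thesis by simp
qed

lemma inner_energy_measurable [measurable]:
  fixes s :: real
  shows "(\<lambda>x. \<integral>\<^sup>+y\<in>fundamental_domain e. ennreal (Q x y / torus_dist e x y powr (real CARD('n) + 2 * s)) \<partial>lborel)
    \<in> borel_measurable borel"
proof -
  note torus_dist_measurable[measurable del]
  have [measurable]: "(\<lambda>p. torus_dist e (fst p) (snd p)) \<in> borel_measurable (borel \<Otimes>\<^sub>M lborel)"
    using torus_dist_measurable by (simp cong: measurable_cong_sets add: sets_pair_measure_cong[OF refl sets_lborel])
  have "(\<lambda>p. ennreal (Q (fst p) (snd p) / torus_dist e (fst p) (snd p) powr (real CARD('n) + 2 * s)) * indicator (fundamental_domain e) (snd p))
     \<in> borel_measurable (borel \<Otimes>\<^sub>M lborel)" by measurable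
  from lborel.borel_measurable_nn_integral_fst[OF this] show ?thesis by simp
qed

lemma local_energy_periodic:
  assumes l: "l \<in> lattice e"
  shows "local_energy r (z + l) = local_energy r z"
proof -
  have "local_energy r (z + l) = (\<integral>\<^sup>+y. ennreal (Q (y + l) (z + l)) * indicator (ball (z + l) r) (y + l) \<partial>lborel)"
    unfolding local_energy_def by (rule nn_integral_translate[symmetric]) measurable
  also have "\<dots> = local_energy r z"
    unfolding local_energy_def using Q_per[OF l] Q_sym
    by (intro nn_integral_cong) (auto simp: indicator_def dist_norm)
  finally show ?thesis .
qed

text \<open>If the torus distance is at least \<open>h\<close>, the exponent
  \<open>2 * s - 2 * s' < 0\<close> lets \<open>h\<close> replace the distance in the quotient of
  the kernels. Otherwise the minimising lattice vector \<open>l\<close> moves \<open>y\<close> into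
  the Euclidean ball of radius \<open>h\<close> around \<open>x\<close>, and \<open>l\<close>
  belongs to \<open>L\<close>.\<close>

lemma energy_split:
  assumes L: "finite L" "\<And>x y l. x \<in> fundamental_domain e \<Longrightarrow> y \<in> fundamental_domain e \<Longrightarrow> l \<in> lattice e \<Longrightarrow>
      norm (x - y - l) < h \<Longrightarrow> l \<in> L" "L \<subseteq> lattice e"
    and h: "0 < h" and s: "0 < s" "s < s'"
  shows "slobodetskij_energy s' Q \<le> ennreal (h powr (2 * s - 2 * s')) * slobodetskij_energy s Q
    + of_nat (card L) * (\<integral>\<^sup>+x\<in>fundamental_domain e. near_integral h s' x \<partial>lborel)"
proof -
  let ?F = "fundamental_domain e" and ?n = "real CARD('n)"
  define k where "k = (\<lambda>x y. ennreal (Q x y / dist x y powr (?n + 2 * s')) * (if dist x y < h then 1 else 0))"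
  have km [measurable]: "(\<lambda>y. k x y) \<in> borel_measurable borel" for x
    unfolding k_def by measurable
  have k_near: "(\<integral>\<^sup>+y. k x y \<partial>lborel) = near_integral h s' x" for x
    unfolding near_integral_def k_def by (intro nn_integral_cong) auto
  have pt: "ennreal (Q x y / torus_dist e x y powr (?n + 2 * s')) \<le>
      ennreal (h powr (2 * s - 2 * s')) * ennreal (Q x y / torus_dist e x y powr (?n + 2 * s)) + (\<Sum>l\<in>L. k x (y + l))"
    if xy: "x \<in> ?F" "y \<in> ?F" for x y
  proof (cases "h \<le> torus_dist e x y")
    case True
    let ?d = "torus_dist e x y"
    have d: "0 < ?d" using True h by simp
    have "Q x y / ?d powr (?n + 2 * s') = ?d powr (2 * s - 2 * s') * (Q x y / ?d powr (?n + 2 * s))"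
      using d by (simp add: powr_diff powr_add field_simps)
    also have "\<dots> \<le> h powr (2 * s - 2 * s') * (Q x y / ?d powr (?n + 2 * s))"
      using True h s Q0 by (intro mult_right_mono powr_mono2') auto
    finally have "ennreal (Q x y / ?d powr (?n + 2 * s')) \<le> ennreal (h powr (2 * s - 2 * s')) * ennreal (Q x y / ?d powr (?n + 2 * s))"
      using Q0 by (simp add: ennreal_mult[symmetric] ennreal_leI)
    then show ?thesis by (rule order_trans) simp
  next
    case False
    obtain l where l: "l \<in> lattice e" "torus_dist e x y = norm (x - y - l)"
      by (rule torus_dist_attained)
    then have lL: "l \<in> L" using L(2)[OF xy] False by simp
    have "ennreal (Q x y / torus_dist e x y powr (?n + 2 * s')) = k x (y + l)"
      using False l Q_per[OF l(1)] by (simp add: k_def dist_norm diff_diff_eq)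
    also have "\<dots> \<le> (\<Sum>l\<in>L. k x (y + l))"
      by (rule member_le_sum[OF lL]) (auto simp: L)
    finally show ?thesis by (rule order_trans) simp
  qed
  have inner: "(\<integral>\<^sup>+y\<in>?F. ennreal (Q x y / torus_dist e x y powr (?n + 2 * s')) \<partial>lborel)
     \<le> ennreal (h powr (2 * s - 2 * s')) * (\<integral>\<^sup>+y\<in>?F. ennreal (Q x y / torus_dist e x y powr (?n + 2 * s)) \<partial>lborel)
       + of_nat (card L) * near_integral h s' x" if x: "x \<in> ?F" for x
  proof -
    have td [measurable]: "(\<lambda>y. torus_dist e x y) \<in> borel_measurable borel"
      using measurable_compose[OF measurable_Pair1' torus_dist_measurable, of x] by simp
    have "(\<integral>\<^sup>+y\<in>?F. ennreal (Q x y / torus_dist e x y powr (?n + 2 * s')) \<partial>lborel)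
      \<le> (\<integral>\<^sup>+y. ennreal (h powr (2 * s - 2 * s')) * (ennreal (Q x y / torus_dist e x y powr (?n + 2 * s)) * indicator ?F y)
          + (\<Sum>l\<in>L. k x (y + l)) \<partial>lborel)"
      using pt[OF x] by (intro nn_integral_mono) (auto simp: indicator_def)
    also have "\<dots> = ennreal (h powr (2 * s - 2 * s')) * (\<integral>\<^sup>+y\<in>?F. ennreal (Q x y / torus_dist e x y powr (?n + 2 * s)) \<partial>lborel)
       + (\<Sum>l\<in>L. \<integral>\<^sup>+y. k x (y + l) \<partial>lborel)"
      by (simp add: nn_integral_add nn_integral_cmult nn_integral_sum)
    \<comment> \<open>The near terms are integrated over the whole space, so each translation by
      \<open>l\<close> leaves the integral unchanged and only the number of translates
      remains.\<close>
    also have "(\<Sum>l\<in>L. \<integral>\<^sup>+y. k x (y + l) \<partial>lborel) = of_nat (card L) * near_integral h s' x"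
      by (simp add: nn_integral_translate k_near)
    finally show ?thesis .
  qed
  have "slobodetskij_energy s' Q \<le> (\<integral>\<^sup>+x. (ennreal (h powr (2 * s - 2 * s')) *
      ((\<integral>\<^sup>+y\<in>?F. ennreal (Q x y / torus_dist e x y powr (?n + 2 * s)) \<partial>lborel) * indicator ?F x)
       + of_nat (card L) * (near_integral h s' x * indicator ?F x)) \<partial>lborel)"
    unfolding slobodetskij_energy_def using inner
    by (intro nn_integral_mono) (auto simp: indicator_def)
  also have "\<dots> = ennreal (h powr (2 * s - 2 * s')) * slobodetskij_energy s Q
    + of_nat (card L) * (\<integral>\<^sup>+x\<in>?F. near_integral h s' x \<partial>lborel)"
    unfolding slobodetskij_energy_def
    by (simp add: nn_integral_add nn_integral_cmult)
  finally show ?thesis .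
qed

text \<open>On the ball the torus distance to \<open>z\<close> is below \<open>r\<close>, so the
  weight of the \<open>s\<close>-energy is at least \<open>r powr (- (n + 2 * s))\<close>. The
  cardinality of \<open>L\<close> accounts for a ball that wraps around the torus.\<close>

lemma local_energy_bound:
  assumes L: "finite L" "\<And>y. y \<in> ball z r \<Longrightarrow> y - reduce y \<in> L" "L \<subseteq> lattice e"
    and r: "0 < r" and s: "0 < s"
  shows "local_energy r z \<le> of_nat (card L) * (ennreal (r powr (real CARD('n) + 2 * s)) *
    (\<integral>\<^sup>+y\<in>fundamental_domain e. ennreal (Q z y / torus_dist e z y powr (real CARD('n) + 2 * s)) \<partial>lborel))"
proof -
  let ?F = "fundamental_domain e" and ?p = "real CARD('n) + 2 * s"
  have td [measurable]: "(\<lambda>y. torus_dist e z y) \<in> borel_measurable borel"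
    using measurable_compose[OF measurable_Pair1' torus_dist_measurable, of z] by simp
  have "local_energy r z = (\<integral>\<^sup>+y\<in>ball z r. (ennreal (Q y z) * indicator (ball z r) y) \<partial>lborel)"
    unfolding local_energy_def by (intro nn_integral_cong) (auto simp: indicator_def)
  also have "\<dots> \<le> (\<Sum>l\<in>L. \<integral>\<^sup>+y\<in>?F. (ennreal (Q (y + l) z) * indicator (ball z r) (y + l)) \<partial>lborel)"
    by (rule nn_integral_cover[OF L(1,2)]) measurable
  also have "\<dots> \<le> (\<Sum>l\<in>L. ennreal (r powr ?p) * (\<integral>\<^sup>+y\<in>?F. ennreal (Q z y / torus_dist e z y powr ?p) \<partial>lborel))"
  proof (rule sum_mono)
    fix l assume "l \<in> L"
    then have l: "l \<in> lattice e" using L by auto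
    have "(\<integral>\<^sup>+y\<in>?F. (ennreal (Q (y + l) z) * indicator (ball z r) (y + l)) \<partial>lborel)
      \<le> (\<integral>\<^sup>+y. ennreal (r powr ?p) * (ennreal (Q z y / torus_dist e z y powr ?p) * indicator ?F y) \<partial>lborel)"
    proof (intro nn_integral_mono)
      fix y
      show "ennreal (Q (y + l) z) * indicator (ball z r) (y + l) * indicator ?F y
        \<le> ennreal (r powr ?p) * (ennreal (Q z y / torus_dist e z y powr ?p) * indicator ?F y)"
      proof (cases "dist z (y + l) < r")
        case True
        have Qe: "Q (y + l) z = Q z y" using Q_sym Q_per[OF l] by metis
        have tr: "torus_dist e z y < r"
          using torus_dist_le[OF l, of z y] True by (simp add: dist_norm diff_diff_eq)
        have "Q z y \<le> r powr ?p * (Q z y / torus_dist e z y powr ?p)"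
        proof (cases "torus_dist e z y = 0")
          \<comment> \<open>Division by 0 gives 0 on the right, so \<open>Q z y\<close> itself must
            vanish: \<open>z\<close> and \<open>y\<close> are the same point of the torus.\<close>
          case True
          obtain k where "k \<in> lattice e" "torus_dist e z y = norm (z - y - k)"
            by (rule torus_dist_attained)
          then have "k \<in> lattice e" "z = y + k" using True by (auto simp: algebra_simps)
          then have "Q z y = 0" using Q_per[of k z y] Q_same by simp
          then show ?thesis by simp
        next
          case False
          then have d: "0 < torus_dist e z y" using torus_dist_nonneg[of z y] by simp
          then have "torus_dist e z y powr ?p \<le> r powr ?p" using tr s by (intro powr_mono2) auto
          then have "Q z y * torus_dist e z y powr ?p \<le> Q z y * r powr ?p"
            by (intro mult_left_mono Q0)
          then show ?thesis using d by (simp add: field_simps)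
        qed
        then have "ennreal (Q z y) \<le> ennreal (r powr ?p) * ennreal (Q z y / torus_dist e z y powr ?p)"
          using Q0 by (simp add: ennreal_mult[symmetric] ennreal_leI)
        then show ?thesis unfolding Qe by (auto simp: indicator_def)
      qed auto
    qed
    also have "\<dots> = ennreal (r powr ?p) * (\<integral>\<^sup>+y\<in>?F. ennreal (Q z y / torus_dist e z y powr ?p) \<partial>lborel)"
      by (rule nn_integral_cmult) measurable
    finally show "(\<integral>\<^sup>+y\<in>?F. (ennreal (Q (y + l) z) * indicator (ball z r) (y + l)) \<partial>lborel)
      \<le> ennreal (r powr ?p) * (\<integral>\<^sup>+y\<in>?F. ennreal (Q z y / torus_dist e z y powr ?p) \<partial>lborel)" .
  qed
  finally show ?thesis by simp
qed

text \<open>The summand 1 is the far part. Each factor \<open>card L\<close> comes from one use of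
  periodicity: splitting off the near part, folding the simplices that stick out of the fundamental
  domain, and folding the balls of radius \<open>R * h\<close>. The displacements involved are at
  most \<open>h\<close>, \<open>D * h\<close> and \<open>R * h\<close>, whence the bound
  \<open>(1 + D + R) * h\<close> in the condition on \<open>L\<close>.\<close>

lemma energy_inverse_estimate:
  fixes h c C D R s s' :: real and S :: "(real ^ 'n) set set" and G :: "(real ^ 'n) set"
  assumes L: "finite L" "L \<subseteq> lattice e"
      "\<And>x y l. x \<in> fundamental_domain e \<Longrightarrow> y \<in> fundamental_domain e \<Longrightarrow> l \<in> lattice e \<Longrightarrow>
        norm (x - y - l) \<le> (1 + D + R) * h \<Longrightarrow> l \<in> L"
    and pos: "0 < h" "0 < c" "0 \<le> C" "0 \<le> D" "0 < R" and s: "0 < s" "s < s'" "s' < 1/2"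
    and cells: "\<And>K. K \<in> S \<Longrightarrow> convex K \<and> compact K \<and> (\<exists>a r. c * h \<le> r \<and> ball a r \<subseteq> K)"
      "\<And>K x y. K \<in> S \<Longrightarrow> x \<in> K \<Longrightarrow> y \<in> K \<Longrightarrow> dist x y \<le> D * h"
      "finite {K \<in> S. K \<inter> fundamental_domain e \<noteq> {}}" "AE x in lborel. x \<in> \<Union>S"
      "\<And>K K'. K \<in> S \<Longrightarrow> K' \<in> S \<Longrightarrow> K \<noteq> K' \<Longrightarrow> K \<inter> K' \<in> null_sets lborel"
    and G: "AE x in lborel. x \<in> G"
    and E1: "\<And>K x y z. K \<in> S \<Longrightarrow> x \<in> G \<Longrightarrow> x \<in> K \<Longrightarrow> y \<in> G \<Longrightarrow> z \<in> G \<Longrightarrow> z \<in> K \<Longrightarrow> dist x y < h \<Longrightarrow>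
      ennreal (Q x y) \<le> ennreal (C / h ^ CARD('n)) * local_energy (R * h) z"
    and E2: "\<And>K x y z. K \<in> S \<Longrightarrow> x \<in> G \<Longrightarrow> x \<in> K \<Longrightarrow> y \<in> G \<Longrightarrow> y \<in> K \<Longrightarrow> z \<in> G \<Longrightarrow> z \<in> K \<Longrightarrow>
      ennreal (Q x y) \<le> ennreal ((dist x y / h)\<^sup>2) * (ennreal (C / h ^ CARD('n)) * local_energy (R * h) z)"
  shows "slobodetskij_energy s' Q \<le> ennreal ((1 + real (card L) ^ 3 * (unit_ball_vol CARD('n) *
     2 powr (real CARD('n) + 2 * s') * shell_sum CARD('n) c s' * C * R powr (real CARD('n) + 2 * s))) *
     h powr (2 * s - 2 * s')) * slobodetskij_energy s Q"
proof -
  let ?F = "fundamental_domain e" and ?n = "real CARD('n)" and ?N = "of_nat (card L) :: ennreal"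
  define SF where "SF = {K \<in> S. K \<inter> ?F \<noteq> {}}"
  have SFm: "K \<in> sets borel" if "K \<in> SF" for K using that cells(1) by (auto simp: SF_def borel_compact)
  define W where "W = unit_ball_vol ?n * 2 powr (?n + 2 * s') * h powr (- 2 * s') * shell_sum ?n c s'"
  let ?A = "local_energy (R * h)"
  have ss0: "0 \<le> shell_sum ?n c s'"
    unfolding shell_sum_def using pos by (intro suminf_nonneg shell_sum_summable s) auto
  then have W0: "0 \<le> W" by (simp add: W_def)
  have "(\<integral>\<^sup>+x\<in>?F. near_integral h s' x \<partial>lborel) \<le> (\<integral>\<^sup>+x. (\<Sum>K\<in>SF. near_integral h s' x * indicator K x) \<partial>lborel)"
  proof (rule nn_integral_mono_AE, use cells(4) in eventually_elim)
    case (elim x)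
    show ?case
    proof (cases "x \<in> ?F")
      case True
      then obtain K where K: "K \<in> SF" "x \<in> K" using elim by (auto simp: SF_def)
      have "near_integral h s' x * indicator K x \<le> (\<Sum>K\<in>SF. near_integral h s' x * indicator K x)"
        using cells(3) by (intro member_le_sum[OF K(1)]) (auto simp: SF_def)
      then show ?thesis using K True by simp
    qed simp
  qed
  also have "\<dots> = (\<Sum>K\<in>SF. \<integral>\<^sup>+x\<in>K. near_integral h s' x \<partial>lborel)"
    using SFm by (intro nn_integral_sum) auto
  also have "\<dots> \<le> (\<Sum>K\<in>SF. ennreal W * ennreal (C / h ^ CARD('n)) * (\<integral>\<^sup>+z\<in>K. ?A z \<partial>lborel))"
  proof (rule sum_mono)
    fix K assume "K \<in> SF"
    then have K: "K \<in> S" by (simp add: SF_def)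
    obtain a r where ar: "c * h \<le> r" "ball a r \<subseteq> K" using cells(1)[OF K] by auto
    show "(\<integral>\<^sup>+x\<in>K. near_integral h s' x \<partial>lborel) \<le> ennreal W * ennreal (C / h ^ CARD('n)) * (\<integral>\<^sup>+z\<in>K. ?A z \<partial>lborel)"
      using cell_integral_average[OF _ _ ar(2) pos(2) ar(1) pos(1) _ s(3) Q0 G local_energy_measurable E1[OF K] E2[OF K]]
        cells(1)[OF K] s unfolding near_integral_def W_def by simp
  qed
  also have "\<dots> = ennreal W * ennreal (C / h ^ CARD('n)) * (\<Sum>K\<in>SF. \<integral>\<^sup>+z\<in>K. ?A z \<partial>lborel)"
    by (rule sum_distrib_left[symmetric])
  also have "(\<Sum>K\<in>SF. \<integral>\<^sup>+z\<in>K. ?A z \<partial>lborel) \<le> (\<integral>\<^sup>+z\<in>\<Union>SF. ?A z \<partial>lborel)"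
    using cells(3,5) SFm by (intro sum_nn_integral_le_Union) (auto simp: SF_def)
  also have "\<dots> \<le> (\<Sum>l\<in>L. \<integral>\<^sup>+z\<in>?F. ?A (z + l) \<partial>lborel)"
  proof (rule nn_integral_cover[OF L(1)])
    fix z assume "z \<in> \<Union>SF"
    then obtain K x where K: "K \<in> S" "z \<in> K" "x \<in> K" "x \<in> ?F" by (auto simp: SF_def)
    have "norm (x - reduce z - (z - reduce z)) \<le> D * h"
      using cells(2)[OF K(1,3,2)] by (simp add: dist_norm)
    also have "\<dots> \<le> (1 + D + R) * h" using pos by (intro mult_right_mono) auto
    finally show "z - reduce z \<in> L" using L(3)[OF K(4) reduce_mem reduce_lattice] by blast
  qed measurable
  also have "\<dots> = ?N * (\<integral>\<^sup>+z\<in>?F. ?A z \<partial>lborel)"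
  proof -
    have "(\<integral>\<^sup>+z\<in>?F. ?A (z + l) \<partial>lborel) = (\<integral>\<^sup>+z\<in>?F. ?A z \<partial>lborel)" if "l \<in> L" for l
      using that L(2) local_energy_periodic by (intro nn_integral_cong) auto
    then show ?thesis by simp
  qed
  also have "(\<integral>\<^sup>+z\<in>?F. ?A z \<partial>lborel) \<le> (\<integral>\<^sup>+z. ?N * ennreal ((R * h) powr (?n + 2 * s)) *
      ((\<integral>\<^sup>+y\<in>?F. ennreal (Q z y / torus_dist e z y powr (?n + 2 * s)) \<partial>lborel) * indicator ?F z) \<partial>lborel)"
  proof (rule nn_integral_mono)
    fix z
    show "?A z * indicator ?F z \<le> ?N * ennreal ((R * h) powr (?n + 2 * s)) *
      ((\<integral>\<^sup>+y\<in>?F. ennreal (Q z y / torus_dist e z y powr (?n + 2 * s)) \<partial>lborel) * indicator ?F z)"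
    proof (cases "z \<in> ?F")
      case True
      have "y - reduce y \<in> L" if "y \<in> ball z (R * h)" for y
      proof -
        have "norm (z - reduce y - (y - reduce y)) \<le> R * h"
          using that by (simp add: dist_norm)
        also have "\<dots> \<le> (1 + D + R) * h" using pos by (intro mult_right_mono) auto
        finally show ?thesis using L(3)[OF True reduce_mem reduce_lattice] by blast
      qed
      from local_energy_bound[OF L(1) this L(2) _ s(1)] show ?thesis
        using True pos by (simp add: mult.assoc)
    qed simp
  qed
  also have "\<dots> = ?N * ennreal ((R * h) powr (?n + 2 * s)) * slobodetskij_energy s Q"
    unfolding slobodetskij_energy_def by (rule nn_integral_cmult) measurable
  finally have near: "(\<integral>\<^sup>+x\<in>?F. near_integral h s' x \<partial>lborel)
     \<le> ennreal W * ennreal (C / h ^ CARD('n)) * (?N * (?N * ennreal ((R * h) powr (?n + 2 * s)) * slobodetskij_energy s Q))"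
    by (simp add: mult_left_mono)
  define V where "V = unit_ball_vol ?n * 2 powr (?n + 2 * s') * shell_sum ?n c s' * C * R powr (?n + 2 * s)"
  have V0: "0 \<le> V" using ss0 pos by (simp add: V_def)
  have "W * (C / h ^ CARD('n)) * (R * h) powr (?n + 2 * s) = V * h powr (2 * s - 2 * s')"
  proof -
    have "h ^ CARD('n) = h powr ?n" using pos by (simp add: powr_realpow)
    then have "h powr (- 2 * s') * (1 / h ^ CARD('n)) * h powr (?n + 2 * s) = h powr (2 * s - 2 * s')"
      using pos by (simp add: powr_add powr_diff powr_minus field_simps)
    then show ?thesis using pos by (simp add: W_def V_def powr_mult mult_ac divide_inverse)
  qed
  then have V: "ennreal W * ennreal (C / h ^ CARD('n)) * ennreal ((R * h) powr (?n + 2 * s)) = ennreal (V * h powr (2 * s - 2 * s'))"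
    using W0 pos by (simp add: ennreal_mult[symmetric] del: ennreal_mult')
  have "slobodetskij_energy s' Q \<le> ennreal (h powr (2 * s - 2 * s')) * slobodetskij_energy s Q
    + ?N * (\<integral>\<^sup>+x\<in>?F. near_integral h s' x \<partial>lborel)"
  proof (rule energy_split[OF L(1) _ L(2) pos(1) s(1,2)])
    fix x y l assume "x \<in> ?F" "y \<in> ?F" "l \<in> lattice e" "norm (x - y - l) < h"
    moreover have "1 * h \<le> (1 + D + R) * h" using pos by (intro mult_right_mono) auto
    ultimately show "l \<in> L" using L(3) by simp
  qed
  also have "\<dots> \<le> ennreal (h powr (2 * s - 2 * s')) * slobodetskij_energy s Q
    + ?N * (ennreal W * ennreal (C / h ^ CARD('n)) * (?N * (?N * ennreal ((R * h) powr (?n + 2 * s)) * slobodetskij_energy s Q)))"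
    by (intro add_left_mono mult_left_mono near) simp
  also have "\<dots> = ennreal (h powr (2 * s - 2 * s')) * slobodetskij_energy s Q
    + ?N ^ 3 * (ennreal W * ennreal (C / h ^ CARD('n)) * ennreal ((R * h) powr (?n + 2 * s))) * slobodetskij_energy s Q"
    by (simp add: power3_eq_cube mult_ac)
  also have "\<dots> = ennreal ((1 + real (card L) ^ 3 * V) * h powr (2 * s - 2 * s')) * slobodetskij_energy s Q"
    unfolding V using V0
    by (simp add: distrib_right ennreal_plus ennreal_mult ennreal_of_nat_eq_real_of_nat[symmetric]
        ennreal_power[symmetric] mult.assoc)
  finally show ?thesis by (simp add: V_def)
qed

end

section \<open>Inverse estimates by compactness\<close>

lemma finite_index_lists: "finite {I :: 'n::finite list. length I = k}"
  using finite_lists_length_eq[of "UNIV :: 'n set" k] by simp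

text \<open>The degree \<open>k\<close> summand of the squared \<open>alt_norm\<close>, before
  division by \<open>fact k\<close>.\<close>

definition comp_sq :: "nat \<Rightarrow> ((real ^ 'n::finite) list \<Rightarrow> real) \<Rightarrow> real" where
  "comp_sq k \<phi> = (\<Sum>I\<in>{I :: 'n list. length I = k}. (\<phi> (map (\<lambda>i. axis i 1) I))\<^sup>2)"

lemma comp_sq_nonneg: "0 \<le> comp_sq k \<phi>"
  unfolding comp_sq_def by (rule sum_nonneg) simp

lemma comp_sq_scale: "comp_sq k (\<lambda>vs. t * \<phi> vs) = t\<^sup>2 * comp_sq k \<phi>"
  unfolding comp_sq_def by (simp add: power_mult_distrib sum_distrib_left)

lemma comp_sq_cong: "(\<And>vs. length vs = k \<Longrightarrow> \<phi> vs = \<psi> vs) \<Longrightarrow> comp_sq k \<phi> = comp_sq k \<psi>"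
  unfolding comp_sq_def by (intro sum.cong) auto

lemma comp_sq_le:
  fixes \<phi> :: "(real ^ 'n::finite) list \<Rightarrow> real"
  assumes "\<And>I. length I = k \<Longrightarrow> \<bar>\<phi> (map (\<lambda>i. axis i 1) I)\<bar> \<le> B"
  shows "comp_sq k \<phi> \<le> real (card {I :: 'n list. length I = k}) * B\<^sup>2"
  unfolding comp_sq_def
proof (rule sum_bounded_above)
  fix I :: "'n list" assume "I \<in> {I. length I = k}"
  then have "\<bar>\<phi> (map (\<lambda>i. axis i 1) I)\<bar> \<le> B" using assms by simp
  then show "(\<phi> (map (\<lambda>i. axis i 1) I))\<^sup>2 \<le> B\<^sup>2"
    using power_mono[of "\<bar>\<phi> (map (\<lambda>i. axis i 1) I)\<bar>" B 2] by simp
qed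

lemma comp_sq_ge: "length I = k \<Longrightarrow> (\<phi> (map (\<lambda>i. axis i 1) I))\<^sup>2 \<le> comp_sq k \<phi>"
  unfolding comp_sq_def using finite_index_lists by (intro member_le_sum) auto

text \<open>Induction on the number \<open>j\<close> of leading slots that hold arbitrary vectors:
  the last of them is expanded in the standard basis, which leaves one arbitrary slot fewer.\<close>

lemma multilinear_eq_0:
  fixes \<phi> :: "(real ^ 'n::finite) list \<Rightarrow> real"
  assumes lin: "\<And>vs i. i < length vs \<Longrightarrow> linear (\<lambda>v. \<phi> (vs[i := v]))"
    and basis: "\<And>I. length I = k \<Longrightarrow> \<phi> (map (\<lambda>i. axis i 1) I) = 0"
    and len: "length vs = k"
  shows "\<phi> vs = 0"
proof -
  have "\<phi> vs = 0" if "j \<le> k" "length vs = k" "\<And>i. j \<le> i \<Longrightarrow> i < k \<Longrightarrow> vs ! i \<in> range (\<lambda>i. axis i 1)" for j vs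
    using that
  proof (induction j arbitrary: vs)
    case 0
    then have "\<forall>i<k. \<exists>m. vs ! i = axis m 1" by auto
    then obtain m where m: "\<And>i. i < k \<Longrightarrow> vs ! i = axis (m i) 1" by metis
    have "vs = map (\<lambda>i. axis i 1) (map m [0..<k])"
      using 0 m by (intro nth_equalityI) auto
    then show ?case using basis[of "map m [0..<k]"] by simp
  next
    case (Suc j)
    have j: "j < length vs" using Suc.prems by simp
    have "\<phi> vs = \<phi> (vs[j := \<Sum>i\<in>UNIV. vs ! j $ i *\<^sub>R axis i 1])"
      using basis_expansion[of "vs ! j"] j by (simp add: scalar_mult_eq_scaleR)
    also have "\<dots> = (\<Sum>i\<in>UNIV. \<phi> (vs[j := vs ! j $ i *\<^sub>R axis i 1]))"
      using linear_sum[OF lin[OF j], of "\<lambda>i. vs ! j $ i *\<^sub>R axis i 1" UNIV] by simp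
    also have "\<dots> = (\<Sum>i\<in>UNIV. vs ! j $ i * \<phi> (vs[j := axis i 1]))"
      using linear_scale[OF lin[OF j]] by simp
    also have "\<dots> = 0"
    proof (rule sum.neutral, rule ballI)
      fix i
      have "\<phi> (vs[j := axis i 1]) = 0"
        using Suc.prems j by (intro Suc.IH) (auto simp: nth_list_update)
      then show "vs ! j $ i * \<phi> (vs[j := axis i 1]) = 0" by simp
    qed
    finally show ?case .
  qed
  from this[of k vs] len show ?thesis by auto
qed

section \<open>Smooth functions and sets with interior balls near every point\<close>

lemma smooth_differentiable: "smooth f \<Longrightarrow> f differentiable (at x)"
  unfolding smooth_def by (drule spec[of _ "[]"]) simp

lemma smooth_continuous: "smooth f \<Longrightarrow> continuous_on A f"
  by (intro continuous_at_imp_continuous_on ballI differentiable_imp_continuous_within smooth_differentiable)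

lemma smooth_deriv_continuous: "smooth f \<Longrightarrow> continuous_on A (\<lambda>x. frechet_derivative f (at x) v)"
  unfolding smooth_def
  by (intro continuous_at_imp_continuous_on ballI differentiable_imp_continuous_within, drule spec[of _ "[v]"]) simp

text \<open>The geometric information on full-dimensional cells that survives scaling: every point
  lies in a convex piece of controlled size with an inscribed ball. Convex pieces through the point
  are what \<open>tangent_to\<close> asks for.\<close>

definition fat :: "real \<Rightarrow> real \<Rightarrow> (real ^ 'n) set \<Rightarrow> bool" where
  "fat c C T \<longleftrightarrow> (\<forall>x\<in>T. \<exists>K a. convex K \<and> x \<in> K \<and> K \<subseteq> T \<and> ball a c \<subseteq> K \<and> K \<subseteq> cball x C)"

lemma fatE:
  assumes "fat c C T" "x \<in> T"
  obtains K a where "convex K" "x \<in> K" "K \<subseteq> T" "ball a c \<subseteq> K" "K \<subseteq> cball x C"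
  using assms unfolding fat_def by metis

text \<open>The convex piece through \<open>x\<close> contains a ball, so its directions span
  everything. Hence pullback to a fat set does not change a form at the points of the set.\<close>

lemma fat_tangent:
  fixes T :: "(real ^ 'n::finite) set"
  assumes "fat c C T" "0 < c" "x \<in> T"
  shows "tangent_to T x vs"
proof -
  obtain K a where K: "convex K" "x \<in> K" "K \<subseteq> T" "ball a c \<subseteq> K"
    using fatE[OF assms(1,3)] by metis
  have "ball (a - x) c \<subseteq> (\<lambda>y. y - x) ` K"
  proof
    fix y assume "y \<in> ball (a - x) c"
    then have "y + x \<in> ball a c" by (simp add: dist_norm algebra_simps)
    then show "y \<in> (\<lambda>y. y - x) ` K" using K by (intro image_eqI[of _ _ "y + x"]) auto
  qed
  then have "span (ball (a - x) c) \<subseteq> span ((\<lambda>y. y - x) ` K)" by (rule span_mono)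
  moreover have "span (ball (a - x) c) = UNIV"
    using affine_hull_nonempty_interior[of "ball (a - x) c"] affine_hull_subset_span[of "ball (a - x) c"] assms(2)
    by auto
  ultimately show ?thesis unfolding tangent_to_def using K by auto
qed

text \<open>Contract the convex piece towards \<open>x\<close> by the factor \<open>t\<close>: the
  image of its inscribed ball has radius \<open>t * c\<close> and lies within \<open>t * C\<close>
  of \<open>x\<close>.\<close>

lemma fat_small_ball:
  assumes "fat c C T" "x \<in> T" "0 < t" "t \<le> 1"
  obtains b where "ball b (t * c) \<subseteq> T \<inter> cball x (t * C)"
proof -
  obtain K a where K: "convex K" "x \<in> K" "K \<subseteq> T" "ball a c \<subseteq> K" "K \<subseteq> cball x C"
    using fatE[OF assms(1,2)] by metis
  have "ball (x + t *\<^sub>R (a - x)) (t * c) \<subseteq> T \<inter> cball x (t * C)"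
  proof
    fix y assume y: "y \<in> ball (x + t *\<^sub>R (a - x)) (t * c)"
    define q where "q = x + (1 / t) *\<^sub>R (y - x)"
    have yq: "y = (1 - t) *\<^sub>R x + t *\<^sub>R q" using assms(3) by (simp add: q_def algebra_simps)
    have "a - q = (1 / t) *\<^sub>R (x + t *\<^sub>R (a - x) - y)"
      using assms(3) by (simp add: q_def algebra_simps)
    then have "norm (a - q) = norm (x + t *\<^sub>R (a - x) - y) / t"
      using assms(3) by simp
    moreover have "norm (x + t *\<^sub>R (a - x) - y) < t * c" using y by (simp add: dist_norm)
    ultimately have "q \<in> ball a c" using assms(3) by (simp add: dist_norm pos_divide_less_eq mult.commute)
    then have q: "q \<in> K" using K by auto
    then have "y \<in> K" unfolding yq using K assms by (intro convexD) auto
    moreover have "norm (x - y) = t * norm (x - q)"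
    proof -
      have "x - y = t *\<^sub>R (x - q)" unfolding yq by (simp add: algebra_simps)
      then show ?thesis using assms(3) by simp
    qed
    moreover have "norm (x - q) \<le> C" using q K(5) by (auto simp: dist_norm)
    ultimately show "y \<in> T \<inter> cball x (t * C)" using K assms(3) by (auto simp: dist_norm)
  qed
  then show ?thesis by (rule that)
qed

text \<open>One constant serves as inverse diameter, radius of a ball, and constant of the sup and
  Lipschitz bounds, and it may always be decreased. The right sides hold at every point
  \<open>y\<close> of the ball, so that integrating over \<open>y\<close> yields an L2 norm.
  Increments are compared only along segments in \<open>S\<close>, which need not be convex.\<close>

definition inverse_bound :: "nat \<Rightarrow> real \<Rightarrow> (real ^ 'n) set \<Rightarrow> ('n::finite) form \<Rightarrow> bool" where
  "inverse_bound k \<kappa> S \<phi> \<longleftrightarrow>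
     (\<forall>x\<in>S. \<forall>y\<in>S. \<kappa> * norm (x - y) \<le> 1) \<and>
     (\<exists>b. ball b \<kappa> \<subseteq> S \<and> (\<forall>y\<in>ball b \<kappa>.
        (\<forall>x\<in>S. \<kappa> * comp_sq k (\<phi> x) \<le> comp_sq k (\<phi> y)) \<and>
        (\<forall>x x'. closed_segment x x' \<subseteq> S \<longrightarrow>
           \<kappa> * comp_sq k (\<lambda>vs. \<phi> x vs - \<phi> x' vs) \<le> (norm (x - x'))\<^sup>2 * comp_sq k (\<phi> y))))"

lemma inverse_bound_mono:
  assumes ib: "inverse_bound k \<kappa> S \<phi>" and le: "\<kappa>' \<le> \<kappa>"
  shows "inverse_bound k \<kappa>' S \<phi>"
proof -
  have m: "\<kappa>' * u \<le> v" if "\<kappa> * u \<le> v" "0 \<le> u" for u v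
    using that mult_right_mono[OF le that(2)] by linarith
  obtain b where b: "ball b \<kappa> \<subseteq> S" "\<And>y. y \<in> ball b \<kappa> \<Longrightarrow>
        (\<forall>x\<in>S. \<kappa> * comp_sq k (\<phi> x) \<le> comp_sq k (\<phi> y)) \<and>
        (\<forall>x x'. closed_segment x x' \<subseteq> S \<longrightarrow>
           \<kappa> * comp_sq k (\<lambda>vs. \<phi> x vs - \<phi> x' vs) \<le> (norm (x - x'))\<^sup>2 * comp_sq k (\<phi> y))"
    using ib unfolding inverse_bound_def by metis
  have sub: "ball b \<kappa>' \<subseteq> ball b \<kappa>" using le by (rule subset_ball)
  show ?thesis
    unfolding inverse_bound_def
  proof (intro conjI ballI exI[of _ b] impI allI)
    show "ball b \<kappa>' \<subseteq> S" using sub b by auto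
    fix y x x' assume y: "y \<in> ball b \<kappa>'"
    show "x \<in> S \<Longrightarrow> \<kappa>' * comp_sq k (\<phi> x) \<le> comp_sq k (\<phi> y)"
      using b(2)[of y] sub y by (intro m comp_sq_nonneg) auto
    show "closed_segment x x' \<subseteq> S \<Longrightarrow>
       \<kappa>' * comp_sq k (\<lambda>vs. \<phi> x vs - \<phi> x' vs) \<le> (norm (x - x'))\<^sup>2 * comp_sq k (\<phi> y)"
      using b(2)[of y] sub y by (intro m comp_sq_nonneg) auto
  next
    fix x y assume "x \<in> S" "y \<in> S"
    then show "\<kappa>' * norm (x - y) \<le> 1" using ib by (intro m) (auto simp: inverse_bound_def)
  qed
qed

text \<open>Both sides of each estimate are quadratic in the form. This removes the normalisation of
  coefficients and also the factor \<open>h ^ k\<close> produced by scaling.\<close>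

lemma inverse_bound_scaled:
  assumes ib: "inverse_bound k \<kappa> S \<psi>" and \<phi>: "\<And>x vs. x \<in> S \<Longrightarrow> length vs = k \<Longrightarrow> \<phi> x vs = t * \<psi> x vs"
  shows "inverse_bound k \<kappa> S \<phi>"
proof -
  have c: "comp_sq k (\<phi> x) = t\<^sup>2 * comp_sq k (\<psi> x)" if "x \<in> S" for x
    using comp_sq_cong[of k "\<phi> x" "\<lambda>vs. t * \<psi> x vs"] \<phi>[OF that] by (simp add: comp_sq_scale)
  have d: "comp_sq k (\<lambda>vs. \<phi> x vs - \<phi> x' vs) = t\<^sup>2 * comp_sq k (\<lambda>vs. \<psi> x vs - \<psi> x' vs)"
    if "x \<in> S" "x' \<in> S" for x x'
    unfolding comp_sq_scale[symmetric] using \<phi> that by (intro comp_sq_cong) (simp add: right_diff_distrib)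
  obtain b where b: "ball b \<kappa> \<subseteq> S" "\<And>y. y \<in> ball b \<kappa> \<Longrightarrow>
        (\<forall>x\<in>S. \<kappa> * comp_sq k (\<psi> x) \<le> comp_sq k (\<psi> y)) \<and>
        (\<forall>x x'. closed_segment x x' \<subseteq> S \<longrightarrow>
           \<kappa> * comp_sq k (\<lambda>vs. \<psi> x vs - \<psi> x' vs) \<le> (norm (x - x'))\<^sup>2 * comp_sq k (\<psi> y))"
    using ib unfolding inverse_bound_def by metis
  have m: "p * (t\<^sup>2 * u) \<le> q * (t\<^sup>2 * v)" if "p * u \<le> q * v" for p q u v :: real
    using mult_left_mono[OF that, of "t\<^sup>2"] by (simp add: mult_ac)
  show ?thesis
    unfolding inverse_bound_def
  proof (intro conjI ballI exI[of _ b] impI allI)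
    fix y x assume y: "y \<in> ball b \<kappa>" and x: "x \<in> S"
    have yS: "y \<in> S" using y b by auto
    show "\<kappa> * comp_sq k (\<phi> x) \<le> comp_sq k (\<phi> y)"
      using b(2)[OF y] x yS m[of \<kappa> _ 1] by (simp add: c)
  next
    fix y x x' assume y: "y \<in> ball b \<kappa>" and seg: "closed_segment x x' \<subseteq> S"
    then have S: "x \<in> S" "x' \<in> S" "y \<in> S" using b by auto
    show "\<kappa> * comp_sq k (\<lambda>vs. \<phi> x vs - \<phi> x' vs) \<le> (norm (x - x'))\<^sup>2 * comp_sq k (\<phi> y)"
      using b(2)[OF y] seg S by (auto simp only: c d intro!: m)
  qed (use b ib in \<open>auto simp: inverse_bound_def\<close>)
qed

lemma linear_le_of_axis_le:
  fixes f :: "real ^ 'n::finite \<Rightarrow> real" and B :: real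
  assumes "linear f" "\<And>i. \<bar>f (axis i 1)\<bar> \<le> B"
  shows "\<bar>f v\<bar> \<le> CARD('n) * B * norm v"
proof -
  have B: "0 \<le> B" using assms(2) abs_ge_zero order_trans by blast
  have "f v = f (\<Sum>i\<in>UNIV. v $ i *\<^sub>R axis i 1)"
    using basis_expansion[of v] by (simp add: scalar_mult_eq_scaleR)
  also have "\<dots> = (\<Sum>i\<in>UNIV. v $ i * f (axis i 1))"
    using assms(1) by (simp add: linear_sum linear_scale)
  finally have "\<bar>f v\<bar> \<le> (\<Sum>i\<in>UNIV. \<bar>v $ i * f (axis i 1)\<bar>)" by simp
  also have "\<dots> \<le> (\<Sum>i\<in>(UNIV::'n set). norm v * B)"
    unfolding abs_mult using B component_le_norm_cart by (intro sum_mono mult_mono assms) auto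
  finally show ?thesis by (simp add: mult_ac)
qed

lemma hausdorff_converges_bounded:
  assumes "hausdorff_converges S S0" "bounded S0"
  obtains \<rho> where "\<forall>\<^sub>F j in sequentially. S j \<subseteq> cball 0 \<rho>" "0 < \<rho>" "\<forall>x\<in>S0. ball x 1 \<subseteq> cball 0 \<rho>"
proof -
  obtain a where a: "\<And>x. x \<in> S0 \<Longrightarrow> norm x \<le> a" "0 < a" using assms(2) bounded_pos by metis
  have *: "ball x 1 \<subseteq> cball 0 (a + 1)" if "x \<in> S0" for x
  proof
    fix y assume "y \<in> ball x 1"
    then show "y \<in> cball 0 (a + 1)"
      using a(1)[OF that] norm_triangle_ineq2[of y x] by (auto simp: dist_norm norm_minus_commute)
  qed
  have "\<forall>\<^sub>F j in sequentially. S j \<subseteq> cball 0 (a + 1)"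
  proof (rule eventually_mono)
    show "\<forall>\<^sub>F j in sequentially. S j \<subseteq> (\<Union>x\<in>S0. ball x 1) \<and> S0 \<subseteq> (\<Union>x\<in>S j. ball x 1)"
      using assms(1)[unfolded hausdorff_converges_def, rule_format, of 1] by simp
  qed (use * in blast)
  then show ?thesis using a * by (intro that[of "a + 1"]) auto
qed

text \<open>The upper bounds come from convergence in C1 on a common ball. For the lower bound, some
  component of \<open>\<eta>\<close> is nonzero at \<open>x0\<close>, hence away from 0 nearby for
  \<open>\<psi> j\<close> with \<open>j\<close> large; Hausdorff convergence supplies a point of
  \<open>S j\<close> near \<open>x0\<close>, and fatness a ball there of radius independent of
  \<open>j\<close>.\<close>

lemma inverse_bound_of_limit:
  fixes \<psi> :: "nat \<Rightarrow> 'n::finite form"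
  assumes S: "hausdorff_converges S S0" "bounded S0" "\<And>j. fat c C (S j)" and cC: "0 < c" "0 < C"
    and conv: "C1_converges \<psi> \<eta>"
    and \<psi>: "\<And>j vs x. (\<lambda>x. \<psi> j x vs) differentiable (at x)"
    and \<eta>: "\<And>vs A. continuous_on A (\<lambda>x. \<eta> x vs)"
      "\<And>vs v A. continuous_on A (\<lambda>x. frechet_derivative (\<lambda>y. \<eta> y vs) (at x) v)"
    and x0: "x0 \<in> S0" "comp_sq k (\<eta> x0) \<noteq> 0"
  obtains \<kappa> where "0 < \<kappa>" "\<forall>\<^sub>F j in sequentially. inverse_bound k \<kappa> (S j) (\<psi> j)"
proof -
  let ?IL = "{I :: 'n list. length I = k}"
  define E where "E = (map (\<lambda>i. axis i 1) :: 'n list \<Rightarrow> (real ^ 'n) list)"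
  obtain \<rho> where \<rho>: "\<forall>\<^sub>F j in sequentially. S j \<subseteq> cball 0 \<rho>" "0 < \<rho>" "\<forall>x\<in>S0. ball x 1 \<subseteq> cball 0 \<rho>"
    by (rule hausdorff_converges_bounded[OF S(1,2)])
  have bdd: "\<exists>M. \<forall>x\<in>cball 0 \<rho>. \<bar>f x\<bar> \<le> M" if "\<And>A. continuous_on A f" for f :: "real ^ 'n \<Rightarrow> real"
    using compact_continuous_image[OF that compact_cball, of 0 \<rho>]
    by (auto dest!: compact_imp_bounded simp: bounded_iff)
  have "\<forall>I. \<exists>M. \<forall>x\<in>cball 0 \<rho>. \<bar>\<eta> x (E I)\<bar> \<le> M"
    by (intro allI bdd \<eta>)
  then obtain M where M: "\<And>I x. x \<in> cball 0 \<rho> \<Longrightarrow> \<bar>\<eta> x (E I)\<bar> \<le> M I"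
    unfolding choice_iff by blast
  have "\<forall>I i. \<exists>M. \<forall>x\<in>cball 0 \<rho>. \<bar>frechet_derivative (\<lambda>y. \<eta> y (E I)) (at x) (axis i 1)\<bar> \<le> M"
    by (intro allI bdd \<eta>)
  then obtain M' where M': "\<And>I i x. x \<in> cball 0 \<rho> \<Longrightarrow>
      \<bar>frechet_derivative (\<lambda>y. \<eta> y (E I)) (at x) (axis i 1)\<bar> \<le> M' I i"
    unfolding choice_iff by blast
  \<comment> \<open>The added 1 here and in \<open>B'\<close> absorbs the error of the uniform
    convergence.\<close>
  define B where "B = Max (M ` ?IL) + 1"
  define B' where "B' = Max ((\<lambda>(I, i). M' I i) ` (?IL \<times> UNIV)) + 1"
  have MB: "M I + 1 \<le> B" if "length I = k" for I
    unfolding B_def using finite_index_lists[of k] that by (auto intro!: Max_ge)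
  have MB': "M' I i + 1 \<le> B'" if "length I = k" for I i
    unfolding B'_def using finite_index_lists[of k] that by (auto intro!: Max_ge finite_imageI finite_cartesian_product)
  have "\<exists>I0. length I0 = k \<and> \<eta> x0 (E I0) \<noteq> 0"
    using x0(2) unfolding comp_sq_def E_def by (metis (mono_tags, lifting) mem_Collect_eq power_zero_numeral sum.neutral)
  then obtain I0 where I0: "length I0 = k" "\<eta> x0 (E I0) \<noteq> 0" by auto
  \<comment> \<open>Of three equal parts of the nonzero component, one is lost by moving away from
    \<open>x0\<close>, one by passing from \<open>\<eta>\<close> to \<open>\<psi> j\<close>, and one
    remains.\<close>
  define \<epsilon> where "\<epsilon> = \<bar>\<eta> x0 (E I0)\<bar> / 3"
  have \<epsilon>: "0 < \<epsilon>" using I0 by (simp add: \<epsilon>_def)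
  have "continuous (at x0) (\<lambda>x. \<eta> x (E I0))"
    using \<eta>(1)[of UNIV] by (simp add: continuous_on_eq_continuous_at)
  then obtain \<delta>0 where \<delta>0: "0 < \<delta>0" "\<And>x. dist x x0 < \<delta>0 \<Longrightarrow> \<bar>\<eta> x (E I0) - \<eta> x0 (E I0)\<bar> < \<epsilon>"
    unfolding continuous_at_eps_delta using \<epsilon> by (auto simp: dist_real_def)
  define \<delta> where "\<delta> = min \<delta>0 1"
  have \<delta>: "0 < \<delta>" "\<delta> \<le> 1" "\<delta> \<le> \<delta>0" using \<delta>0 by (auto simp: \<delta>_def)
  have u1: "uniform_limit (cball 0 \<rho>) (\<lambda>j x. \<psi> j x vs) (\<lambda>x. \<eta> x vs) sequentially"
    and u2: "uniform_limit (cball 0 \<rho>) (\<lambda>j x. frechet_derivative (\<lambda>y. \<psi> j y vs) (at x) v)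
       (\<lambda>x. frechet_derivative (\<lambda>y. \<eta> y vs) (at x) v) sequentially" for vs v
    using conv unfolding C1_converges_def by auto
  have ev1: "\<forall>\<^sub>F j in sequentially. \<forall>I\<in>?IL. \<forall>x\<in>cball 0 \<rho>. \<bar>\<psi> j x (E I) - \<eta> x (E I)\<bar> < min 1 \<epsilon>"
    unfolding eventually_ball_finite_distrib[OF finite_index_lists]
    using u1[unfolded uniform_limit_iff dist_real_def, rule_format, of "min 1 \<epsilon>"] \<epsilon> by auto
  have ev2: "\<forall>\<^sub>F j in sequentially. \<forall>I\<in>?IL. \<forall>i\<in>UNIV. \<forall>x\<in>cball 0 \<rho>. \<bar>frechet_derivative (\<lambda>y. \<psi> j y (E I)) (at x) (axis i 1)
      - frechet_derivative (\<lambda>y. \<eta> y (E I)) (at x) (axis i 1)\<bar> < 1"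
    unfolding eventually_ball_finite_distrib[OF finite_index_lists] eventually_ball_finite_distrib[OF finite[of UNIV]]
    using u2[unfolded uniform_limit_iff dist_real_def, rule_format, of 1] by auto
  have ev3: "\<forall>\<^sub>F j in sequentially. S0 \<subseteq> (\<Union>x\<in>S j. ball x (\<delta> / 2))"
    using S(1)[unfolded hausdorff_converges_def, rule_format, of "\<delta> / 2"] \<delta> by (auto elim!: eventually_mono)
  \<comment> \<open>The ball provided by fatness then lies within \<open>\<delta> / 2\<close> of
    \<open>xj\<close>, hence within \<open>\<delta>\<close> of \<open>x0\<close>.\<close>
  define t where "t = min 1 (\<delta> / (2 * C))"
  have t: "0 < t" "t \<le> 1" "t * C \<le> \<delta> / 2" using \<delta> cC by (auto simp: t_def min_def field_simps)
  define K1 where "K1 = real (card ?IL) * B\<^sup>2 + 1"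
  define K2 where "K2 = real (card ?IL) * (CARD('n) * B')\<^sup>2 + 1"
  have K: "0 < K1" "0 < K2" by (auto simp: K1_def K2_def add_nonneg_pos)
  \<comment> \<open>The four entries serve the radius of the ball, the diameter, the sup bound and
    the Lipschitz bound, in this order.\<close>
  define \<kappa> where "\<kappa> = min (min (t * c) (1 / (2 * \<rho>))) (min (\<epsilon>\<^sup>2 / K1) (\<epsilon>\<^sup>2 / K2))"
  have \<kappa>: "0 < \<kappa>" "\<kappa> \<le> t * c" "\<kappa> * (2 * \<rho>) \<le> 1" "\<kappa> * K1 \<le> \<epsilon>\<^sup>2" "\<kappa> * K2 \<le> \<epsilon>\<^sup>2"
  proof -
    show "0 < \<kappa>" using t cC \<rho> \<epsilon> K by (auto simp: \<kappa>_def)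
    have "\<kappa> \<le> 1 / (2 * \<rho>)" "\<kappa> \<le> \<epsilon>\<^sup>2 / K1" "\<kappa> \<le> \<epsilon>\<^sup>2 / K2" by (auto simp: \<kappa>_def)
    then show "\<kappa> * (2 * \<rho>) \<le> 1" "\<kappa> * K1 \<le> \<epsilon>\<^sup>2" "\<kappa> * K2 \<le> \<epsilon>\<^sup>2"
      using \<rho> K by (auto simp: field_simps)
  qed (auto simp: \<kappa>_def)
  have "\<forall>\<^sub>F j in sequentially. inverse_bound k \<kappa> (S j) (\<psi> j)"
    using \<rho>(1) ev1 ev2 ev3
  proof eventually_elim
    case (elim j)
    have up: "comp_sq k (\<psi> j x) \<le> K1" if x: "x \<in> S j" for x
    proof -
      have "\<bar>\<psi> j x (E I)\<bar> \<le> B" if I: "length I = k" for I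
      proof -
        have "\<bar>\<psi> j x (E I) - \<eta> x (E I)\<bar> < min 1 \<epsilon>" "\<bar>\<eta> x (E I)\<bar> \<le> M I"
          using elim(1,2) x I M by auto
        then show ?thesis using MB[OF I] by linarith
      qed
      then show ?thesis unfolding K1_def using comp_sq_le[of k "\<psi> j x" B] by (simp add: E_def)
    qed
    have lip: "comp_sq k (\<lambda>vs. \<psi> j x vs - \<psi> j x' vs) \<le> K2 * (norm (x - x'))\<^sup>2"
      if seg: "closed_segment x x' \<subseteq> S j" for x x'
    proof -
      have "\<bar>\<psi> j x (E I) - \<psi> j x' (E I)\<bar> \<le> CARD('n) * B' * norm (x - x')" if I: "length I = k" for I
      proof -
        have "norm (\<psi> j x (E I) - \<psi> j x' (E I)) \<le> CARD('n) * B' * norm (x - x')"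
        proof (rule differentiable_bound[where S = "closed_segment x x'"])
          fix y assume y: "y \<in> closed_segment x x'"
          let ?f = "frechet_derivative (\<lambda>y. \<psi> j y (E I)) (at y)"
          show d: "((\<lambda>y. \<psi> j y (E I)) has_derivative ?f) (at y within closed_segment x x')"
            using \<psi>[of j "E I" y] by (simp add: frechet_derivative_works has_derivative_at_withinI)
          have lin: "linear ?f" by (rule linear_frechet_derivative[OF \<psi>])
          have "\<bar>?f (axis i 1)\<bar> \<le> B'" for i
          proof -
            have "y \<in> cball 0 \<rho>" using y seg elim(1) by auto
            then have "\<bar>?f (axis i 1) - frechet_derivative (\<lambda>y. \<eta> y (E I)) (at y) (axis i 1)\<bar> < 1"
              "\<bar>frechet_derivative (\<lambda>y. \<eta> y (E I)) (at y) (axis i 1)\<bar> \<le> M' I i"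
              using elim(3) I M' by auto
            then show ?thesis using MB'[OF I, of i] by linarith
          qed
          from linear_le_of_axis_le[OF lin this] show "onorm ?f \<le> CARD('n) * B'"
            by (intro onorm_le) simp
        qed auto
        then show ?thesis by simp
      qed
      then have "comp_sq k (\<lambda>vs. \<psi> j x vs - \<psi> j x' vs) \<le> real (card ?IL) * (CARD('n) * B' * norm (x - x'))\<^sup>2"
        by (intro comp_sq_le) (simp add: E_def)
      also have "\<dots> \<le> K2 * (norm (x - x'))\<^sup>2"
        by (simp add: K2_def power_mult_distrib algebra_simps)
      finally show ?thesis .
    qed
    obtain xj where xj: "xj \<in> S j" "dist xj x0 < \<delta> / 2" using elim(4) x0(1) by auto
    obtain b where b: "ball b (t * c) \<subseteq> S j \<inter> cball xj (t * C)"
      using fat_small_ball[OF S(3) xj(1) t(1,2)] .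
    have low: "\<epsilon>\<^sup>2 \<le> comp_sq k (\<psi> j y)" if y: "y \<in> ball b (t * c)" for y
    proof -
      have "dist y x0 \<le> dist xj y + dist xj x0" by (rule dist_triangle3)
      also have "dist xj y \<le> \<delta> / 2" using y b t by auto
      finally have yx: "dist y x0 < \<delta>" using xj(2) by simp
      then have "\<bar>\<eta> y (E I0) - \<eta> x0 (E I0)\<bar> < \<epsilon>" using \<delta>0(2) \<delta>(3) by simp
      moreover have "y \<in> cball 0 \<rho>" using elim(1) y b by blast
      then have "\<bar>\<psi> j y (E I0) - \<eta> y (E I0)\<bar> < min 1 \<epsilon>"
        using elim(2) I0 by blast
      ultimately have "\<epsilon> \<le> \<bar>\<psi> j y (E I0)\<bar>" unfolding \<epsilon>_def by linarith
      then have "\<epsilon>\<^sup>2 \<le> (\<psi> j y (E I0))\<^sup>2" using \<epsilon> power_mono[of \<epsilon> "\<bar>\<psi> j y (E I0)\<bar>" 2] by simp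
      also have "\<dots> \<le> comp_sq k (\<psi> j y)" unfolding E_def by (rule comp_sq_ge[OF I0(1)])
      finally show ?thesis .
    qed
    have sub: "ball b \<kappa> \<subseteq> ball b (t * c)" using \<kappa> by (intro subset_ball)
    show ?case unfolding inverse_bound_def
    proof (intro conjI ballI exI[of _ b] impI allI)
      fix x y assume "x \<in> S j" "y \<in> S j"
      then have "norm x \<le> \<rho>" "norm y \<le> \<rho>" using elim(1) by auto
      then have "norm (x - y) \<le> 2 * \<rho>" using norm_triangle_ineq4[of x y] by linarith
      then have "\<kappa> * norm (x - y) \<le> \<kappa> * (2 * \<rho>)" using \<kappa>(1) by (intro mult_left_mono) auto
      then show "\<kappa> * norm (x - y) \<le> 1" using \<kappa>(3) by (rule order_trans)
    next
      show "ball b \<kappa> \<subseteq> S j" using sub b by auto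
    next
      fix y x assume y: "y \<in> ball b \<kappa>" and x: "x \<in> S j"
      have "\<kappa> * comp_sq k (\<psi> j x) \<le> \<kappa> * K1" using up[OF x] \<kappa>(1) by (intro mult_left_mono) auto
      then show "\<kappa> * comp_sq k (\<psi> j x) \<le> comp_sq k (\<psi> j y)" using low[of y] y sub \<kappa>(4) by auto
    next
      fix y x x' assume y: "y \<in> ball b \<kappa>" and seg: "closed_segment x x' \<subseteq> S j"
      have "\<kappa> * comp_sq k (\<lambda>vs. \<psi> j x vs - \<psi> j x' vs) \<le> \<kappa> * (K2 * (norm (x - x'))\<^sup>2)"
        using lip[OF seg] \<kappa>(1) by (intro mult_left_mono) auto
      also have "\<dots> = (norm (x - x'))\<^sup>2 * (\<kappa> * K2)" by simp
      also have "\<dots> \<le> (norm (x - x'))\<^sup>2 * comp_sq k (\<psi> j y)"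
        using low[of y] y sub \<kappa>(5) by (intro mult_left_mono) auto
      finally show "\<kappa> * comp_sq k (\<lambda>vs. \<psi> j x vs - \<psi> j x' vs) \<le> (norm (x - x'))\<^sup>2 * comp_sq k (\<psi> j y)" .
    qed
  qed
  then show ?thesis using \<kappa>(1) by (rule that[rotated])
qed

section \<open>Subsequences and limits of linear combinations of forms\<close>

lemma C1_converges_subseq:
  assumes "C1_converges \<omega> \<eta>" "strict_mono r"
  shows "C1_converges (\<lambda>j. \<omega> (r j)) \<eta>"
  using assms(1) filterlim_compose[OF _ filterlim_subseq[OF assms(2)]]
  unfolding C1_converges_def by blast

lemma hausdorff_converges_subseq:
  assumes "hausdorff_converges S S0" "strict_mono r"
  shows "hausdorff_converges (\<lambda>j. S (r j)) S0"
  using assms(1) eventually_subseq[OF assms(2)]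
  unfolding hausdorff_converges_def by fast

lemma uniform_limit_combination:
  fixes f :: "nat \<Rightarrow> nat \<Rightarrow> 'a::topological_space \<Rightarrow> real"
  assumes c: "\<And>i. i < N \<Longrightarrow> (\<lambda>j. c j i) \<longlonglongrightarrow> cl i"
    and f: "\<And>i. i < N \<Longrightarrow> uniform_limit A (\<lambda>j x. f j i x) (g i) sequentially"
    and g: "\<And>i. i < N \<Longrightarrow> continuous_on A (g i)" and A: "compact A"
  shows "uniform_limit A (\<lambda>j x. \<Sum>i<N. c j i * f j i x) (\<lambda>x. \<Sum>i<N. cl i * g i x) sequentially"
  using c f g
proof (induction N)
  case (Suc N)
  have "uniform_limit A (\<lambda>j x. c j N) (\<lambda>x. cl N) sequentially"
    using Suc.prems(1)[of N] by (intro uniform_limitI) (auto simp: tendsto_iff elim!: eventually_mono)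
  moreover have "bounded (g N ` A)"
    using Suc.prems(3)[of N] A by (intro compact_imp_bounded compact_continuous_image) auto
  ultimately have "uniform_limit A (\<lambda>j x. c j N * f j N x) (\<lambda>x. cl N * g N x) sequentially"
    using Suc.prems(2)[of N] by (intro uniform_lim_mult) (auto intro: bounded_subset[of "{cl N}"])
  moreover have "uniform_limit A (\<lambda>j x. \<Sum>i<N. c j i * f j i x) (\<lambda>x. \<Sum>i<N. cl i * g i x) sequentially"
    using Suc by auto
  ultimately show ?case by (simp add: uniform_limit_add)
qed (simp add: uniform_limit_const)

lemma frechet_derivative_combination:
  fixes f :: "nat \<Rightarrow> 'a::real_normed_vector \<Rightarrow> real"
  assumes "\<And>i. i < N \<Longrightarrow> f i differentiable (at x)"
  shows "((\<lambda>x. \<Sum>i<N. c i * f i x) has_derivative (\<lambda>v. \<Sum>i<N. c i * frechet_derivative (f i) (at x) v)) (at x)"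
  using assms
  by (intro has_derivative_sum has_derivative_mult_right) (simp add: frechet_derivative_works)

lemma C1_converges_combination:
  fixes \<omega> :: "nat \<Rightarrow> nat \<Rightarrow> 'n::finite form"
  assumes c: "\<And>i. i < N \<Longrightarrow> (\<lambda>j. c j i) \<longlonglongrightarrow> cl i"
    and \<omega>: "\<And>i. i < N \<Longrightarrow> C1_converges (\<lambda>j. \<omega> j i) (\<eta> i)"
    and smooth: "\<And>i vs. i < N \<Longrightarrow> smooth (\<lambda>x. \<eta> i x vs)" "\<And>i j vs. i < N \<Longrightarrow> smooth (\<lambda>x. \<omega> j i x vs)"
  shows "C1_converges (\<lambda>j x vs. \<Sum>i<N. c j i * \<omega> j i x vs) (\<lambda>x vs. \<Sum>i<N. cl i * \<eta> i x vs)"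
  unfolding C1_converges_def
proof (intro allI conjI)
  fix r and vs :: "(real ^ 'n) list" and v
  show "uniform_limit (cball 0 r) (\<lambda>j x. \<Sum>i<N. c j i * \<omega> j i x vs) (\<lambda>x. \<Sum>i<N. cl i * \<eta> i x vs) sequentially"
    using \<omega> smooth by (intro uniform_limit_combination c) (auto simp: C1_converges_def smooth_continuous)
  have d: "frechet_derivative (\<lambda>y. \<Sum>i<N. c j i * \<omega> j i y vs) (at x) v =
      (\<Sum>i<N. c j i * frechet_derivative (\<lambda>y. \<omega> j i y vs) (at x) v)" for j x
    using frechet_derivative_combination[of N "\<lambda>i y. \<omega> j i y vs" x "c j"] smooth
    by (simp add: smooth_differentiable frechet_derivative_at[symmetric])
  have d': "frechet_derivative (\<lambda>y. \<Sum>i<N. cl i * \<eta> i y vs) (at x) v =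
      (\<Sum>i<N. cl i * frechet_derivative (\<lambda>y. \<eta> i y vs) (at x) v)" for x
    using frechet_derivative_combination[of N "\<lambda>i y. \<eta> i y vs" x cl] smooth
    by (simp add: smooth_differentiable frechet_derivative_at[symmetric])
  show "uniform_limit (cball 0 r) (\<lambda>j x. frechet_derivative (\<lambda>y. \<Sum>i<N. c j i * \<omega> j i y vs) (at x) v)
       (\<lambda>x. frechet_derivative (\<lambda>y. \<Sum>i<N. cl i * \<eta> i y vs) (at x) v) sequentially"
    unfolding d d'
    using \<omega> smooth by (intro uniform_limit_combination c) (auto simp: C1_converges_def smooth_deriv_continuous)
qed

lemma bounded_family_subseq:
  fixes c :: "nat \<Rightarrow> nat \<Rightarrow> real"
  assumes "\<And>i j. i < N \<Longrightarrow> \<bar>c j i\<bar> \<le> B"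
  obtains r cl where "strict_mono (r :: nat \<Rightarrow> nat)" "\<And>i. i < N \<Longrightarrow> (\<lambda>j. c (r j) i) \<longlonglongrightarrow> cl i"
proof -
  have "\<exists>r cl. strict_mono (r :: nat \<Rightarrow> nat) \<and> (\<forall>i<N. (\<lambda>j. c (r j) i) \<longlonglongrightarrow> cl i)"
    using assms
  proof (induction N)
    case 0
    then show ?case by (intro exI[of _ id]) (auto simp: strict_mono_def)
  next
    case (Suc N)
    then obtain r cl where r: "strict_mono (r :: nat \<Rightarrow> nat)" "\<forall>i<N. (\<lambda>j. c (r j) i) \<longlonglongrightarrow> cl i"
      by (metis less_SucI)
    have "bounded (range (\<lambda>j. c (r j) N))"
      using Suc.prems by (intro boundedI[of _ B]) auto
    then obtain l r' where r': "strict_mono r'" "((\<lambda>j. c (r j) N) \<circ> r') \<longlonglongrightarrow> l"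
      using bounded_imp_convergent_subsequence by blast
    have "(\<lambda>j. c ((r \<circ> r') j) i) \<longlonglongrightarrow> (cl(N := l)) i" if "i < Suc N" for i
    proof (cases "i = N")
      case True
      then show ?thesis using r'(2) by (simp add: o_def)
    next
      case False
      then have "(\<lambda>j. c (r j) i) \<longlonglongrightarrow> cl i" using r(2) that by simp
      from LIMSEQ_subseq_LIMSEQ[OF this r'(1)] show ?thesis using False by (simp add: o_def)
    qed
    then show ?case using strict_mono_o[OF r(1) r'(1)] by blast
  qed
  then show ?thesis using that by blast
qed

text \<open>Independence in the limit space only yields some argument list on which a combination is
  nonzero. This lemma converts that into a nonzero \<open>comp_sq\<close>, which looks at basis
  vectors alone.\<close>

lemma smooth_form_combination_eq_0:
  fixes \<eta> :: "nat \<Rightarrow> 'n::finite form"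
  assumes "\<And>i. i < N \<Longrightarrow> smooth_form k (\<eta> i)"
    and 0: "comp_sq k (\<lambda>vs. \<Sum>i<N. c i * \<eta> i x vs) = 0"
  shows "(\<Sum>i<N. c i * \<eta> i x vs) = 0"
proof (cases "length vs = k")
  case True
  show ?thesis
  proof (rule multilinear_eq_0[of "\<lambda>vs. \<Sum>i<N. c i * \<eta> i x vs", OF _ _ True])
    fix vs :: "(real ^ 'n) list" and m assume m: "m < length vs"
    have "linear (\<lambda>v. \<eta> i x (vs[m := v]))" if "i < N" for i
      using assms(1)[OF that] m by (auto simp: smooth_form_def alternating_def)
    then have "linear (\<lambda>v. c i *\<^sub>R \<eta> i x (vs[m := v]))" if "i < N" for i
      using that by (intro linear_compose_scale_right) auto
    then show "linear (\<lambda>v. \<Sum>i<N. c i * \<eta> i x (vs[m := v]))"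
      by (intro linear_compose_sum) auto
  next
    fix I :: "'n list" assume I: "length I = k"
    have "(\<Sum>i<N. c i * \<eta> i x (map (\<lambda>i. axis i 1) I))\<^sup>2 \<le> 0"
      using comp_sq_ge[OF I, of "\<lambda>vs. \<Sum>i<N. c i * \<eta> i x vs"] 0 by simp
    then show "(\<Sum>i<N. c i * \<eta> i x (map (\<lambda>i. axis i 1) I)) = 0" by simp
  qed
next
  case False
  then have "\<eta> i x vs = 0" if "i < N" for i
    using assms(1)[OF that] by (auto simp: smooth_form_def homogeneous_def)
  then show ?thesis by simp
qed

section \<open>The compactness argument on macro-elements\<close>

lemma is_cell_nonempty:
  assumes "is_cell T" shows "T \<noteq> {}"
proof -
  obtain V :: "(real ^ 'a) set" where V: "subspace V" "(V \<inter> cball 0 1) homeomorphic T"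
    using assms by (auto simp: is_cell_def)
  have "0 \<in> V \<inter> cball 0 1" using V(1) by (simp add: subspace_0)
  then show ?thesis using V(2) homeomorphic_empty(2) by blast
qed

lemma compact_cell:
  assumes "is_cell T" shows "compact T"
proof -
  obtain V :: "(real ^ 'a) set" where V: "subspace V" "(V \<inter> cball 0 1) homeomorphic T"
    using assms by (auto simp: is_cell_def)
  then show ?thesis
    using homeomorphic_compactness closed_Int_compact[OF closed_subspace compact_cball] by metis
qed

text \<open>Subsequences are extracted for the macro-elements, for the position of the cell in the
  list, and for the normalised coefficients of the forms. The bound therefore holds for infinitely
  many \<open>j\<close> only, which is enough to refute a sequence of counterexamples.\<close>

lemma compact_family_inverse_bound:
  fixes \<K> :: "('n::finite) macro set" and k :: nat
  assumes \<K>: "compact_family \<K>" "\<And>j. Ms j \<in> \<K>"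
    and idx: "\<And>j. idx j < length (Ms j)"
    and fat: "\<And>j. fat c0 C0 (fst (Ms j ! idx j))" "\<And>j. fst (Ms j ! idx j) \<noteq> {}" and cC: "0 < c0" "0 < C0"
    and \<phi>: "\<And>j. \<phi> j \<in> snd (Ms j ! idx j) k"
  obtains \<kappa> where "0 < \<kappa>" "\<exists>\<^sub>F j in sequentially. inverse_bound k \<kappa> (fst (Ms j ! idx j)) (\<phi> j)"
proof -
  obtain M r where M: "M \<in> \<K>" "strict_mono r" "macro_converges (Ms \<circ> r) M"
    using \<K> unfolding compact_family_def by metis
  \<comment> \<open>Along \<open>r\<close> the lists have eventually constant length, so one
    position \<open>a\<close> occurs infinitely often.\<close>
  have "\<forall>\<^sub>F j in sequentially. \<exists>a\<in>{..<length M}. idx (r j) = a"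
  proof (rule eventually_mono)
    show "\<forall>\<^sub>F j in sequentially. length (Ms (r j)) = length M"
      using M(3) unfolding macro_converges_def by (auto elim!: eventually_mono)
  qed (use idx[of "r _"] in \<open>metis lessThan_iff\<close>)
  then have "\<exists>\<^sub>F j in sequentially. \<exists>a\<in>{..<length M}. idx (r j) = a"
    by (intro eventually_frequently sequentially_bot)
  then obtain a where a: "a < length M" "\<exists>\<^sub>F j in sequentially. idx (r j) = a"
    unfolding frequently_bex_finite_distrib[OF finite_lessThan] by blast
  define T0 where "T0 = fst (M ! a)"
  define S where "S = (\<lambda>j. fst (Ms (r j) ! a))"
  define Y where "Y = (\<lambda>j. snd (Ms (r j) ! a) k)"
  have haus: "hausdorff_converges S T0" and spc: "spaces_converge k S Y T0 (snd (M ! a) k)"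
    using M(3) a(1) unfolding macro_converges_def S_def Y_def T0_def o_def by auto
  have "is_cell T0"
    using \<K>(1) M(1) a(1) unfolding compact_family_def macro_element_def cell_complex_def T0_def by auto
  then have "compact T0" by (rule compact_cell)
  then have bT0: "bounded T0" by (rule compact_imp_bounded)
  obtain N \<omega> \<eta> where N: "\<And>i. i < N \<Longrightarrow> smooth_form k (\<eta> i)" "\<And>i j. i < N \<Longrightarrow> smooth_form k (\<omega> j i)"
      "\<And>i. i < N \<Longrightarrow> C1_converges (\<lambda>j. \<omega> j i) (\<eta> i)"
      "form_independent N (\<lambda>i. pullback T0 (\<eta> i))"
      "\<forall>\<^sub>F j in sequentially. Y j = form_span N (\<lambda>i. pullback (S j) (\<omega> j i))"
    using spc unfolding spaces_converge_def by blast
  have "\<exists>\<^sub>F j in sequentially. idx (r j) = a \<and> Y j = form_span N (\<lambda>i. pullback (S j) (\<omega> j i))"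
    using frequently_eventually_conj[OF a(2) N(5)] by (simp add: conj_commute)
  then have "infinite {j. idx (r j) = a \<and> Y j = form_span N (\<lambda>i. pullback (S j) (\<omega> j i))}"
    by (simp add: cofinite_eq_sequentially[symmetric] frequently_cofinite)
  then obtain r2 :: "nat \<Rightarrow> nat" where "strict_mono r2"
      "\<forall>j. r2 j \<in> {j. idx (r j) = a \<and> Y j = form_span N (\<lambda>i. pullback (S j) (\<omega> j i))}"
    using infinite_enumerate by blast
  then have r2: "strict_mono r2" "\<And>j. idx (r (r2 j)) = a"
      "\<And>j. Y (r2 j) = form_span N (\<lambda>i. pullback (S (r2 j)) (\<omega> (r2 j) i))"
    by simp_all
  define S2 where "S2 = (\<lambda>j. S (r2 j))"
  have S2: "S2 j = fst (Ms (r (r2 j)) ! idx (r (r2 j)))" for j by (simp add: S2_def S_def r2)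
  have fat2: "fat c0 C0 (S2 j)" "S2 j \<noteq> {}" for j unfolding S2 by (rule fat)+
  have haus2: "hausdorff_converges S2 T0"
    unfolding S2_def by (rule hausdorff_converges_subseq[OF haus r2(1)])
  \<comment> \<open>On a fat cell the pullbacks are the smooth forms themselves, so the expansion of
    the given form holds for all argument lists.\<close>
  have "\<exists>c. \<forall>x\<in>S2 j. \<forall>vs. \<phi> (r (r2 j)) x vs = (\<Sum>i<N. c i * \<omega> (r2 j) i x vs)" for j
  proof -
    have "\<phi> (r (r2 j)) \<in> Y (r2 j)" using \<phi>[of "r (r2 j)"] by (simp add: Y_def r2)
    then obtain c where "\<phi> (r (r2 j)) = (\<lambda>x vs. \<Sum>i<N. c i * pullback (S (r2 j)) (\<omega> (r2 j) i) x vs)"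
      unfolding r2(3) form_span_def by auto
    then show ?thesis
      using fat_tangent[OF fat2(1) cC(1)] by (intro exI[of _ c]) (simp add: pullback_def S2_def)
  qed
  then obtain c where c: "\<And>j x vs. x \<in> S2 j \<Longrightarrow> \<phi> (r (r2 j)) x vs = (\<Sum>i<N. c j i * \<omega> (r2 j) i x vs)"
    by metis
  note goal = that
  \<comment> \<open>A bound that holds eventually along some further subsequence is incompatible
    with eventual failure along the original sequence.\<close>
  have conclude: "thesis" if "strict_mono r3" "0 < \<kappa>" "\<forall>\<^sub>F j in sequentially. inverse_bound k \<kappa> (S2 (r3 j)) (\<phi> (r (r2 (r3 j))))" for \<kappa> r3
  proof (rule goal[of \<kappa>])
    show "\<exists>\<^sub>F j in sequentially. inverse_bound k \<kappa> (fst (Ms j ! idx j)) (\<phi> j)"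
    proof (rule ccontr)
      assume "\<not> ?thesis"
      then have "\<forall>\<^sub>F j in sequentially. \<not> inverse_bound k \<kappa> (fst (Ms j ! idx j)) (\<phi> j)"
        by (simp add: not_frequently)
      from eventually_subseq[OF strict_mono_o[OF M(2) strict_mono_o[OF r2(1) that(1)]] this]
      have "\<forall>\<^sub>F j in sequentially. \<not> inverse_bound k \<kappa> (S2 (r3 j)) (\<phi> (r (r2 (r3 j))))"
        by (simp add: S2)
      with that(3) have "\<forall>\<^sub>F j in sequentially. False" by eventually_elim simp
      then show False by simp
    qed
  qed (fact that(2))
  show ?thesis
  proof (cases "N = 0")
    \<comment> \<open>The local spaces are zero and there are no coefficients to normalise; only the
      diameter and the ball have to be provided.\<close>
    case True
    obtain \<rho> where \<rho>: "\<forall>\<^sub>F j in sequentially. S2 j \<subseteq> cball 0 \<rho>" "0 < \<rho>"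
      by (rule hausdorff_converges_bounded[OF haus2 bT0])
    define \<kappa> where "\<kappa> = min c0 (1 / (2 * \<rho>))"
    have \<kappa>: "0 < \<kappa>" "\<kappa> \<le> c0" "\<kappa> * (2 * \<rho>) \<le> 1"
      using cC \<rho>(2) by (auto simp: \<kappa>_def min_def field_simps)
    have "\<forall>\<^sub>F j in sequentially. inverse_bound k \<kappa> (S2 (id j)) (\<phi> (r (r2 (id j))))"
      using \<rho>(1)
    proof eventually_elim
      case (elim j)
      obtain x where x: "x \<in> S2 j" using fat2 by auto
      obtain b where b: "ball b (1 * c0) \<subseteq> S2 j \<inter> cball x (1 * C0)"
        by (rule fat_small_ball[OF fat2(1) x]) auto
      have "ball b \<kappa> \<subseteq> ball b c0" using \<kappa> by (intro subset_ball)
      then have b': "ball b \<kappa> \<subseteq> S2 j" using b by auto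
      have "inverse_bound k \<kappa> (S2 j) (\<lambda>x vs. 0)"
        unfolding inverse_bound_def
      proof (intro conjI ballI exI[of _ b] impI allI b')
        fix x y assume "x \<in> S2 j" "y \<in> S2 j"
        then have "norm x \<le> \<rho>" "norm y \<le> \<rho>" using elim by auto
        then have "norm (x - y) \<le> 2 * \<rho>" using norm_triangle_ineq4[of x y] by linarith
        then have "\<kappa> * norm (x - y) \<le> \<kappa> * (2 * \<rho>)" using \<kappa>(1) by (intro mult_left_mono) auto
        then show "\<kappa> * norm (x - y) \<le> 1" using \<kappa>(3) by (rule order_trans)
      qed (auto simp: comp_sq_def)
      then show ?case unfolding id_apply by (rule inverse_bound_scaled[where t = 1]) (simp add: c True)
    qed
    then show ?thesis using \<kappa>(1) by (intro conclude[of id \<kappa>]) (auto simp: strict_mono_def)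
  next
    case False
    define n where "n = (\<lambda>j. \<Sum>i<N. \<bar>c j i\<bar>)"
    \<comment> \<open>If \<open>n j = 0\<close>, any unit vector \<open>d j\<close> satisfies \<open>c j = n j * d j\<close>.\<close>
    define d where "d = (\<lambda>j i. if n j = 0 then (if i = 0 then 1 else 0) else c j i / n j)"
    have n0: "0 \<le> n j" for j unfolding n_def by (rule sum_nonneg) simp
    have cd: "c j i = n j * d j i" if "i < N" for i j
      using that by (auto simp: d_def n_def sum_nonneg_eq_0_iff)
    have d1: "(\<Sum>i<N. \<bar>d j i\<bar>) = 1" for j
    proof (cases "n j = 0")
      case True
      then show ?thesis using False by (simp add: d_def if_distrib[of abs] sum.delta cong: if_cong)
    next
      case nz: False
      have "(\<Sum>i<N. \<bar>d j i\<bar>) = (\<Sum>i<N. \<bar>c j i\<bar>) / n j"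
        using nz n0[of j] by (simp add: d_def abs_divide sum_divide_distrib)
      then show ?thesis using nz by (simp add: n_def)
    qed
    have "\<bar>d j i\<bar> \<le> 1" if "i < N" for i j
      unfolding d1[of j, symmetric] using that by (intro member_le_sum) auto
    then obtain r3 cl where r3: "strict_mono (r3 :: nat \<Rightarrow> nat)" "\<And>i. i < N \<Longrightarrow> (\<lambda>j. d (r3 j) i) \<longlonglongrightarrow> cl i"
      using bounded_family_subseq[of N d 1] by metis
    \<comment> \<open>The normalisation to total absolute value 1 passes to the limit, so the limit
      coefficients are not all 0.\<close>
    have "(\<lambda>j. \<Sum>i<N. \<bar>d (r3 j) i\<bar>) \<longlonglongrightarrow> (\<Sum>i<N. \<bar>cl i\<bar>)"
      using r3(2) by (intro tendsto_sum tendsto_rabs) auto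
    then have "(\<Sum>i<N. \<bar>cl i\<bar>) = 1" unfolding d1 by (simp add: LIMSEQ_const_iff)
    then have "\<not> (\<forall>i<N. cl i = 0)"
      using sum.neutral[of "{..<N}" "\<lambda>i. \<bar>cl i\<bar>"] by fastforce
    then have "(\<lambda>x vs. \<Sum>i<N. cl i * pullback T0 (\<eta> i) x vs) \<noteq> zero_form"
      using N(4) unfolding form_independent_def by blast
    then obtain x0 vs0 where x0: "(\<Sum>i<N. cl i * pullback T0 (\<eta> i) x0 vs0) \<noteq> 0"
      by (auto simp: zero_form_def fun_eq_iff)
    \<comment> \<open>A pullback vanishes on lists that are not tangent. Thus the nonzero value is
      attained at a point \<open>x0\<close> of \<open>T0\<close>, where the pullbacks agree with the
      smooth forms.\<close>
    then have tan: "tangent_to T0 x0 vs0"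
      by (cases "tangent_to T0 x0 vs0") (simp_all add: pullback_def)
    then have xT0: "x0 \<in> T0" by (auto simp: tangent_to_def)
    have nz: "comp_sq k (\<lambda>vs. \<Sum>i<N. cl i * \<eta> i x0 vs) \<noteq> 0"
      using smooth_form_combination_eq_0[where c = cl and \<eta> = \<eta> and x = x0 and vs = vs0, OF N(1)] x0 tan
      by (auto simp: pullback_def)
    have sm: "smooth (\<lambda>x. \<eta> i x vs)" "smooth (\<lambda>x. \<omega> j i x vs)" if "i < N" for i j vs
      using N(1,2)[OF that] by (auto simp: smooth_form_def)
    define \<psi> where "\<psi> = (\<lambda>j x vs. \<Sum>i<N. d (r3 j) i * \<omega> (r2 (r3 j)) i x vs)"
    define \<zeta> where "\<zeta> = (\<lambda>x vs. \<Sum>i<N. cl i * \<eta> i x vs)"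
    have conv: "C1_converges \<psi> \<zeta>"
      unfolding \<psi>_def \<zeta>_def
      using C1_converges_subseq[OF N(3) strict_mono_o[OF r2(1) r3(1)]]
      by (intro C1_converges_combination r3 sm) (auto simp: o_def)
    have haus3: "hausdorff_converges (\<lambda>j. S2 (r3 j)) T0"
      by (rule hausdorff_converges_subseq[OF haus2 r3(1)])
    have dif: "(\<lambda>x. \<psi> j x vs) differentiable (at x)" for j vs x
      unfolding \<psi>_def
      by (rule differentiableI[OF frechet_derivative_combination]) (rule smooth_differentiable[OF sm(2)])
    have cont: "continuous_on A (\<lambda>x. \<zeta> x vs)" for A vs
      unfolding \<zeta>_def using sm(1) by (intro continuous_intros smooth_continuous) auto
    have cont': "continuous_on A (\<lambda>x. frechet_derivative (\<lambda>y. \<zeta> y vs) (at x) v)" for A vs v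
    proof -
      have "frechet_derivative (\<lambda>y. \<zeta> y vs) (at x) v =
        (\<Sum>i<N. cl i * frechet_derivative (\<lambda>y. \<eta> i y vs) (at x) v)" for x
        unfolding \<zeta>_def using frechet_derivative_combination[of N "\<lambda>i y. \<eta> i y vs" x cl] sm(1)
        by (simp add: smooth_differentiable frechet_derivative_at[symmetric])
      then show ?thesis using sm(1) by (auto intro!: continuous_intros smooth_deriv_continuous)
    qed
    obtain \<kappa> where \<kappa>: "0 < \<kappa>" "\<forall>\<^sub>F j in sequentially. inverse_bound k \<kappa> (S2 (r3 j)) (\<psi> j)"
      by (rule inverse_bound_of_limit[OF haus3 bT0 fat2(1) cC conv dif cont cont' xT0])
        (use nz in \<open>simp_all add: \<zeta>_def\<close>)
    have "\<forall>\<^sub>F j in sequentially. inverse_bound k \<kappa> (S2 (r3 j)) (\<phi> (r (r2 (r3 j))))"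
      using \<kappa>(2)
      by eventually_elim
        (erule inverse_bound_scaled[where t = "n (r3 _)"], simp add: c cd \<psi>_def sum_distrib_left mult.assoc)
    then show ?thesis by (rule conclude[OF r3(1) \<kappa>(1)])
  qed
qed

section \<open>Geometry of the refined meshes\<close>

text \<open>A ball inside \<open>T\<close> forces the model subspace \<open>V\<close> to be the
  whole space, by invariance of dimension. Then the image of the open unit ball is open, by
  invariance of domain, and dense in \<open>T\<close>. This rules out lower dimensional pieces
  attached to a full-dimensional cell.\<close>

lemma cell_subset_closure_interior:
  fixes T :: "(real ^ 'n::finite) set"
  assumes T: "is_cell T" and B: "ball a r \<subseteq> T" "0 < r"
  shows "T \<subseteq> closure (interior T)"
proof -
  obtain V :: "(real ^ 'n) set" where V: "subspace V" "(V \<inter> cball 0 1) homeomorphic T"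
    using T by (auto simp: is_cell_def)
  obtain f g where fg: "homeomorphism (V \<inter> cball 0 1) T f g"
    using V(2) by (auto simp: homeomorphic_def)
  have sub: "g ` ball a r \<subseteq> V \<inter> cball 0 1" using fg B(1) by (auto simp: homeomorphism_def)
  have "homeomorphism (ball a r) (g ` ball a r) g f"
    by (rule homeomorphism_of_subsets[OF homeomorphism_symD[OF fg] B(1) sub refl])
  then have "ball a r homeomorphic g ` ball a r"
    unfolding homeomorphic_def by blast
  then have "aff_dim (ball a r) \<le> aff_dim (g ` ball a r)"
    by (intro homeomorphic_convex_sets_le) auto
  also have "aff_dim (g ` ball a r) \<le> aff_dim V" using sub by (intro aff_dim_subset) blast
  also have "aff_dim V = int (dim V)" using V(1) by (rule aff_dim_subspace)
  finally have "DIM(real ^ 'n) \<le> dim V" using B(2) by (simp add: aff_dim_open)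
  then have "dim V = DIM(real ^ 'n)" using dim_subset_UNIV[of V] by linarith
  then have "span V = UNIV" by (rule dim_eq_full[THEN iffD1])
  then have "V = UNIV" using V(1) span_eq_iff by blast
  with fg have h: "homeomorphism (cball 0 1) T f g" by simp
  have "open (f ` ball 0 1)"
    using h by (intro invariance_of_domain)
      (auto simp: homeomorphism_def inj_on_def intro: continuous_on_subset, metis mem_ball_0 less_imp_le mem_cball_0)
  moreover have "f ` ball 0 1 \<subseteq> T" using h by (auto simp: homeomorphism_def)
  ultimately have "f ` ball 0 1 \<subseteq> interior T" by (rule interior_maximal[rotated])
  moreover have "T \<subseteq> closure (f ` ball 0 1)"
  proof -
    have "T = f ` closure (ball 0 1)" using h by (simp add: homeomorphism_def)
    also have "\<dots> \<subseteq> closure (f ` ball 0 1)"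
      using h by (intro image_closure_subset) (auto simp: homeomorphism_def closure_subset)
    finally show ?thesis .
  qed
  ultimately show ?thesis using closure_mono by blast
qed

lemma negligible_AE_lborel:
  assumes "negligible S" shows "AE x in lborel. x \<notin> S"
proof -
  have "AE x in lebesgue. x \<notin> S"
    using assms by (intro AE_not_in) (simp add: negligible_iff_null_sets)
  then show ?thesis by (simp add: AE_completion_iff)
qed

lemma negligible_of_aff_dim_less:
  fixes S :: "'a::euclidean_space set"
  assumes "convex S" "aff_dim S < int DIM('a)"
  shows "negligible S"
proof -
  have "interior S = {}"
  proof (rule ccontr)
    assume "interior S \<noteq> {}"
    then have "aff_dim S = aff_dim (UNIV :: 'a set)"
      using affine_hull_nonempty_interior[of S] aff_dim_affine_hull[of S] by simp
    then show False using assms(2) by (simp add: aff_dim_UNIV)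
  qed
  then show ?thesis using assms(1) by (simp add: negligible_convex_interior)
qed

section \<open>Cells modulo the lattice and simplices of full dimension\<close>

context torus_lattice begin

text \<open>Every cell is a lattice translate of one of the finitely many cells that meet the
  fundamental domain. Countability lets statements about single cells hold almost everywhere for all
  cells at once.\<close>

lemma torus_complex_countable:
  assumes \<T>: "torus_complex e \<T>"
  shows "countable \<T>"
proof -
  let ?\<F> = "{T\<in>\<T>. T \<inter> fundamental_domain e \<noteq> {}}"
  have "\<T> \<subseteq> (\<Union>l\<in>lattice e. (\<lambda>T. (+) l ` T) ` ?\<F>)"
  proof
    fix T assume T: "T \<in> \<T>"
    then have "is_cell T" using \<T> by (auto simp: torus_complex_def cell_complex_def)
    then obtain x where x: "x \<in> T" using is_cell_nonempty by blast
    define l where "l = x - reduce x"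
    have l: "l \<in> lattice e" unfolding l_def by (rule reduce_lattice)
    have "(+) (- l) ` T \<in> \<T>" using \<T> T lattice_minus[OF l] unfolding torus_complex_def by blast
    moreover have "reduce x \<in> (+) (- l) ` T" using x by (auto simp: l_def image_iff algebra_simps)
    ultimately have "(+) (- l) ` T \<in> ?\<F>" using reduce_mem[of x] by blast
    moreover have "T = (+) l ` ((+) (- l) ` T)" by (simp add: image_image)
    ultimately show "T \<in> (\<Union>l\<in>lattice e. (\<lambda>T. (+) l ` T) ` ?\<F>)" using l by blast
  qed
  moreover have "countable (\<Union>l\<in>lattice e. (\<lambda>T. (+) l ` T) ` ?\<F>)"
    using \<T> by (intro countable_UN countable_lattice countable_image countable_finite) (simp add: torus_complex_def)
  ultimately show ?thesis by (rule countable_subset)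
qed

end

locale refined_mesh = torus_lattice e for e :: "'n::finite \<Rightarrow> real ^ 'n" +
  fixes \<T> U :: "(real ^ 'n) set set" and C h :: real
  assumes complex: "torus_complex e \<T>" and refinement: "simplicial_refinement e U \<T>" and C_pos: "0 < C"
    and shape: "\<And>\<sigma>. \<sigma> \<in> U \<Longrightarrow> int CARD('n) simplex \<sigma> \<Longrightarrow>
      (\<exists>a r. ball a r \<subseteq> \<sigma> \<and> diameter \<sigma> \<le> C * r) \<and> h \<le> C * diameter \<sigma> \<and> diameter \<sigma> \<le> C * h"
    and finite_simplices: "\<And>T. T \<in> \<T> \<Longrightarrow> finite {\<sigma>\<in>U. \<sigma> \<subseteq> T}"
begin

definition top_simplices :: "(real ^ 'n) set set" where
  "top_simplices = {\<sigma>\<in>U. int CARD('n) simplex \<sigma>}"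

lemma U_complex: "torus_complex e U"
  and U_simplex: "\<sigma> \<in> U \<Longrightarrow> \<exists>k. k simplex \<sigma>"
  and U_face: "\<sigma> \<in> U \<Longrightarrow> \<tau> \<in> U \<Longrightarrow> (\<sigma> \<inter> \<tau>) face_of \<sigma>"
  and T_Union: "T \<in> \<T> \<Longrightarrow> T = \<Union>{\<sigma>\<in>U. \<sigma> \<subseteq> T}"
  using refinement by (auto simp: simplicial_refinement_def simplicial_torus_complex_def)

lemma U_convex: "\<sigma> \<in> U \<Longrightarrow> convex \<sigma>" and U_compact: "\<sigma> \<in> U \<Longrightarrow> compact \<sigma>"
  using U_simplex convex_simplex compact_simplex by blast+

lemma negligible_other_simplex:
  assumes "\<sigma> \<in> U" "\<sigma> \<notin> top_simplices"
  shows "negligible \<sigma>"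
proof (rule negligible_of_aff_dim_less[OF U_convex[OF assms(1)]])
  obtain k where k: "k simplex \<sigma>" using U_simplex assms by blast
  then have "aff_dim \<sigma> = k" by (rule aff_dim_simplex)
  moreover have "k \<noteq> int CARD('n)" using assms k by (auto simp: top_simplices_def)
  moreover have "aff_dim \<sigma> \<le> int CARD('n)" using aff_dim_le_DIM[of \<sigma>] by simp
  ultimately show "aff_dim \<sigma> < int DIM(real ^ 'n)" by simp
qed

lemma top_simplex_diameter_pos:
  assumes "\<sigma> \<in> top_simplices" shows "0 < diameter \<sigma>"
proof -
  have \<sigma>: "\<sigma> \<in> U" "aff_dim \<sigma> = int CARD('n)"
    using assms aff_dim_simplex by (auto simp: top_simplices_def)
  \<comment> \<open>\<open>CARD('n)\<close> is at least 1, whereas the empty set and a point have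
    affine dimension -1 and 0.\<close>
  then have "\<sigma> \<noteq> {}" "\<And>x. \<sigma> \<noteq> {x}" by auto
  then obtain x y where xy: "x \<in> \<sigma>" "y \<in> \<sigma>" "x \<noteq> y" by blast
  have "0 < dist x y" using xy by simp
  also have "\<dots> \<le> diameter \<sigma>"
    using xy U_compact[OF \<sigma>(1)] by (intro diameter_bounded_bound compact_imp_bounded)
  finally show ?thesis .
qed

text \<open>The radius comes from \<open>h \<le> C * diameter \<sigma>\<close> and
  \<open>diameter \<sigma> \<le> C * r\<close>, whence \<open>h \<le> C * (C * r)\<close>.\<close>

lemma top_simplex_size:
  assumes "\<sigma> \<in> top_simplices"
  shows "0 < h" "\<exists>a. ball a (h / C\<^sup>2) \<subseteq> \<sigma>" "\<And>x y. x \<in> \<sigma> \<Longrightarrow> y \<in> \<sigma> \<Longrightarrow> dist x y \<le> C * h"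
proof -
  have \<sigma>: "\<sigma> \<in> U" "int CARD('n) simplex \<sigma>" using assms by (auto simp: top_simplices_def)
  have d: "0 < diameter \<sigma>" by (rule top_simplex_diameter_pos[OF assms])
  obtain a r where ar: "ball a r \<subseteq> \<sigma>" "diameter \<sigma> \<le> C * r" "h \<le> C * diameter \<sigma>" "diameter \<sigma> \<le> C * h"
    using shape[OF \<sigma>] by blast
  show "0 < h" using d ar(4) C_pos by (metis less_le_trans zero_less_mult_pos)
  have "h \<le> C * (C * r)" using ar(2,3) C_pos by (meson order_trans mult_left_mono less_imp_le)
  then have "h / C\<^sup>2 \<le> r" using C_pos by (simp add: field_simps power2_eq_square)
  then have "ball a (h / C\<^sup>2) \<subseteq> ball a r" by (rule subset_ball)
  then show "\<exists>a. ball a (h / C\<^sup>2) \<subseteq> \<sigma>" using ar(1) by blast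
  fix x y assume "x \<in> \<sigma>" "y \<in> \<sigma>"
  then have "dist x y \<le> diameter \<sigma>"
    using U_compact[OF \<sigma>(1)] by (intro diameter_bounded_bound compact_imp_bounded)
  then show "dist x y \<le> C * h" using ar(4) by simp
qed

lemma negligible_other_simplices: "negligible (\<Union>(U - top_simplices))"
proof (rule negligible_countable_Union)
  show "countable (U - top_simplices)"
    using torus_complex_countable[OF U_complex] by (rule countable_subset[rotated]) blast
qed (use negligible_other_simplex in blast)

lemma AE_top_simplices: "AE x in lborel. x \<in> \<Union>top_simplices"
  using negligible_AE_lborel[OF negligible_other_simplices]
proof eventually_elim
  case (elim x)
  have "x \<in> \<Union>U" using U_complex by (simp add: torus_complex_def)
  then show ?case using elim by auto
qed

text \<open>Simplices of full dimension exist, since otherwise the whole space would be negligible;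
  the positive diameter of one of them forces \<open>h\<close> to be positive.\<close>

lemma h_pos: "0 < h"
proof -
  have "top_simplices \<noteq> {}"
    using negligible_other_simplices U_complex open_not_negligible[of "UNIV :: (real ^ 'n) set"]
    by (auto simp: torus_complex_def)
  then show ?thesis using top_simplex_size(1) by blast
qed

lemma finite_top_simplices: "finite {K \<in> top_simplices. K \<inter> fundamental_domain e \<noteq> {}}"
proof (rule finite_subset)
  show "finite {K \<in> U. K \<inter> fundamental_domain e \<noteq> {}}"
    using U_complex unfolding torus_complex_def by blast
qed (auto simp: top_simplices_def)

text \<open>The intersection is a face of both simplices and, as they differ, a proper face of at
  least one; so its dimension drops.\<close>

lemma top_simplices_disjoint:
  assumes "K \<in> top_simplices" "K' \<in> top_simplices" "K \<noteq> K'"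
  shows "K \<inter> K' \<in> null_sets lborel"
proof -
  have U: "K \<in> U" "K' \<in> U" and dim: "aff_dim K = int CARD('n)" "aff_dim K' = int CARD('n)"
    using assms aff_dim_simplex by (auto simp: top_simplices_def)
  have lt: "aff_dim (K \<inter> K') < int CARD('n)"
  proof (cases "K \<inter> K' = K")
    case False
    then show ?thesis using face_of_aff_dim_lt[OF U_convex[OF U(1)] U_face[OF U]] dim by simp
  next
    case True
    then have "K \<inter> K' \<noteq> K'" using assms(3) by blast
    then show ?thesis
      using face_of_aff_dim_lt[OF U_convex[OF U(2)] U_face[OF U(2,1)]] dim by (simp add: Int_commute)
  qed
  have "negligible (K \<inter> K')"
    using lt by (intro negligible_of_aff_dim_less convex_Int U_convex U) simp
  then show ?thesis
    using U_compact U by (auto simp: negligible_iff_null_sets null_sets_completion_iff borel_compact compact_Int)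
qed

text \<open>An interior point of \<open>\<sigma>\<close> lies in some simplex \<open>\<tau>\<close>
  of a cell. The face \<open>\<sigma> \<inter> \<tau>\<close> of \<open>\<sigma>\<close> meets the
  interior of \<open>\<sigma>\<close>, hence is all of \<open>\<sigma>\<close>.\<close>

lemma top_simplex_in_cell:
  assumes "\<sigma> \<in> top_simplices" obtains T where "T \<in> \<T>" "\<sigma> \<subseteq> T"
proof -
  have \<sigma>: "\<sigma> \<in> U" using assms by (simp add: top_simplices_def)
  obtain a where a: "ball a (h / C\<^sup>2) \<subseteq> \<sigma>" using top_simplex_size(2)[OF assms] by blast
  have ai: "a \<in> interior \<sigma>"
    using a h_pos C_pos by (auto simp: mem_interior intro!: exI[of _ "h / C\<^sup>2"])
  have "a \<in> \<Union>\<T>" using complex by (simp add: torus_complex_def)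
  then obtain T where T: "T \<in> \<T>" "a \<in> T" by blast
  then obtain \<tau> where \<tau>: "\<tau> \<in> U" "\<tau> \<subseteq> T" "a \<in> \<tau>" using T_Union by blast
  have "a \<in> (\<sigma> \<inter> \<tau>) \<inter> interior \<sigma>" using ai \<tau> interior_subset by blast
  then have "\<sigma> \<inter> \<tau> = \<sigma>" using face_of_disjoint_interior[OF U_face[OF \<sigma> \<tau>(1)]] by blast
  then show ?thesis using that[OF T(1)] \<tau>(2) by blast
qed

text \<open>The part of \<open>interior T\<close> outside the simplices of full dimension is open,
  and negligible because lower dimensional simplices cover it; so it is empty. Taking closures
  reaches all of \<open>T\<close>.\<close>

lemma cell_eq_Union_top_simplices:
  assumes T: "T \<in> \<T>" and \<sigma>: "\<sigma> \<in> top_simplices" "\<sigma> \<subseteq> T" and x: "x \<in> T"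
  obtains \<tau> where "\<tau> \<in> top_simplices" "\<tau> \<subseteq> T" "x \<in> \<tau>"
proof -
  let ?A = "{\<tau> \<in> top_simplices. \<tau> \<subseteq> T}" and ?B = "{\<tau> \<in> U. \<tau> \<subseteq> T \<and> \<tau> \<notin> top_simplices}"
  have fin: "finite ?A" "finite ?B"
    using finite_simplices[OF T] by (auto simp: top_simplices_def intro: finite_subset[rotated])
  have cl: "closed (\<Union>?A)"
    using fin U_compact by (intro closed_Union) (auto simp: top_simplices_def intro: compact_imp_closed)
  have "negligible (\<Union>?B)" using fin(2) negligible_other_simplex by (intro negligible_Union) auto
  moreover have "interior T - \<Union>?A \<subseteq> \<Union>?B"
  proof
    fix y assume y: "y \<in> interior T - \<Union>?A"
    then have "y \<in> T" using interior_subset by blast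
    then obtain \<tau> where "\<tau> \<in> U" "\<tau> \<subseteq> T" "y \<in> \<tau>" using T_Union[OF T] by blast
    then show "y \<in> \<Union>?B" using y by blast
  qed
  ultimately have "negligible (interior T - \<Union>?A)" by (rule negligible_subset)
  moreover have "open (interior T - \<Union>?A)" using cl by (intro open_Diff) auto
  ultimately have "interior T - \<Union>?A = {}" using open_not_negligible by blast
  then have "closure (interior T) \<subseteq> \<Union>?A" using cl by (intro closure_minimal) auto
  moreover have "T \<subseteq> closure (interior T)"
  proof -
    obtain a where "ball a (h / C\<^sup>2) \<subseteq> \<sigma>" using top_simplex_size(2)[OF \<sigma>(1)] by blast
    moreover have "is_cell T" using complex T by (auto simp: torus_complex_def cell_complex_def)
    ultimately show ?thesis
      using \<sigma>(2) h_pos C_pos by (intro cell_subset_closure_interior[of T a "h / C\<^sup>2"]) auto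
  qed
  ultimately show ?thesis using x that by blast
qed

lemma cell_fat:
  assumes "T \<in> \<T>" "\<sigma> \<in> top_simplices" "\<sigma> \<subseteq> T"
  shows "fat (h / C\<^sup>2) (C * h) T"
  unfolding fat_def
proof
  fix x assume "x \<in> T"
  then obtain \<tau> where \<tau>: "\<tau> \<in> top_simplices" "\<tau> \<subseteq> T" "x \<in> \<tau>"
    by (rule cell_eq_Union_top_simplices[OF assms])
  obtain a where "ball a (h / C\<^sup>2) \<subseteq> \<tau>" using top_simplex_size(2)[OF \<tau>(1)] by blast
  moreover have "convex \<tau>" using \<tau> U_convex by (simp add: top_simplices_def)
  moreover have "\<tau> \<subseteq> cball x (C * h)" using top_simplex_size(3)[OF \<tau>(1,3)] by auto
  ultimately show "\<exists>K a. convex K \<and> x \<in> K \<and> K \<subseteq> T \<and> ball a (h / C\<^sup>2) \<subseteq> K \<and> K \<subseteq> cball x (C * h)"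
    using \<tau> by blast
qed

end

section \<open>Inverse estimates on the meshes\<close>

lemma alternating_scale:
  assumes \<phi>: "alternating \<phi>"
  shows "\<phi> (map (\<lambda>v. t *\<^sub>R v) vs) = t ^ length vs * \<phi> vs"
proof -
  have "\<phi> (map (\<lambda>v. t *\<^sub>R v) (take j vs) @ drop j vs) = t ^ j * \<phi> vs" if "j \<le> length vs" for j
    using that
  proof (induction j)
    case (Suc j)
    define ws where "ws = map (\<lambda>v. t *\<^sub>R v) (take j vs) @ drop j vs"
    have j: "j < length ws" using Suc.prems by (simp add: ws_def)
    have lin: "linear (\<lambda>v. \<phi> (ws[j := v]))" using \<phi> j by (auto simp: alternating_def)
    have wj: "ws ! j = vs ! j" using Suc.prems by (simp add: ws_def nth_append)
    have "map (\<lambda>v. t *\<^sub>R v) (take (Suc j) vs) @ drop (Suc j) vs = ws[j := t *\<^sub>R vs ! j]"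
      using Suc.prems by (intro nth_equalityI) (auto simp: ws_def nth_append nth_list_update less_Suc_eq)
    then have "\<phi> (map (\<lambda>v. t *\<^sub>R v) (take (Suc j) vs) @ drop (Suc j) vs) = t * \<phi> (ws[j := vs ! j])"
      using linear_scale[OF lin, of t "vs ! j"] by simp
    also have "ws[j := vs ! j] = ws" using wj by (metis list_update_id)
    finally show ?case using Suc by (simp add: ws_def)
  qed simp
  from this[of "length vs"] show ?thesis by simp
qed

lemma mem_scale_cell: "y \<in> scale_cell a h T \<longleftrightarrow> a + h *\<^sub>R y \<in> T"
  by (simp add: scale_cell_def)

lemma scale_cellI:
  assumes "x \<in> T" "0 < h"
  shows "(1 / h) *\<^sub>R (x - a) \<in> scale_cell a h T"
  using assms by (simp add: mem_scale_cell)

lemma fat_scale_cell: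
  assumes T: "fat (c * h) (C * h) T" and h: "0 < h"
  shows "fat c C (scale_cell a h T)"
  unfolding fat_def
proof
  fix x assume "x \<in> scale_cell a h T"
  then obtain K b where K: "convex K" "a + h *\<^sub>R x \<in> K" "K \<subseteq> T" "ball b (c * h) \<subseteq> K" "K \<subseteq> cball (a + h *\<^sub>R x) (C * h)"
    using fatE[OF T] mem_scale_cell by metis
  have "convex (scale_cell a h K)"
  proof (rule convexI)
    fix x y :: "real ^ 'a" and u v :: real
    assume xy: "x \<in> scale_cell a h K" "y \<in> scale_cell a h K" and uv: "0 \<le> u" "0 \<le> v" "u + v = 1"
    have "a = u *\<^sub>R a + v *\<^sub>R a" using uv by (simp add: scaleR_add_left[symmetric])
    then have "a + h *\<^sub>R (u *\<^sub>R x + v *\<^sub>R y) = u *\<^sub>R (a + h *\<^sub>R x) + v *\<^sub>R (a + h *\<^sub>R y)"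
      by (simp add: algebra_simps)
    also have "\<dots> \<in> K" using K(1) xy uv by (intro convexD) (auto simp: mem_scale_cell)
    finally show "u *\<^sub>R x + v *\<^sub>R y \<in> scale_cell a h K" by (simp add: mem_scale_cell)
  qed
  moreover have "ball ((1 / h) *\<^sub>R (b - a)) c \<subseteq> scale_cell a h K"
  proof
    fix y assume y: "y \<in> ball ((1 / h) *\<^sub>R (b - a)) c"
    have "b - (a + h *\<^sub>R y) = h *\<^sub>R ((1 / h) *\<^sub>R (b - a) - y)"
      using h by (simp add: algebra_simps)
    then have "norm (b - (a + h *\<^sub>R y)) = h * norm ((1 / h) *\<^sub>R (b - a) - y)"
      using h by simp
    also have "\<dots> < h * c" using y h by (simp only: mem_ball dist_norm mult_less_cancel_left_pos)
    finally have "a + h *\<^sub>R y \<in> ball b (c * h)" by (simp add: dist_norm mult.commute)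
    then show "y \<in> scale_cell a h K" using K by (auto simp: mem_scale_cell)
  qed
  moreover have "scale_cell a h K \<subseteq> cball x C"
  proof
    fix y assume "y \<in> scale_cell a h K"
    then have "norm ((a + h *\<^sub>R x) - (a + h *\<^sub>R y)) \<le> C * h" using K(5) by (auto simp: mem_scale_cell dist_norm)
    moreover have "(a + h *\<^sub>R x) - (a + h *\<^sub>R y) = h *\<^sub>R (x - y)" by (simp add: algebra_simps)
    ultimately show "y \<in> cball x C" using h by (simp add: dist_norm mult.commute)
  qed
  moreover have "scale_cell a h K \<subseteq> scale_cell a h T" using K by (auto simp: mem_scale_cell)
  ultimately show "\<exists>K b. convex K \<and> x \<in> K \<and> K \<subseteq> scale_cell a h T \<and> ball b c \<subseteq> K \<and> K \<subseteq> cball x C"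
    using K(2) mem_scale_cell by blast
qed

text \<open>The counterpart of \<open>inverse_bound\<close> at size \<open>h\<close>: lengths are
  multiplied by \<open>h\<close>, while the form enters homogeneously and is left unscaled.\<close>

definition cell_inverse_bound :: "nat \<Rightarrow> real \<Rightarrow> real \<Rightarrow> (real ^ 'n) set \<Rightarrow> ('n::finite) form \<Rightarrow> bool" where
  "cell_inverse_bound k \<kappa> h T \<omega> \<longleftrightarrow>
     (\<forall>x\<in>T. \<forall>y\<in>T. \<kappa> * norm (x - y) \<le> h) \<and>
     (\<exists>b. ball b (\<kappa> * h) \<subseteq> T \<and> (\<forall>y\<in>ball b (\<kappa> * h).
        (\<forall>x\<in>T. \<kappa> * comp_sq k (\<omega> x) \<le> comp_sq k (\<omega> y)) \<and>
        (\<forall>x x'. closed_segment x x' \<subseteq> T \<longrightarrow>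
           \<kappa> * h\<^sup>2 * comp_sq k (\<lambda>vs. \<omega> x vs - \<omega> x' vs) \<le> (norm (x - x'))\<^sup>2 * comp_sq k (\<omega> y))))"

text \<open>On the scaled cell the scaled form is \<open>h ^ k\<close> times
  \<open>\<omega> (a + h *\<^sub>R y)\<close>, and homogeneity discards this factor. What remains is
  a change of variables.\<close>

lemma cell_inverse_bound_unscale:
  assumes ib: "inverse_bound k \<kappa> (scale_cell a h T) (scale_form a h (pullback T \<omega>))"
    and fat: "fat c C T" "0 < c" and h: "0 < h" and alt: "\<And>x. alternating (\<omega> x)"
  shows "cell_inverse_bound k \<kappa> h T \<omega>"
proof -
  let ?S = "scale_cell a h T" and ?\<psi> = "\<lambda>y. \<omega> (a + h *\<^sub>R y)"
  have "?\<psi> y vs = (1 / h ^ k) * scale_form a h (pullback T \<omega>) y vs" if "y \<in> ?S" "length vs = k" for y vs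
    using that h fat_tangent[OF fat, of "a + h *\<^sub>R y"]
    by (simp add: scale_form_def pullback_def alternating_scale[OF alt] mem_scale_cell)
  from inverse_bound_scaled[OF ib this] have ib': "inverse_bound k \<kappa> ?S ?\<psi>" .
  define r where "r = (\<lambda>x. (1 / h) *\<^sub>R (x - a))"
  have r: "a + h *\<^sub>R r x = x" for x using h by (simp add: r_def)
  have rS: "r x \<in> ?S" if "x \<in> T" for x using that by (simp add: mem_scale_cell r)
  have rd: "norm (r x - r y) = norm (x - y) / h" for x y
  proof -
    have "r x - r y = (1 / h) *\<^sub>R (x - y)" by (simp add: r_def algebra_simps)
    then show ?thesis using h by simp
  qed
  obtain b where b0: "ball b \<kappa> \<subseteq> ?S" "\<forall>y\<in>ball b \<kappa>.
        (\<forall>x\<in>?S. \<kappa> * comp_sq k (?\<psi> x) \<le> comp_sq k (?\<psi> y)) \<and>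
        (\<forall>x x'. closed_segment x x' \<subseteq> ?S \<longrightarrow>
           \<kappa> * comp_sq k (\<lambda>vs. ?\<psi> x vs - ?\<psi> x' vs) \<le> (norm (x - x'))\<^sup>2 * comp_sq k (?\<psi> y))"
    using ib' unfolding inverse_bound_def by (elim conjE exE) (rule that)
  note b = b0(1) bspec[OF b0(2)]
  have rb: "r y \<in> ball b \<kappa>" if "y \<in> ball (a + h *\<^sub>R b) (\<kappa> * h)" for y
  proof -
    have "norm (r (a + h *\<^sub>R b) - r y) < \<kappa>"
      using that h unfolding rd by (simp add: dist_norm pos_divide_less_eq)
    moreover have "r (a + h *\<^sub>R b) = b" using h by (simp add: r_def)
    ultimately show ?thesis by (simp add: dist_norm)
  qed
  show ?thesis unfolding cell_inverse_bound_def
  proof (intro conjI ballI exI[of _ "a + h *\<^sub>R b"] impI allI)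
    fix x y assume "x \<in> T" "y \<in> T"
    then have "\<kappa> * norm (r x - r y) \<le> 1" using ib' rS unfolding inverse_bound_def by blast
    then show "\<kappa> * norm (x - y) \<le> h" using h by (simp add: rd)
  next
    show "ball (a + h *\<^sub>R b) (\<kappa> * h) \<subseteq> T"
    proof
      fix y assume "y \<in> ball (a + h *\<^sub>R b) (\<kappa> * h)"
      then have "r y \<in> ?S" using rb b by blast
      then show "y \<in> T" by (simp add: mem_scale_cell r)
    qed
  next
    fix y x assume "y \<in> ball (a + h *\<^sub>R b) (\<kappa> * h)" "x \<in> T"
    then have "\<kappa> * comp_sq k (?\<psi> (r x)) \<le> comp_sq k (?\<psi> (r y))" using b(2)[OF rb] rS by blast
    then show "\<kappa> * comp_sq k (\<omega> x) \<le> comp_sq k (\<omega> y)" by (simp only: r)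
  next
    fix y x x' assume y: "y \<in> ball (a + h *\<^sub>R b) (\<kappa> * h)" and seg: "closed_segment x x' \<subseteq> T"
    have "closed_segment (r x) (r x') \<subseteq> ?S"
    proof
      fix v assume "v \<in> closed_segment (r x) (r x')"
      then obtain t where t: "0 \<le> t" "t \<le> 1" "v = (1 - t) *\<^sub>R r x + t *\<^sub>R r x'" by (auto simp: in_segment)
      have "a + h *\<^sub>R v = (1 - t) *\<^sub>R (a + h *\<^sub>R r x) + t *\<^sub>R (a + h *\<^sub>R r x')"
        unfolding t(3) by (simp add: algebra_simps)
      then have "a + h *\<^sub>R v \<in> closed_segment x x'" unfolding r using t(1,2) by (auto simp: in_segment)
      then show "v \<in> ?S" using seg by (auto simp: mem_scale_cell)
    qed
    then have "\<kappa> * comp_sq k (\<lambda>vs. ?\<psi> (r x) vs - ?\<psi> (r x') vs) \<le> (norm (r x - r x'))\<^sup>2 * comp_sq k (?\<psi> (r y))"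
      using b(2)[OF rb[OF y]] by blast
    then have "\<kappa> * comp_sq k (\<lambda>vs. \<omega> x vs - \<omega> x' vs) \<le> (norm (x - x') / h)\<^sup>2 * comp_sq k (\<omega> y)"
      by (simp only: r rd)
    then show "\<kappa> * h\<^sup>2 * comp_sq k (\<lambda>vs. \<omega> x vs - \<omega> x' vs) \<le> (norm (x - x'))\<^sup>2 * comp_sq k (\<omega> y)"
      using h by (simp add: power_divide field_simps)
  qed
qed

text \<open>Counterexamples for the constants \<open>1 / Suc j\<close> would contradict the
  compactness lemma as soon as \<open>1 / Suc j\<close> falls below the constant that it yields. One
  compact family serves all meshes, so the mesh indices of the counterexamples may be arbitrary. The
  simplex \<open>\<sigma>\<close> singles out the cells of full dimension.\<close>

lemma mesh_inverse_bound:
  fixes X :: "nat \<Rightarrow> (real ^ 'n) set \<Rightarrow> nat \<Rightarrow> ('n::finite) form set"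
  assumes hs: "h_setting e \<T> X"
    and mesh: "\<And>m. refined_mesh e (\<T> m) (U m) C (mesh_size e (\<T> m))"
  obtains \<kappa> where "0 < \<kappa>"
    "\<And>m T \<sigma> \<omega>. T \<in> \<T> m \<Longrightarrow> \<sigma> \<in> refined_mesh.top_simplices (U m) \<Longrightarrow> \<sigma> \<subseteq> T \<Longrightarrow> smooth_form k \<omega> \<Longrightarrow>
      pullback T \<omega> \<in> X m T k \<Longrightarrow> cell_inverse_bound k \<kappa> (mesh_size e (\<T> m)) T \<omega>"
proof -
  let ?h = "\<lambda>m. mesh_size e (\<T> m)"
  define P where "P = (\<lambda>m T \<sigma> \<omega>. T \<in> \<T> m \<and> \<sigma> \<in> refined_mesh.top_simplices (U m) \<and> \<sigma> \<subseteq> T \<and> smooth_form k \<omega> \<and>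
      pullback T \<omega> \<in> X m T k)"
  have "\<exists>\<kappa>>0. \<forall>m T \<sigma> \<omega>. P m T \<sigma> \<omega> \<longrightarrow> cell_inverse_bound k \<kappa> (?h m) T \<omega>"
  proof (rule ccontr)
    assume "\<not> ?thesis"
    then have "\<forall>j::nat. \<exists>m T \<sigma> \<omega>. P m T \<sigma> \<omega> \<and> \<not> cell_inverse_bound k (1 / Suc j) (?h m) T \<omega>"
      by (metis of_nat_0_less_iff zero_less_Suc zero_less_divide_1_iff)
    then obtain m T \<sigma> \<omega> where P: "\<And>j. P (m j) (T j) (\<sigma> j) (\<omega> j)"
      and fail: "\<And>j. \<not> cell_inverse_bound k (1 / Suc j) (?h (m j)) (T j) (\<omega> j)"
      by metis
    obtain \<K> where \<K>: "compact_family \<K>" "\<And>m T. T \<in> \<T> m \<Longrightarrow> \<exists>a Ts. set Ts = macro_cells (\<T> m) T \<and>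
        scaled_macro a (?h m) Ts (X m) \<in> \<K>"
      using hs unfolding h_setting_def by blast
    have Tm: "T j \<in> \<T> (m j)" for j using P by (simp add: P_def)
    obtain a Ts where Ts: "\<And>j. set (Ts j) = macro_cells (\<T> (m j)) (T j)"
        "\<And>j. scaled_macro (a j) (?h (m j)) (Ts j) (X (m j)) \<in> \<K>"
      using \<K>(2)[OF Tm] by metis
    have hp: "0 < ?h (m j)" and Cp: "0 < C" for j
      using refined_mesh.h_pos[OF mesh] refined_mesh.C_pos[OF mesh] by auto
    have fatT: "fat (?h (m j) / C\<^sup>2) (C * ?h (m j)) (T j)" for j
      using refined_mesh.cell_fat[OF mesh] P unfolding P_def by blast
    have cellT: "is_cell (T j)" for j
      using refined_mesh.complex[OF mesh, of "m j"] Tm[of j] by (auto simp: torus_complex_def cell_complex_def)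
    \<comment> \<open>A cell is nonempty and so touches itself; hence it occurs in its own
      macro-element.\<close>
    have "T j \<in> set (Ts j)" for j
      unfolding Ts macro_cells_def using Tm[of j] is_cell_nonempty[OF cellT[of j]] by blast
    then have "\<forall>j. \<exists>i. i < length (Ts j) \<and> Ts j ! i = T j"
      by (simp add: in_set_conv_nth)
    then obtain idx where idx: "\<And>j. idx j < length (Ts j)" "\<And>j. Ts j ! idx j = T j"
      unfolding choice_iff by blast
    define Ms where "Ms = (\<lambda>j. scaled_macro (a j) (?h (m j)) (Ts j) (X (m j)))"
    have Mi: "Ms j ! idx j = (scale_cell (a j) (?h (m j)) (T j), \<lambda>k. scale_form (a j) (?h (m j)) ` X (m j) (T j) k)" for j
      using idx[of j] by (simp add: Ms_def scaled_macro_def)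
    obtain \<kappa> where \<kappa>: "0 < \<kappa>" "\<exists>\<^sub>F j in sequentially. inverse_bound k \<kappa> (fst (Ms j ! idx j))
        (scale_form (a j) (?h (m j)) (pullback (T j) (\<omega> j)))"
    proof (rule compact_family_inverse_bound[OF \<K>(1), of Ms idx "1 / C\<^sup>2" C "\<lambda>j. scale_form (a j) (?h (m j)) (pullback (T j) (\<omega> j))" k])
      show "Ms j \<in> \<K>" for j unfolding Ms_def by (rule Ts)
      show "idx j < length (Ms j)" for j using idx by (simp add: Ms_def scaled_macro_def)
      show "fat (1 / C\<^sup>2) C (fst (Ms j ! idx j))" for j
        unfolding Mi using fatT[of j] hp[of j] by (auto intro!: fat_scale_cell)
      show "fst (Ms j ! idx j) \<noteq> {}" for j
        unfolding Mi using scale_cellI[OF _ hp] is_cell_nonempty[OF cellT[of j]] by fastforce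
      show "scale_form (a j) (?h (m j)) (pullback (T j) (\<omega> j)) \<in> snd (Ms j ! idx j) k" for j
        unfolding Mi using P[of j] by (auto simp: P_def)
    qed (use Cp in auto)
    have "\<forall>\<^sub>F j in sequentially. 1 / Suc j \<le> \<kappa>"
    proof -
      have "\<forall>\<^sub>F j in sequentially. 1 / real (Suc j) < \<kappa>"
        using order_tendstoD(2)[OF LIMSEQ_inverse_real_of_nat \<kappa>(1)] by (simp add: inverse_eq_divide)
      then show ?thesis by eventually_elim simp
    qed
    from frequently_eventually_conj[OF \<kappa>(2) this]
    obtain j where j: "1 / Suc j \<le> \<kappa>" "inverse_bound k \<kappa> (fst (Ms j ! idx j))
        (scale_form (a j) (?h (m j)) (pullback (T j) (\<omega> j)))"
      using frequently_ex by blast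
    have "inverse_bound k (1 / Suc j) (scale_cell (a j) (?h (m j)) (T j)) (scale_form (a j) (?h (m j)) (pullback (T j) (\<omega> j)))"
      using inverse_bound_mono[OF j(2,1)] by (simp add: Mi)
    from cell_inverse_bound_unscale[OF this fatT _ hp]
    have "cell_inverse_bound k (1 / Suc j) (?h (m j)) (T j) (\<omega> j)"
      using P[of j] hp[of j] Cp by (simp add: P_def smooth_form_def)
    then show False using fail by blast
  qed
  then obtain \<kappa> where "0 < \<kappa>" "\<And>m T \<sigma> \<omega>. P m T \<sigma> \<omega> \<Longrightarrow> cell_inverse_bound k \<kappa> (?h m) T \<omega>" by blast
  then show ?thesis unfolding P_def by (intro that[of \<kappa>]) auto
qed

lemma cell_inverse_bound_mono:
  assumes ib: "cell_inverse_bound k \<kappa> h T \<omega>" and le: "\<kappa>' \<le> \<kappa>" and h: "0 \<le> h"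
  shows "cell_inverse_bound k \<kappa>' h T \<omega>"
proof -
  have m: "\<kappa>' * u \<le> v" if "\<kappa> * u \<le> v" "0 \<le> u" for u v
    using that mult_right_mono[OF le that(2)] by linarith
  obtain b where b0: "ball b (\<kappa> * h) \<subseteq> T" "\<forall>y\<in>ball b (\<kappa> * h).
        (\<forall>x\<in>T. \<kappa> * comp_sq k (\<omega> x) \<le> comp_sq k (\<omega> y)) \<and>
        (\<forall>x x'. closed_segment x x' \<subseteq> T \<longrightarrow>
           \<kappa> * h\<^sup>2 * comp_sq k (\<lambda>vs. \<omega> x vs - \<omega> x' vs) \<le> (norm (x - x'))\<^sup>2 * comp_sq k (\<omega> y))"
    using ib unfolding cell_inverse_bound_def by (elim conjE exE) (rule that)
  note b = b0(1) bspec[OF b0(2)]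
  have sub: "ball b (\<kappa>' * h) \<subseteq> ball b (\<kappa> * h)" using le h by (intro subset_ball mult_right_mono)
  show ?thesis
    unfolding cell_inverse_bound_def
  proof (intro conjI ballI exI[of _ b] impI allI)
    show "ball b (\<kappa>' * h) \<subseteq> T" using sub b by auto
    fix y x x' assume y: "y \<in> ball b (\<kappa>' * h)"
    show "x \<in> T \<Longrightarrow> \<kappa>' * comp_sq k (\<omega> x) \<le> comp_sq k (\<omega> y)"
      using b(2)[of y] sub y by (intro m comp_sq_nonneg) auto
    show "closed_segment x x' \<subseteq> T \<Longrightarrow>
       \<kappa>' * h\<^sup>2 * comp_sq k (\<lambda>vs. \<omega> x vs - \<omega> x' vs) \<le> (norm (x - x'))\<^sup>2 * comp_sq k (\<omega> y)"
      using b(2)[of y] sub y unfolding mult.assoc by (intro m mult_nonneg_nonneg comp_sq_nonneg) auto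
  next
    fix x y assume "x \<in> T" "y \<in> T"
    then show "\<kappa>' * norm (x - y) \<le> h" using ib by (intro m) (auto simp: cell_inverse_bound_def)
  qed
qed

section \<open>Subtracting a constant form on a cell\<close>

lemma iterated_deriv_diff_const:
  assumes "smooth f"
  shows "iterated_deriv vs (\<lambda>x. f x - c) = (\<lambda>x. iterated_deriv vs f x - (if vs = [] then c else 0))"
proof (induction vs)
  case (Cons v vs)
  have "frechet_derivative (\<lambda>x. iterated_deriv vs f x - d) (at x) = frechet_derivative (iterated_deriv vs f) (at x)" for d x
  proof -
    have "iterated_deriv vs f differentiable (at x)" using assms by (simp add: smooth_def)
    then have "((\<lambda>x. iterated_deriv vs f x - d) has_derivative frechet_derivative (iterated_deriv vs f) (at x)) (at x)"
      using has_derivative_diff[OF _ has_derivative_const] by (fastforce simp: frechet_derivative_works)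
    then show ?thesis by (rule frechet_derivative_at[symmetric])
  qed
  then show ?case unfolding iterated_deriv.simps Cons by simp
qed simp

lemma smooth_diff_const: "smooth f \<Longrightarrow> smooth (\<lambda>x. f x - c)"
  unfolding smooth_def[of "\<lambda>x. f x - c"]
  by (auto simp only: iterated_deriv_diff_const intro!: differentiable_diff differentiable_const)
    (simp add: smooth_def)

lemma smooth_form_diff_const:
  assumes \<omega>: "smooth_form k \<omega>" and \<phi>: "alternating \<phi>" "homogeneous k \<phi>"
  shows "smooth_form k (\<lambda>x vs. \<omega> x vs - \<phi> vs)"
  unfolding smooth_form_def
proof (intro conjI allI)
  fix x
  have a: "alternating (\<omega> x)" "homogeneous k (\<omega> x)" using \<omega> by (auto simp: smooth_form_def)
  show "alternating (\<lambda>vs. \<omega> x vs - \<phi> vs)"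
    using a(1) \<phi>(1) unfolding alternating_def by (auto intro!: linear_compose_sub)
  show "homogeneous k (\<lambda>vs. \<omega> x vs - \<phi> vs)"
    using a(2) \<phi>(2) unfolding homogeneous_def by auto
next
  fix vs
  show "smooth (\<lambda>x. \<omega> x vs - \<phi> vs)"
    using \<omega> by (intro smooth_diff_const) (simp add: smooth_form_def)
qed

lemma const_in_poly_forms_on:
  fixes \<phi> :: "(real ^ 'n::finite) list \<Rightarrow> real"
  assumes "alternating \<phi>" "homogeneous k \<phi>"
  shows "pullback T (\<lambda>x. \<phi>) \<in> poly_forms_on p k T"
proof -
  have "poly_fun p (\<lambda>x::real ^ 'n. d)" for d
    unfolding poly_fun_def
  proof (intro exI[of _ "\<lambda>\<alpha>. if \<alpha> = (\<lambda>_. 0) then d else 0"] allI)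
    fix x :: "real ^ 'n"
    \<comment> \<open>Finiteness is essential here: a sum over an infinite set is 0 by
      convention.\<close>
    have "{\<alpha> :: 'n \<Rightarrow> nat. (\<Sum>i\<in>UNIV. \<alpha> i) \<le> p} \<subseteq> UNIV \<rightarrow>\<^sub>E {..p}"
    proof safe
      fix \<alpha> :: "'n \<Rightarrow> nat" and i assume "(\<Sum>i\<in>UNIV. \<alpha> i) \<le> p"
      then show "\<alpha> i \<le> p" using member_le_sum[of i UNIV \<alpha>] by simp
    qed auto
    then have fin: "finite {\<alpha> :: 'n \<Rightarrow> nat. (\<Sum>i\<in>UNIV. \<alpha> i) \<le> p}"
      by (rule finite_subset) (auto intro: finite_PiE)
    have "(\<Sum>\<alpha>\<in>{\<alpha>. (\<Sum>i\<in>UNIV. \<alpha> i) \<le> p}. (if \<alpha> = (\<lambda>_. 0) then d else 0) * (\<Prod>i\<in>UNIV. x $ i ^ \<alpha> i))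
       = (\<Sum>\<alpha>\<in>{\<alpha> :: 'n \<Rightarrow> nat. (\<Sum>i\<in>UNIV. \<alpha> i) \<le> p}. if \<alpha> = (\<lambda>_. 0) then d else 0)"
      by (intro sum.cong) auto
    also have "\<dots> = d" using fin by (simp add: sum.delta)
    finally show "d = (\<Sum>\<alpha>\<in>{\<alpha>. (\<Sum>i\<in>UNIV. \<alpha> i) \<le> p}. (if \<alpha> = (\<lambda>_. 0) then d else 0) * (\<Prod>i\<in>UNIV. x $ i ^ \<alpha> i))"
      by simp
  qed
  then show ?thesis unfolding poly_forms_on_def using assms by blast
qed

lemma form_span_diff:
  assumes "u \<in> form_span N b" "v \<in> form_span N b"
  shows "(\<lambda>x vs. u x vs - v x vs) \<in> form_span N b"
proof -
  obtain c d where "u = (\<lambda>x vs. \<Sum>i<N. c i * b i x vs)" "v = (\<lambda>x vs. \<Sum>i<N. d i * b i x vs)"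
    using assms by (auto simp: form_span_def)
  then have "(\<lambda>x vs. u x vs - v x vs) = (\<lambda>x vs. \<Sum>i<N. (c i - d i) * b i x vs)"
    by (simp add: sum_subtractf left_diff_distrib)
  then show ?thesis by (auto simp: form_span_def)
qed

text \<open>This admits \<open>\<omega> - u(z)\<close> into the local space: the value of
  \<open>u\<close> at a fixed point \<open>z\<close> is a constant form, a polynomial of degree
  0.\<close>

lemma pullback_diff_const_mem:
  assumes "local_spaces T Y" "poly_forms_on p k T \<subseteq> Y k" "pullback T \<omega> \<in> Y k"
    and "alternating \<phi>" "homogeneous k \<phi>"
  shows "pullback T (\<lambda>x vs. \<omega> x vs - \<phi> vs) \<in> Y k"
proof -
  obtain N b where Y: "Y k = form_span N b" using assms(1) unfolding local_spaces_def finite_dim_def by blast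
  have "pullback T (\<lambda>x. \<phi>) \<in> Y k" using const_in_poly_forms_on[OF assms(4,5)] assms(2) by blast
  then have "(\<lambda>x vs. pullback T \<omega> x vs - pullback T (\<lambda>x. \<phi>) x vs) \<in> Y k"
    using assms(3) unfolding Y by (rule form_span_diff[rotated])
  moreover have "pullback T (\<lambda>x vs. \<omega> x vs - \<phi> vs) = (\<lambda>x vs. pullback T \<omega> x vs - pullback T (\<lambda>x. \<phi>) x vs)"
    by (auto simp: pullback_def fun_eq_iff)
  ultimately show ?thesis by simp
qed

section \<open>From bounds at all points of a ball to local energies\<close>

lemma ball_integral_lower_bound:
  fixes g :: "'a::euclidean_space \<Rightarrow> real" and c \<rho> :: real
  assumes "0 \<le> \<rho>" "AE y in lborel. y \<in> ball b \<rho> \<longrightarrow> y \<in> B \<and> c \<le> g y"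
  shows "ennreal c * ennreal (unit_ball_vol DIM('a) * \<rho> ^ DIM('a)) \<le> (\<integral>\<^sup>+y\<in>B. ennreal (g y) \<partial>lborel)"
proof -
  have "ennreal c * ennreal (unit_ball_vol DIM('a) * \<rho> ^ DIM('a)) = (\<integral>\<^sup>+y. ennreal c * indicator (ball b \<rho>) y \<partial>lborel)"
    using assms(1) by (simp add: nn_integral_cmult_indicator emeasure_ball)
  also have "\<dots> \<le> (\<integral>\<^sup>+y\<in>B. ennreal (g y) \<partial>lborel)"
    using assms(2) by (intro nn_integral_mono_AE) (auto elim!: eventually_mono simp: indicator_def ennreal_leI)
  finally show ?thesis .
qed

context refined_mesh begin

text \<open>\<open>M\<close> is the reciprocal of \<open>\<kappa>\<close> times the volume of a ball
  of radius \<open>\<kappa>\<close>. In \<open>R\<close>, \<open>1 / \<kappa>\<close> bounds the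
  diameter of a cell, \<open>C + 1\<close> the distance from \<open>z\<close> to \<open>y\<close>,
  and the last 1 makes the inclusion in the open ball strict.\<close>

lemma local_estimates_homogeneous:
  fixes v :: "'n form" and \<Omega> :: "(real ^ 'n) set \<Rightarrow> 'n form" and q :: "real ^ 'n \<Rightarrow> real ^ 'n \<Rightarrow> real"
  assumes \<kappa>: "0 < \<kappa>"
    and ib: "\<And>T \<sigma> \<phi>. T \<in> \<T> \<Longrightarrow> \<sigma> \<in> top_simplices \<Longrightarrow> \<sigma> \<subseteq> T \<Longrightarrow> alternating \<phi> \<Longrightarrow> homogeneous k \<phi> \<Longrightarrow>
      cell_inverse_bound k \<kappa> h T (\<lambda>x vs. \<Omega> T x vs - \<phi> vs)"
    and v: "\<And>x. alternating (v x)" "\<And>x. homogeneous k (v x)"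
    and G: "AE x in lborel. x \<in> G" "\<And>x T. x \<in> G \<Longrightarrow> T \<in> \<T> \<Longrightarrow> x \<in> T \<Longrightarrow> v x = pullback T (\<Omega> T) x"
      "\<And>x. x \<in> G \<Longrightarrow> x \<in> \<Union>top_simplices"
    and q: "\<And>x y. x \<in> G \<Longrightarrow> y \<in> G \<Longrightarrow> q x y = comp_sq k (\<lambda>vs. v x vs - v y vs)"
  defines "R \<equiv> C + 2 + 1 / \<kappa>" and "M \<equiv> 1 / (\<kappa> ^ Suc CARD('n) * unit_ball_vol CARD('n))"
  shows "\<And>y z. y \<in> G \<Longrightarrow> z \<in> G \<Longrightarrow> dist y z \<le> (C + 1) * h \<Longrightarrow>
      ennreal (q y z) \<le> ennreal (M / h ^ CARD('n)) * (\<integral>\<^sup>+y\<in>ball z (R * h). ennreal (q y z) \<partial>lborel)" (is "PROP ?E1")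
    and "\<And>K x y z. K \<in> top_simplices \<Longrightarrow> x \<in> G \<Longrightarrow> x \<in> K \<Longrightarrow> y \<in> G \<Longrightarrow> y \<in> K \<Longrightarrow> z \<in> G \<Longrightarrow> z \<in> K \<Longrightarrow>
      ennreal (q x y) \<le> ennreal ((dist x y / h)\<^sup>2) *
        (ennreal (M / h ^ CARD('n)) * (\<integral>\<^sup>+y\<in>ball z (R * h). ennreal (q y z) \<partial>lborel))" (is "PROP ?E2")
proof -
  have h: "0 < h" by (rule h_pos)
  have \<kappa>h: "0 \<le> \<kappa> * h" using \<kappa> h by simp
  have uv: "unit_ball_vol (real CARD('n)) \<noteq> 0" using unit_ball_vol_pos[of "real CARD('n)"] by linarith
  have M0: "0 \<le> M" using \<kappa> by (simp add: M_def)
  \<comment> \<open>\<open>M / h ^ n\<close> cancels \<open>\<kappa>\<close> times the volume of a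
    ball of radius \<open>\<kappa> * h\<close>.\<close>
  have Mc: "ennreal (M / h ^ CARD('n)) * (ennreal (\<kappa> * t) * ennreal (unit_ball_vol CARD('n) * (\<kappa> * h) ^ CARD('n))) = ennreal t"
    if t: "0 \<le> t" for t
  proof -
    have "ennreal (\<kappa> * t) * ennreal (unit_ball_vol CARD('n) * (\<kappa> * h) ^ CARD('n))
        = ennreal (\<kappa> * t * (unit_ball_vol CARD('n) * (\<kappa> * h) ^ CARD('n)))"
      using \<kappa> t by (intro ennreal_mult'[symmetric]) simp
    moreover have "ennreal (M / h ^ CARD('n)) * ennreal (\<kappa> * t * (unit_ball_vol CARD('n) * (\<kappa> * h) ^ CARD('n)))
        = ennreal (M / h ^ CARD('n) * (\<kappa> * t * (unit_ball_vol CARD('n) * (\<kappa> * h) ^ CARD('n))))"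
      using M0 h by (intro ennreal_mult'[symmetric]) simp
    moreover have "M / h ^ CARD('n) * (\<kappa> * t * (unit_ball_vol CARD('n) * (\<kappa> * h) ^ CARD('n))) = t"
      using \<kappa> h uv by (simp add: M_def power_mult_distrib)
    ultimately show ?thesis by simp
  qed
  have q0: "0 \<le> q x y" if "x \<in> G" "y \<in> G" for x y using q[OF that] comp_sq_nonneg[of k] by simp
  have on_cell: "\<Omega> T x vs = v x vs" if "T \<in> \<T>" "\<sigma> \<in> top_simplices" "\<sigma> \<subseteq> T" "x \<in> T" "x \<in> G" for T \<sigma> x vs
  proof -
    have "0 < h / C\<^sup>2" using h C_pos by simp
    from fat_tangent[OF cell_fat[OF that(1-3)] this that(4)] show ?thesis
      using G(2)[OF that(5,1,4)] by (simp add: pullback_def)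
  qed
  have diffq: "comp_sq k (\<lambda>vs. \<Omega> T x vs - v z vs) = q x z"
    if "T \<in> \<T>" "\<sigma> \<in> top_simplices" "\<sigma> \<subseteq> T" "x \<in> T" "x \<in> G" "z \<in> G" for T \<sigma> x z
    using on_cell[OF that(1-5)] q[OF that(5,6)] by simp
  show "PROP ?E1"
  proof -
    fix y z assume y: "y \<in> G" and z: "z \<in> G" and d: "dist y z \<le> (C + 1) * h"
    obtain \<sigma> where \<sigma>: "\<sigma> \<in> top_simplices" "y \<in> \<sigma>" using G(3)[OF y] by blast
    obtain T where T: "T \<in> \<T>" "\<sigma> \<subseteq> T" by (rule top_simplex_in_cell[OF \<sigma>(1)])
    have yT: "y \<in> T" using \<sigma> T by blast
    \<comment> \<open>The cell is chosen to contain \<open>y\<close>; \<open>z\<close> may lie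
      elsewhere, since only the constant form \<open>v z\<close> enters.\<close>
    note cib = ib[OF T(1) \<sigma>(1) T(2) v(1)[of z] v(2)[of z], unfolded cell_inverse_bound_def]
    obtain b where b: "ball b (\<kappa> * h) \<subseteq> T"
      "\<And>x'. x' \<in> ball b (\<kappa> * h) \<Longrightarrow> \<kappa> * comp_sq k (\<lambda>vs. \<Omega> T y vs - v z vs) \<le> comp_sq k (\<lambda>vs. \<Omega> T x' vs - v z vs)"
      using cib yT by blast
    have "AE x' in lborel. x' \<in> ball b (\<kappa> * h) \<longrightarrow> x' \<in> ball z (R * h) \<and> \<kappa> * q y z \<le> q x' z"
      using G(1)
    proof eventually_elim
      case (elim x')
      show ?case
      proof
        assume x': "x' \<in> ball b (\<kappa> * h)"
        then have xT: "x' \<in> T" using b by blast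
        have "\<kappa> * norm (y - x') \<le> h" using cib yT xT by blast
        then have "dist y x' \<le> 1 / \<kappa> * h" using \<kappa> by (simp add: dist_norm field_simps)
        then have "dist z x' \<le> (C + 1) * h + 1 / \<kappa> * h"
          using d dist_triangle[of z x' y] by (simp add: dist_commute)
        also have "\<dots> < R * h" using h by (simp add: R_def algebra_simps)
        finally show "x' \<in> ball z (R * h) \<and> \<kappa> * q y z \<le> q x' z"
          using b(2)[OF x'] diffq[OF T(1) \<sigma>(1) T(2) yT y z] diffq[OF T(1) \<sigma>(1) T(2) xT elim z] by simp
      qed
    qed
    from ball_integral_lower_bound[OF \<kappa>h this]
    have "ennreal (M / h ^ CARD('n)) * (ennreal (\<kappa> * q y z) * ennreal (unit_ball_vol CARD('n) * (\<kappa> * h) ^ CARD('n)))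
       \<le> ennreal (M / h ^ CARD('n)) * (\<integral>\<^sup>+y\<in>ball z (R * h). ennreal (q y z) \<partial>lborel)"
      by (intro mult_left_mono) auto
    also have "ennreal (M / h ^ CARD('n)) * (ennreal (\<kappa> * q y z) * ennreal (unit_ball_vol CARD('n) * (\<kappa> * h) ^ CARD('n))) = ennreal (q y z)"
      by (rule Mc[OF q0[OF y z]])
    finally show "ennreal (q y z) \<le> ennreal (M / h ^ CARD('n)) * (\<integral>\<^sup>+y\<in>ball z (R * h). ennreal (q y z) \<partial>lborel)" .
  qed
  show "PROP ?E2"
  proof -
    fix K x y z assume K: "K \<in> top_simplices" and x: "x \<in> G" "x \<in> K" and y: "y \<in> G" "y \<in> K" and z: "z \<in> G" "z \<in> K"
    obtain T where T: "T \<in> \<T>" "K \<subseteq> T" by (rule top_simplex_in_cell[OF K])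
    have inT: "x \<in> T" "y \<in> T" "z \<in> T" using x y z T by auto
    \<comment> \<open>Convexity of the simplex, not of the cell, makes the Lipschitz part
      applicable.\<close>
    have seg: "closed_segment x y \<subseteq> T"
      using closed_segment_subset[OF x(2) y(2)] U_convex K T by (auto simp: top_simplices_def)
    have qxy: "q x y = comp_sq k (\<lambda>vs. (\<Omega> T x vs - v z vs) - (\<Omega> T y vs - v z vs))"
      using q[OF x(1) y(1)] on_cell[OF T(1) K T(2)] inT x y by simp
    note cib = ib[OF T(1) K T(2) v(1)[of z] v(2)[of z], unfolded cell_inverse_bound_def]
    obtain b where b: "ball b (\<kappa> * h) \<subseteq> T"
      "\<And>x'. x' \<in> ball b (\<kappa> * h) \<Longrightarrow> \<kappa> * h\<^sup>2 * q x y \<le> (norm (x - y))\<^sup>2 * comp_sq k (\<lambda>vs. \<Omega> T x' vs - v z vs)"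
      unfolding qxy using cib seg by blast
    show "ennreal (q x y) \<le> ennreal ((dist x y / h)\<^sup>2) *
        (ennreal (M / h ^ CARD('n)) * (\<integral>\<^sup>+y\<in>ball z (R * h). ennreal (q y z) \<partial>lborel))"
    \<comment> \<open>The case \<open>x = y\<close> is separated because the squared distance is
      divided by below.\<close>
    proof (cases "x = y")
      case True
      then have "q x y = 0" using q x y by (simp add: comp_sq_def)
      then show ?thesis by simp
    next
      case False
      define r where "r = (dist x y / h)\<^sup>2"
      have r: "0 < r" using False h by (simp add: r_def)
      have "AE x' in lborel. x' \<in> ball b (\<kappa> * h) \<longrightarrow> x' \<in> ball z (R * h) \<and> \<kappa> * (q x y / r) \<le> q x' z"
        using G(1)
      proof eventually_elim
        case (elim x')
        show ?case
        proof
          assume x': "x' \<in> ball b (\<kappa> * h)"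
          then have xT: "x' \<in> T" using b by blast
          have "\<kappa> * norm (z - x') \<le> h" using cib inT xT by blast
          then have "dist z x' \<le> 1 / \<kappa> * h" using \<kappa> by (simp add: dist_norm field_simps)
          also have "\<dots> < R * h" using h C_pos by (simp add: R_def algebra_simps add_pos_pos)
          finally have "x' \<in> ball z (R * h)" by simp
          moreover have "\<kappa> * h\<^sup>2 * q x y \<le> (norm (x - y))\<^sup>2 * q x' z"
            using b(2)[OF x'] diffq[OF T(1) K T(2) xT elim z(1)] by simp
          then have "\<kappa> * (q x y / r) \<le> q x' z"
            using h False by (simp add: r_def dist_norm power_divide field_simps)
          ultimately show "x' \<in> ball z (R * h) \<and> \<kappa> * (q x y / r) \<le> q x' z" by blast
        qed
      qed
      from ball_integral_lower_bound[OF \<kappa>h this]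
      have "ennreal r * (ennreal (M / h ^ CARD('n)) * (ennreal (\<kappa> * (q x y / r)) * ennreal (unit_ball_vol CARD('n) * (\<kappa> * h) ^ CARD('n))))
         \<le> ennreal r * (ennreal (M / h ^ CARD('n)) * (\<integral>\<^sup>+y\<in>ball z (R * h). ennreal (q y z) \<partial>lborel))"
        by (intro mult_left_mono) auto
      also have "ennreal r * (ennreal (M / h ^ CARD('n)) * (ennreal (\<kappa> * (q x y / r)) * ennreal (unit_ball_vol CARD('n) * (\<kappa> * h) ^ CARD('n))))
         = ennreal r * ennreal (q x y / r)"
        using q0[OF x(1) y(1)] r by (subst Mc) simp_all
      also have "\<dots> = ennreal (q x y)"
        using r by (subst ennreal_mult'[symmetric]) simp_all
      finally show ?thesis by (simp add: r_def)
    qed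
  qed
qed

end

section \<open>Periodic Borel versions of periodic functions\<close>

context torus_lattice begin

lemma AE_lborel_translate:
  assumes "AE x in lborel. P (x :: real ^ 'n)"
  shows "AE x in lborel. P (x + l)"
proof -
  have "AE x in distr lborel borel ((+) l). P x" using assms by (subst lborel_distr_plus)
  from AE_distrD[OF _ this] show ?thesis by (simp add: add.commute)
qed

text \<open>A Borel version \<open>g'\<close> need not be periodic, but its composition with
  \<open>reduce\<close> is. It still agrees with \<open>g\<close> almost everywhere, because
  countably many lattice translates of a null set form a null set.\<close>

lemma periodic_borel_version:
  fixes g :: "real ^ 'n \<Rightarrow> real"
  assumes g: "g \<in> borel_measurable lebesgue" and per: "\<And>x l. l \<in> lattice e \<Longrightarrow> g (x + l) = g x"
  obtains f where "f \<in> borel_measurable borel" "\<forall>l\<in>lattice e. \<forall>x. f (x + l) = f x" "AE x in lborel. f x = g x"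
proof -
  obtain g' where g': "g' \<in> borel_measurable lborel" "AE x in lborel. g x = g' x"
    using completion_ex_borel_measurable_real[OF g] by blast
  have "AE x in lborel. \<forall>l\<in>lattice e. g (x + l) = g' (x + l)"
    using AE_lborel_translate[OF g'(2)] countable_lattice by (intro AE_ball_countable') auto
  then have "AE x in lborel. g' (reduce x) = g x"
  proof eventually_elim
    case (elim x)
    have l: "- (x - reduce x) \<in> lattice e" by (intro lattice_minus reduce_lattice)
    then have "g (x + - (x - reduce x)) = g' (x + - (x - reduce x))" using elim by blast
    then show ?case using per[OF l, of x] by simp
  qed
  moreover have "(\<lambda>x. g' (reduce x)) \<in> borel_measurable borel"
    using measurable_compose[OF reduce_measurable] g'(1) by simp
  ultimately show ?thesis by (intro that[of "\<lambda>x. g' (reduce x)"]) (simp_all add: reduce_translate)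
qed

end

section \<open>From finite element forms to periodic kernels\<close>

lemma alt_norm_sq:
  fixes \<phi> :: "(real ^ 'n::finite) list \<Rightarrow> real"
  shows "(alt_norm \<phi>)\<^sup>2 = (\<Sum>k\<le>CARD('n). comp_sq k \<phi> / fact k)"
  unfolding alt_norm_def comp_sq_def
  by (intro real_sqrt_pow2 sum_nonneg divide_nonneg_nonneg) auto

context refined_mesh begin

lemma fe_space_deg_components:
  fixes X :: "(real ^ 'n) set \<Rightarrow> nat \<Rightarrow> 'n form set"
  assumes X: "\<And>T. T \<in> \<T> \<Longrightarrow> local_spaces T (X T)" and w: "w \<in> fe_space_deg e \<T> X k"
  obtains \<Omega> f where "\<forall>T\<in>\<T>. smooth_form k (\<Omega> T) \<and> pullback T (\<Omega> T) \<in> X T k"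
    "\<forall>T\<in>\<T>. AE x in lborel. x \<in> T \<longrightarrow> w x = pullback T (\<Omega> T) x"
    "\<forall>I. f I \<in> borel_measurable borel" "\<forall>I. \<forall>l\<in>lattice e. \<forall>x. f I (x + l) = f I x"
    "\<forall>I. AE x in lborel. f I x = w x (map (\<lambda>i. axis i 1) I)"
proof -
  have "\<exists>W. (\<forall>T\<in>\<T>. W T \<in> X T k) \<and> (\<forall>T\<in>\<T>. \<forall>T'\<in>\<T>. T' \<subseteq> T \<longrightarrow> pullback T' (W T) = W T') \<and>
      (\<forall>T\<in>\<T>. AE x in lebesgue. x \<in> T \<longrightarrow> w x = W T x)"
    using w by (simp add: fe_space_deg_def)
  then obtain W where W0: "\<forall>T\<in>\<T>. W T \<in> X T k" "\<forall>T\<in>\<T>. AE x in lebesgue. x \<in> T \<longrightarrow> w x = W T x"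
    by (elim exE conjE)
  note W = bspec[OF W0(1)] bspec[OF W0(2)]
  have "\<forall>T\<in>\<T>. \<exists>\<omega>. smooth_form k \<omega> \<and> W T = pullback T \<omega>"
    using X W(1) unfolding local_spaces_def smooth_forms_on_def by blast
  from bchoice[OF this] obtain \<Omega> where \<Omega>0: "\<forall>T\<in>\<T>. smooth_form k (\<Omega> T) \<and> W T = pullback T (\<Omega> T)"
    by (elim exE)
  note \<Omega> = bspec[OF \<Omega>0]
  have L2: "w \<in> L2_forms e" using w by (simp add: fe_space_deg_def)
  have per: "w (x + l) vs = w x vs" if "l \<in> lattice e" for x l vs
  proof -
    have "translate_form l w = w" using L2 that by (simp add: L2_forms_def)
    then have "translate_form l w (x + l) vs = w (x + l) vs" by simp
    then show ?thesis by (simp add: translate_form_def)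
  qed
  have "\<forall>I :: 'n list. \<exists>f. f \<in> borel_measurable borel \<and> (\<forall>l\<in>lattice e. \<forall>x. f (x + l) = f x) \<and>
      (AE x in lborel. f x = w x (map (\<lambda>i. axis i 1) I))"
  proof
    fix I :: "'n list"
    have "(\<lambda>x. w x (map (\<lambda>i. axis i 1) I)) \<in> borel_measurable lebesgue"
      using L2 by (simp add: L2_forms_def)
    then obtain f where "f \<in> borel_measurable borel" "\<forall>l\<in>lattice e. \<forall>x. f (x + l) = f x"
        "AE x in lborel. f x = w x (map (\<lambda>i. axis i 1) I)"
      by (rule periodic_borel_version[OF _ per])
    then show "\<exists>f. f \<in> borel_measurable borel \<and> (\<forall>l\<in>lattice e. \<forall>x. f (x + l) = f x) \<and>
      (AE x in lborel. f x = w x (map (\<lambda>i. axis i 1) I))"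
      by (intro exI[of _ f]) simp
  qed
  from choice[OF this] obtain f where f:
    "\<forall>I. f I \<in> borel_measurable borel \<and> (\<forall>l\<in>lattice e. \<forall>x. f I (x + l) = f I x) \<and>
      (AE x in lborel. f I x = w x (map (\<lambda>i. axis i 1) I))"
    by (elim exE)
  show ?thesis
  proof (rule that[of \<Omega> f])
    show "\<forall>T\<in>\<T>. AE x in lborel. x \<in> T \<longrightarrow> w x = pullback T (\<Omega> T) x"
    proof
      fix T assume T: "T \<in> \<T>"
      show "AE x in lborel. x \<in> T \<longrightarrow> w x = pullback T (\<Omega> T) x"
        using W(2)[OF T] \<Omega>[OF T] by (simp add: AE_completion_iff)
    qed
    show "\<forall>T\<in>\<T>. smooth_form k (\<Omega> T) \<and> pullback T (\<Omega> T) \<in> X T k"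
      using W(1) \<Omega> by auto
  qed (use f in simp_all)
qed

text \<open>
  The components of \<open>u\<close> are only Lebesgue measurable; periodic Borel versions of them make the kernel
  \<open>Q\<close> jointly measurable, as needed for the nested integrals.
\<close>

lemma fe_space_kernel:
  fixes X :: "(real ^ 'n) set \<Rightarrow> nat \<Rightarrow> 'n form set"
  assumes X: "\<And>T. T \<in> \<T> \<Longrightarrow> local_spaces T (X T)"
    and poly: "\<And>T k. T \<in> \<T> \<Longrightarrow> poly_forms_on p k T \<subseteq> X T k"
    and \<kappa>: "0 < \<kappa>"
    and ib: "\<And>k T \<sigma> \<omega>. k \<le> CARD('n) \<Longrightarrow> T \<in> \<T> \<Longrightarrow> \<sigma> \<in> top_simplices \<Longrightarrow> \<sigma> \<subseteq> T \<Longrightarrow> smooth_form k \<omega> \<Longrightarrow>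
      pullback T \<omega> \<in> X T k \<Longrightarrow> cell_inverse_bound k \<kappa> h T \<omega>"
    and u: "u \<in> fe_space e \<T> X"
  defines "R \<equiv> C + 2 + 1 / \<kappa>" and "M \<equiv> 1 / (\<kappa> ^ Suc CARD('n) * unit_ball_vol CARD('n))"
  obtains Q G where "periodic_kernel e Q" "\<forall>x y z. Q x y \<le> 2 * Q x z + 2 * Q y z"
    "\<forall>s. slobodetskij e s u = ennreal_sqrt (slobodetskij_energy s Q)" "AE x in lborel. x \<in> G"
    "\<forall>y\<in>G. \<forall>z\<in>G. dist y z \<le> (C + 1) * h \<longrightarrow>
      ennreal (Q y z) \<le> ennreal (M / h ^ CARD('n)) * (\<integral>\<^sup>+y\<in>ball z (R * h). ennreal (Q y z) \<partial>lborel)"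
    "\<forall>K\<in>top_simplices. \<forall>x\<in>G \<inter> K. \<forall>y\<in>G \<inter> K. \<forall>z\<in>G \<inter> K.
      ennreal (Q x y) \<le> ennreal ((dist x y / h)\<^sup>2) *
        (ennreal (M / h ^ CARD('n)) * (\<integral>\<^sup>+y\<in>ball z (R * h). ennreal (Q y z) \<partial>lborel))"
proof -
  let ?n = "CARD('n)"
  obtain w where w: "u = (\<lambda>x vs. \<Sum>k\<le>?n. w k x vs)" "\<And>k. k \<le> ?n \<Longrightarrow> w k \<in> fe_space_deg e \<T> X k"
    using u unfolding fe_space_def by blast
  have w_alt: "alternating (w k x)" and w_hom: "homogeneous k (w k x)" if "k \<le> ?n" for k x
    using w(2)[OF that] by (auto simp: fe_space_deg_def L2_forms_def)
  define P where "P = (\<lambda>k (\<Omega> :: (real ^ 'n) set \<Rightarrow> 'n form) (f :: 'n list \<Rightarrow> real ^ 'n \<Rightarrow> real).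
      (\<forall>T\<in>\<T>. smooth_form k (\<Omega> T) \<and> pullback T (\<Omega> T) \<in> X T k) \<and>
      (\<forall>T\<in>\<T>. AE x in lborel. x \<in> T \<longrightarrow> w k x = pullback T (\<Omega> T) x) \<and>
      (\<forall>I. f I \<in> borel_measurable borel) \<and> (\<forall>I. \<forall>l\<in>lattice e. \<forall>x. f I (x + l) = f I x) \<and>
      (\<forall>I. AE x in lborel. f I x = w k x (map (\<lambda>i. axis i 1) I)))"
  have "\<exists>\<Omega> f. P k \<Omega> f" if "k \<le> ?n" for k
  proof -
    note wk = w(2)[OF that]
    obtain \<Omega> f where "\<forall>T\<in>\<T>. smooth_form k (\<Omega> T) \<and> pullback T (\<Omega> T) \<in> X T k"
      "\<forall>T\<in>\<T>. AE x in lborel. x \<in> T \<longrightarrow> w k x = pullback T (\<Omega> T) x"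
      "\<forall>I. f I \<in> borel_measurable borel" "\<forall>I. \<forall>l\<in>lattice e. \<forall>x. f I (x + l) = f I x"
      "\<forall>I. AE x in lborel. f I x = w k x (map (\<lambda>i. axis i 1) I)"
      by (rule fe_space_deg_components[OF X wk])
    then have "P k \<Omega> f" unfolding P_def by simp
    then show ?thesis by blast
  qed
  then obtain \<Omega> f where P: "\<And>k. k \<le> ?n \<Longrightarrow> P k (\<Omega> k) (f k)" by metis
  have \<Omega>: "\<And>k T. k \<le> ?n \<Longrightarrow> T \<in> \<T> \<Longrightarrow> smooth_form k (\<Omega> k T) \<and> pullback T (\<Omega> k T) \<in> X T k"
      "\<And>k T. k \<le> ?n \<Longrightarrow> T \<in> \<T> \<Longrightarrow> AE x in lborel. x \<in> T \<longrightarrow> w k x = pullback T (\<Omega> k T) x"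
    and f: "\<And>k I. k \<le> ?n \<Longrightarrow> f k I \<in> borel_measurable borel"
      "\<And>k I x l. k \<le> ?n \<Longrightarrow> l \<in> lattice e \<Longrightarrow> f k I (x + l) = f k I x"
      "\<And>k I. k \<le> ?n \<Longrightarrow> AE x in lborel. f k I x = w k x (map (\<lambda>i. axis i 1) I)"
    using P unfolding P_def by simp_all
  \<comment> \<open>The squared degree \<open>k\<close> difference in terms of the Borel versions.
    Every index list is counted, so \<open>Q\<close> divides by \<open>fact k\<close> as
    \<open>alt_norm\<close> does.\<close>
  define q where "q = (\<lambda>k x y. \<Sum>I\<in>{I :: 'n list. length I = k}. (f k I x - f k I y)\<^sup>2)"
  define Q where "Q = (\<lambda>x y. \<Sum>k\<le>?n. q k x y / fact k)"
  have q0: "0 \<le> q k x y" for k x y unfolding q_def by (intro sum_nonneg) auto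
  have qm: "(\<lambda>p. q k (g1 p) (g2 p)) \<in> borel_measurable N"
    if "k \<le> ?n" "g1 \<in> borel_measurable N" "g2 \<in> borel_measurable N" for k g1 g2 and N :: "'b measure"
    unfolding q_def
    by (intro borel_measurable_sum borel_measurable_power borel_measurable_diff
        measurable_compose[OF that(2) f(1)[OF that(1)]] measurable_compose[OF that(3) f(1)[OF that(1)]])
  have ker: "periodic_kernel e Q"
  proof
    have "(\<lambda>p. Q (fst p) (snd p)) \<in> borel_measurable (borel \<Otimes>\<^sub>M borel)"
      unfolding Q_def by (intro borel_measurable_sum borel_measurable_divide qm) auto
    then show "case_prod Q \<in> borel_measurable (borel \<Otimes>\<^sub>M borel)" by (simp add: case_prod_beta')
    fix x y l
    show "0 \<le> Q x y" unfolding Q_def by (intro sum_nonneg divide_nonneg_nonneg q0) auto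
    show "Q x x = 0" by (simp add: Q_def q_def)
    show "Q x y = Q y x" by (simp add: Q_def q_def power2_commute)
    show "Q x (y + l) = Q x y" if "l \<in> lattice e"
      unfolding Q_def q_def using f(2)[OF _ that] by (intro sum.cong refl) auto
  qed
  have tri: "Q x y \<le> 2 * Q x z + 2 * Q y z" for x y z
  proof -
    have sq: "(a - b)\<^sup>2 \<le> 2 * (a - c)\<^sup>2 + 2 * (b - c)\<^sup>2" for a b c :: real
      using zero_le_power2[of "a + b - 2 * c"] by (simp add: power2_eq_square algebra_simps)
    have "q k x y \<le> 2 * q k x z + 2 * q k y z" for k
      unfolding q_def sum_distrib_left sum.distrib[symmetric] by (intro sum_mono sq)
    then have "q k x y / fact k \<le> (2 * q k x z + 2 * q k y z) / fact k" for k
      by (rule divide_right_mono) simp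
    then have "Q x y \<le> (\<Sum>k\<le>?n. (2 * q k x z + 2 * q k y z) / fact k)"
      unfolding Q_def by (rule sum_mono)
    also have "\<dots> = 2 * Q x z + 2 * Q y z"
      unfolding Q_def sum_distrib_left sum.distrib[symmetric] by (simp add: add_divide_distrib)
    finally show ?thesis .
  qed
  \<comment> \<open>There are countably many cells and finitely many degrees and index lists, so all
    the almost everywhere identities hold together off one null set.\<close>
  define G where "G = {x. x \<in> \<Union>top_simplices \<and>
      (\<forall>T\<in>\<T>. \<forall>k\<in>{..?n}. x \<in> T \<longrightarrow> w k x = pullback T (\<Omega> k T) x) \<and>
      (\<forall>k\<in>{..?n}. \<forall>I\<in>{I. length I = k}. f k I x = w k x (map (\<lambda>i. axis i 1) I))}"
  have AE_G: "AE x in lborel. x \<in> G"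
  proof -
    have "AE x in lborel. \<forall>T\<in>\<T>. \<forall>k\<in>{..?n}. x \<in> T \<longrightarrow> w k x = pullback T (\<Omega> k T) x"
      by (intro AE_ball_countable' AE_finite_allI \<Omega>(2) torus_complex_countable[OF complex]) auto
    moreover have "AE x in lborel. \<forall>k\<in>{..?n}. \<forall>I\<in>{I. length I = k}. f k I x = w k x (map (\<lambda>i. axis i 1) I)"
      by (intro AE_finite_allI f(3) finite_index_lists) auto
    ultimately show ?thesis using AE_top_simplices unfolding G_def by auto
  qed
  have q_comp: "q k x y = comp_sq k (\<lambda>vs. w k x vs - w k y vs)" if "k \<le> ?n" "x \<in> G" "y \<in> G" for k x y
    unfolding q_def comp_sq_def using that by (intro sum.cong refl) (auto simp: G_def)
  have Q_alt: "(alt_norm (\<lambda>vs. u x vs - u y vs))\<^sup>2 = Q x y" if "x \<in> G" "y \<in> G" for x y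
  proof -
    have uw: "u x vs = w k x vs" if "k \<le> ?n" "length vs = k" for k vs x
    proof -
      have "u x vs = (\<Sum>k'\<le>?n. if k' = k then w k x vs else 0)"
        unfolding w(1) using w_hom that by (intro sum.cong refl) (auto simp: homogeneous_def)
      then show ?thesis using that by simp
    qed
    have "comp_sq k (\<lambda>vs. u x vs - u y vs) = q k x y" if "k \<le> ?n" for k
      unfolding q_comp[OF that \<open>x \<in> G\<close> \<open>y \<in> G\<close>] using uw[OF that] by (intro comp_sq_cong) auto
    then show ?thesis unfolding alt_norm_sq Q_def by (intro sum.cong refl) auto
  qed
  have slob: "slobodetskij e s u = ennreal_sqrt (slobodetskij_energy s Q)" for s
  proof -
    let ?F = "fundamental_domain e" and ?t = "\<lambda>x y. torus_dist e x y powr (real CARD('n) + 2 * s)"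
    have "(\<integral>\<^sup>+y\<in>?F. ennreal ((alt_norm (\<lambda>vs. u x vs - u y vs))\<^sup>2 / ?t x y) \<partial>lborel)
       = (\<integral>\<^sup>+y\<in>?F. ennreal (Q x y / ?t x y) \<partial>lborel)" if "x \<in> G" for x
      using AE_G by (intro nn_integral_cong_AE) (auto elim!: eventually_mono simp: Q_alt[OF that])
    then have "(\<integral>\<^sup>+x\<in>?F. (\<integral>\<^sup>+y\<in>?F. ennreal ((alt_norm (\<lambda>vs. u x vs - u y vs))\<^sup>2 / ?t x y) \<partial>lborel) \<partial>lborel)
       = slobodetskij_energy s Q"
      unfolding slobodetskij_energy_def
      using AE_G by (intro nn_integral_cong_AE) (auto elim!: eventually_mono)
    then show ?thesis by (simp add: slobodetskij_def nn_integral_completion)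
  qed
  have est: "\<And>y z. y \<in> G \<Longrightarrow> z \<in> G \<Longrightarrow> dist y z \<le> (C + 1) * h \<Longrightarrow>
      ennreal (q k y z) \<le> ennreal (M / h ^ ?n) * (\<integral>\<^sup>+y\<in>ball z (R * h). ennreal (q k y z) \<partial>lborel)"
    "\<And>K x y z. K \<in> top_simplices \<Longrightarrow> x \<in> G \<Longrightarrow> x \<in> K \<Longrightarrow> y \<in> G \<Longrightarrow> y \<in> K \<Longrightarrow> z \<in> G \<Longrightarrow> z \<in> K \<Longrightarrow>
      ennreal (q k x y) \<le> ennreal ((dist x y / h)\<^sup>2) *
        (ennreal (M / h ^ ?n) * (\<integral>\<^sup>+y\<in>ball z (R * h). ennreal (q k y z) \<partial>lborel))"
    if k: "k \<le> ?n" for k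
  proof -
    \<comment> \<open>The constant forms \<open>\<phi>\<close> will be the values
      \<open>w k z\<close>.\<close>
    have a: "cell_inverse_bound k \<kappa> h T (\<lambda>x vs. \<Omega> k T x vs - \<phi> vs)"
      if "T \<in> \<T>" "\<sigma> \<in> top_simplices" "\<sigma> \<subseteq> T" "alternating \<phi>" "homogeneous k \<phi>" for T \<sigma> \<phi>
      using \<Omega>(1)[OF k that(1)] that
      by (intro ib[OF k that(1-3)] smooth_form_diff_const pullback_diff_const_mem[OF X poly]) auto
    have b: "w k x = pullback T (\<Omega> k T) x" if "x \<in> G" "T \<in> \<T>" "x \<in> T" for x T
      using that k by (auto simp: G_def)
    have c: "x \<in> \<Union>top_simplices" if "x \<in> G" for x using that by (simp add: G_def)
    note loc = local_estimates_homogeneous[where v = "w k" and \<Omega> = "\<Omega> k" and q = "q k", OF \<kappa> a w_alt[OF k] w_hom[OF k] AE_G b c q_comp[OF k],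
        folded R_def M_def]
    show "\<And>y z. y \<in> G \<Longrightarrow> z \<in> G \<Longrightarrow> dist y z \<le> (C + 1) * h \<Longrightarrow>
      ennreal (q k y z) \<le> ennreal (M / h ^ ?n) * (\<integral>\<^sup>+y\<in>ball z (R * h). ennreal (q k y z) \<partial>lborel)"
      by (rule loc(1))
    show "\<And>K x y z. K \<in> top_simplices \<Longrightarrow> x \<in> G \<Longrightarrow> x \<in> K \<Longrightarrow> y \<in> G \<Longrightarrow> y \<in> K \<Longrightarrow> z \<in> G \<Longrightarrow> z \<in> K \<Longrightarrow>
      ennreal (q k x y) \<le> ennreal ((dist x y / h)\<^sup>2) *
        (ennreal (M / h ^ ?n) * (\<integral>\<^sup>+y\<in>ball z (R * h). ennreal (q k y z) \<partial>lborel))"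
      by (rule loc(2))
  qed
  have Q_sum: "ennreal (Q x y) = (\<Sum>k\<le>?n. ennreal (1 / fact k) * ennreal (q k x y))" for x y
  proof -
    have "ennreal (Q x y) = (\<Sum>k\<le>?n. ennreal (q k x y / fact k))"
      unfolding Q_def by (rule sum_ennreal[symmetric]) (simp add: q0)
    also have "\<dots> = (\<Sum>k\<le>?n. ennreal (1 / fact k) * ennreal (q k x y))"
      by (intro sum.cong refl) (simp add: ennreal_mult'[symmetric])
    finally show ?thesis .
  qed
  have int_Q: "(\<integral>\<^sup>+y\<in>B. ennreal (Q y z) \<partial>lborel) = (\<Sum>k\<le>?n. ennreal (1 / fact k) * (\<integral>\<^sup>+y\<in>B. ennreal (q k y z) \<partial>lborel))"
    if B: "B \<in> sets borel" for B z
  proof -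
    have m: "(\<lambda>y. ennreal (q k y z) * indicator B y) \<in> borel_measurable lborel" if "k \<le> ?n" for k
      using B qm[OF that, of "\<lambda>y. y" lborel "\<lambda>y. z"] by simp
    have "(\<integral>\<^sup>+y\<in>B. ennreal (Q y z) \<partial>lborel) = (\<integral>\<^sup>+y. (\<Sum>k\<le>?n. ennreal (1 / fact k) * (ennreal (q k y z) * indicator B y)) \<partial>lborel)"
      unfolding Q_sum by (simp add: sum_distrib_right mult.assoc)
    also have "\<dots> = (\<Sum>k\<le>?n. \<integral>\<^sup>+y. ennreal (1 / fact k) * (ennreal (q k y z) * indicator B y) \<partial>lborel)"
      by (rule nn_integral_sum, rule borel_measurable_times_ennreal[OF borel_measurable_const m]) simp
    also have "\<dots> = (\<Sum>k\<le>?n. ennreal (1 / fact k) * (\<integral>\<^sup>+y\<in>B. ennreal (q k y z) \<partial>lborel))"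
      using m by (intro sum.cong refl nn_integral_cmult) auto
    finally show ?thesis .
  qed
  show ?thesis
  proof (rule that[OF ker _ _ AE_G]; intro ballI allI impI)
    fix y z assume *: "y \<in> G" "z \<in> G" "dist y z \<le> (C + 1) * h"
    have "ennreal (Q y z) \<le> (\<Sum>k\<le>?n. ennreal (1 / fact k) *
        (ennreal (M / h ^ ?n) * (\<integral>\<^sup>+y\<in>ball z (R * h). ennreal (q k y z) \<partial>lborel)))"
      unfolding Q_sum by (intro sum_mono mult_left_mono est(1) *) auto
    then show "ennreal (Q y z) \<le> ennreal (M / h ^ ?n) * (\<integral>\<^sup>+y\<in>ball z (R * h). ennreal (Q y z) \<partial>lborel)"
      by (simp add: int_Q sum_distrib_left mult_ac)
  next
    fix K x y z assume "K \<in> top_simplices" "x \<in> G \<inter> K" "y \<in> G \<inter> K" "z \<in> G \<inter> K"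
    then have *: "K \<in> top_simplices" "x \<in> G" "x \<in> K" "y \<in> G" "y \<in> K" "z \<in> G" "z \<in> K" by auto
    have "ennreal (Q x y) \<le> (\<Sum>k\<le>?n. ennreal (1 / fact k) * (ennreal ((dist x y / h)\<^sup>2) *
        (ennreal (M / h ^ ?n) * (\<integral>\<^sup>+y\<in>ball z (R * h). ennreal (q k y z) \<partial>lborel))))"
      unfolding Q_sum[of x y] by (intro sum_mono mult_left_mono est(2)[OF _ *]) auto
    then show "ennreal (Q x y) \<le> ennreal ((dist x y / h)\<^sup>2) *
        (ennreal (M / h ^ ?n) * (\<integral>\<^sup>+y\<in>ball z (R * h). ennreal (Q y z) \<partial>lborel))"
      by (simp add: int_Q sum_distrib_left mult_ac)
  qed (rule tri slob)+
qed

end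

section \<open>Square roots and conclusion\<close>

lemma ennreal_sqrt_le_mult:
  assumes le: "a \<le> ennreal c * b" and c: "0 < c"
  shows "ennreal_sqrt a \<le> ennreal (sqrt c) * ennreal_sqrt b"
proof (cases "b = \<infinity>")
  \<comment> \<open>Positivity of \<open>c\<close> matters, since 0 times infinity is 0.\<close>
  case True
  then show ?thesis using c by (simp add: ennreal_sqrt_def ennreal_mult_top)
next
  case False
  then obtain r where r: "b = ennreal r" "0 \<le> r" by (cases b) auto
  have "a \<le> ennreal (c * r)" using le c r by (simp add: ennreal_mult)
  moreover from this obtain t where t: "a = ennreal t" "0 \<le> t" by (cases a) (auto simp: top_unique)
  ultimately have "t \<le> c * r" using c r by simp
  then have "sqrt t \<le> sqrt c * sqrt r" by (simp add: real_sqrt_mult[symmetric])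
  then show ?thesis
    using t r c by (simp add: ennreal_sqrt_def ennreal_mult[symmetric] ennreal_leI)
qed

theorem proposition5p2:
  fixes e :: "'n::finite \<Rightarrow> real ^ 'n"
    and \<T> :: "nat \<Rightarrow> (real ^ 'n) set set"
    and X :: "nat \<Rightarrow> (real ^ 'n) set \<Rightarrow> nat \<Rightarrow> 'n form set"
    and h :: "nat \<Rightarrow> real"
    and p :: nat
    and s s' :: real
  assumes "lattice_basis e"
    and "\<And>m. torus_complex e (\<T> m)"
    and h_def: "\<And>m. h m = mesh_size e (\<T> m)"
    and "h \<longlonglongrightarrow> 0"
    and "quasi_uniform e \<T>"
    and "\<And>m. compatible_fe_system e (\<T> m) (X m)"
    and "h_setting e \<T> X"
    and "\<And>m T k. T \<in> \<T> m \<Longrightarrow> poly_forms_on p k T \<subseteq> X m T k"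
    and "0 < s" and "s < s'" and "s' < 1 / 2"
  shows "\<exists>M::real. \<forall>m. \<forall>u\<in>fe_space e (\<T> m) (X m).
           slobodetskij e s' u \<le> ennreal (M * h m powr (s - s')) * slobodetskij e s u"
proof -
  let ?n = "CARD('n)"
  interpret torus_lattice e by unfold_locales fact
  obtain C and N :: nat where C: "0 < C" and U0: "\<forall>m. \<exists>\<U>.
     simplicial_refinement e \<U> (\<T> m) \<and>
     (\<forall>\<sigma>\<in>\<U>. int CARD('n) simplex \<sigma> \<longrightarrow>
        (\<exists>a r. ball a r \<subseteq> \<sigma> \<and> diameter \<sigma> \<le> C * r) \<and>
        mesh_size e (\<T> m) \<le> C * diameter \<sigma> \<and> diameter \<sigma> \<le> C * mesh_size e (\<T> m)) \<and>
     (\<forall>T\<in>\<T> m. finite {\<sigma>\<in>\<U>. \<sigma> \<subseteq> T} \<and> card {\<sigma>\<in>\<U>. \<sigma> \<subseteq> T} \<le> N)"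
    using \<open>quasi_uniform e \<T>\<close> unfolding quasi_uniform_def by (elim exE conjE)
  from choice[OF U0] obtain U where U: "\<forall>m. simplicial_refinement e (U m) (\<T> m) \<and>
     (\<forall>\<sigma>\<in>U m. int CARD('n) simplex \<sigma> \<longrightarrow>
        (\<exists>a r. ball a r \<subseteq> \<sigma> \<and> diameter \<sigma> \<le> C * r) \<and>
        mesh_size e (\<T> m) \<le> C * diameter \<sigma> \<and> diameter \<sigma> \<le> C * mesh_size e (\<T> m)) \<and>
     (\<forall>T\<in>\<T> m. finite {\<sigma>\<in>U m. \<sigma> \<subseteq> T} \<and> card {\<sigma>\<in>U m. \<sigma> \<subseteq> T} \<le> N)"
    by (elim exE)
  have mesh: "refined_mesh e (\<T> m) (U m) C (mesh_size e (\<T> m))" for m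
    by unfold_locales (use assms(2) C spec[OF U, of m] in simp_all)
  define P where "P = (\<lambda>k \<kappa>. \<forall>m T \<sigma> \<omega>. T \<in> \<T> m \<longrightarrow> \<sigma> \<in> refined_mesh.top_simplices (U m) \<longrightarrow> \<sigma> \<subseteq> T \<longrightarrow>
      smooth_form k \<omega> \<longrightarrow> pullback T \<omega> \<in> X m T k \<longrightarrow> cell_inverse_bound k \<kappa> (h m) T \<omega>)"
  have "\<forall>k. \<exists>\<kappa>. 0 < \<kappa> \<and> P k \<kappa>"
  proof
    fix k
    show "\<exists>\<kappa>. 0 < \<kappa> \<and> P k \<kappa>"
    proof (rule mesh_inverse_bound[OF \<open>h_setting e \<T> X\<close> mesh, where k = k])
      fix \<kappa> assume \<kappa>: "0 < \<kappa>" "\<And>m T \<sigma> \<omega>. T \<in> \<T> m \<Longrightarrow> \<sigma> \<in> refined_mesh.top_simplices (U m) \<Longrightarrow> \<sigma> \<subseteq> T \<Longrightarrow>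
        smooth_form k \<omega> \<Longrightarrow> pullback T \<omega> \<in> X m T k \<Longrightarrow> cell_inverse_bound k \<kappa> (mesh_size e (\<T> m)) T \<omega>"
      then have "P k \<kappa>" unfolding P_def h_def by simp
      then show "\<exists>\<kappa>. 0 < \<kappa> \<and> P k \<kappa>" using \<kappa>(1) by blast
    qed
  qed
  from choice[OF this] obtain \<kappa>0 where "\<forall>k. 0 < \<kappa>0 k \<and> P k (\<kappa>0 k)"
    by (elim exE)
  then have \<kappa>0: "\<And>k. 0 < \<kappa>0 k" "\<And>k m T \<sigma> \<omega>. T \<in> \<T> m \<Longrightarrow> \<sigma> \<in> refined_mesh.top_simplices (U m) \<Longrightarrow> \<sigma> \<subseteq> T \<Longrightarrow>
      smooth_form k \<omega> \<Longrightarrow> pullback T \<omega> \<in> X m T k \<Longrightarrow> cell_inverse_bound k (\<kappa>0 k) (h m) T \<omega>"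
    unfolding P_def by simp_all
  \<comment> \<open>One constant for the degrees \<open>0, ..., n\<close> that occur in
    \<open>fe_space\<close>.\<close>
  define \<kappa> where "\<kappa> = Min (\<kappa>0 ` {..?n})"
  have \<kappa>: "0 < \<kappa>" "\<And>k. k \<le> ?n \<Longrightarrow> \<kappa> \<le> \<kappa>0 k" using \<kappa>0(1) by (auto simp: \<kappa>_def)
  have hpos: "0 < h m" for m unfolding h_def by (rule refined_mesh.h_pos[OF mesh])
  obtain H where H: "\<And>m. h m \<le> H"
    using BseqE[OF convergent_imp_Bseq[OF convergentI[OF \<open>h \<longlonglongrightarrow> 0\<close>]]] by (metis abs_le_D1 real_norm_def)
  obtain B where B: "\<And>x. x \<in> fundamental_domain e \<Longrightarrow> norm x \<le> B"
    using bounded_fundamental_domain by (auto simp: bounded_iff)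
  define R where "R = C + 2 + 1 / \<kappa>"
  define M where "M = 1 / (\<kappa> ^ Suc ?n * unit_ball_vol ?n)"
  have M0: "0 \<le> M" using \<kappa>(1) by (simp add: M_def)
  have R0: "0 < R" using C \<kappa>(1) by (simp add: R_def add_pos_pos)
  \<comment> \<open>\<open>L\<close> must not depend on \<open>m\<close>, so the convergent mesh
    sizes are replaced by their bound \<open>H\<close>; \<open>2 * B\<close> bounds the difference
    of two points of the fundamental domain.\<close>
  define L where "L = {l \<in> lattice e. norm l \<le> (1 + C + R) * H + 2 * B}"
  \<comment> \<open>The factor 4 pays for comparing \<open>x\<close> and \<open>y\<close> through
    \<open>z\<close>. The maximum with 1 secures the positivity needed when square roots are
    taken.\<close>
  define K where "K = max 1 (1 + real (card L) ^ 3 * (unit_ball_vol ?n *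
     2 powr (real ?n + 2 * s') * shell_sum ?n (1 / C\<^sup>2) s' * (4 * M) * R powr (real ?n + 2 * s)))"
  have "slobodetskij e s' u \<le> ennreal (sqrt K * h m powr (s - s')) * slobodetskij e s u"
    if u: "u \<in> fe_space e (\<T> m) (X m)" for m u
  proof -
    interpret refined_mesh e "\<T> m" "U m" C "h m" unfolding h_def by (rule mesh)
    have X: "local_spaces T (X m T)" if "T \<in> \<T> m" for T
      using assms(6)[of m] that by (auto simp: compatible_fe_system_def fe_system_def)
    have ib: "cell_inverse_bound k \<kappa> (h m) T \<omega>"
      if "k \<le> ?n" "T \<in> \<T> m" "\<sigma> \<in> top_simplices" "\<sigma> \<subseteq> T" "smooth_form k \<omega>" "pullback T \<omega> \<in> X m T k" for k T \<sigma> \<omega>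
      using cell_inverse_bound_mono[OF \<kappa>0(2)[OF that(2-6)] \<kappa>(2)[OF that(1)]] hpos[of m] by simp
    obtain Q G where Q: "periodic_kernel e Q" and tri: "\<forall>x y z. Q x y \<le> 2 * Q x z + 2 * Q y z"
      and slob: "\<forall>s. slobodetskij e s u = ennreal_sqrt (slobodetskij_energy s Q)"
      and G: "AE x in lborel. x \<in> G"
      and near: "\<forall>y\<in>G. \<forall>z\<in>G. dist y z \<le> (C + 1) * h m \<longrightarrow>
        ennreal (Q y z) \<le> ennreal (M / h m ^ ?n) * (\<integral>\<^sup>+y\<in>ball z (R * h m). ennreal (Q y z) \<partial>lborel)"
      and lip: "\<forall>K\<in>top_simplices. \<forall>x\<in>G \<inter> K. \<forall>y\<in>G \<inter> K. \<forall>z\<in>G \<inter> K.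
        ennreal (Q x y) \<le> ennreal ((dist x y / h m)\<^sup>2) *
          (ennreal (M / h m ^ ?n) * (\<integral>\<^sup>+y\<in>ball z (R * h m). ennreal (Q y z) \<partial>lborel))"
      unfolding R_def M_def by (rule fe_space_kernel[OF X assms(8) \<kappa>(1) ib u])
    interpret ker: periodic_kernel e Q by (rule Q)
    have "slobodetskij_energy s' Q \<le> ennreal ((1 + real (card L) ^ 3 * (unit_ball_vol ?n *
     2 powr (real ?n + 2 * s') * shell_sum ?n (1 / C\<^sup>2) s' * (4 * M) * R powr (real ?n + 2 * s))) *
     h m powr (2 * s - 2 * s')) * slobodetskij_energy s Q"
    proof (rule ker.energy_inverse_estimate[where S = top_simplices and G = G and D = C])
      show "finite L" unfolding L_def by (rule finite_lattice_ball)
    next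
      fix x y l assume xy: "x \<in> fundamental_domain e" "y \<in> fundamental_domain e" and l: "l \<in> lattice e"
        "norm (x - y - l) \<le> (1 + C + R) * h m"
      have "norm l \<le> norm (x - y) + norm (x - y - l)"
        using norm_triangle_ineq4[of "x - y" "x - y - l"] by simp
      moreover have "norm (x - y) \<le> 2 * B" using B[OF xy(1)] B[OF xy(2)] norm_triangle_ineq4[of x y] by linarith
      moreover have "(1 + C + R) * h m \<le> (1 + C + R) * H" using H C R0 by (intro mult_left_mono) auto
      ultimately show "l \<in> L" using l by (simp add: L_def)
    next
      fix K assume K: "K \<in> top_simplices"
      show "convex K \<and> compact K \<and> (\<exists>a r. 1 / C\<^sup>2 * h m \<le> r \<and> ball a r \<subseteq> K)"
        using top_simplex_size(2)[OF K] K U_convex U_compact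
        by (auto simp: top_simplices_def intro!: exI[of _ "h m / C\<^sup>2"])
    next
      fix K x y z assume K: "K \<in> top_simplices" and x: "x \<in> G" "x \<in> K" and y: "y \<in> G" and z: "z \<in> G" "z \<in> K"
        and d: "dist x y < h m"
      let ?A = "ker.local_energy (R * h m) z"
      have xz: "dist x z \<le> C * h m" by (rule top_simplex_size(3)[OF K x(2) z(2)])
      have "dist y z \<le> dist x y + dist x z" by (rule dist_triangle3)
      then have yz': "dist y z \<le> (C + 1) * h m" using xz d by (simp add: algebra_simps)
      have xz': "dist x z \<le> (C + 1) * h m" using xz hpos[of m] by (simp add: algebra_simps)
      \<comment> \<open>The points \<open>x\<close> and \<open>y\<close> may lie in different
        simplices, so both are compared with \<open>z\<close>. As \<open>y\<close> is within
        \<open>h\<close> of \<open>x\<close>, it is within \<open>(C + 1) * h\<close> of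
        \<open>z\<close>.\<close>
      have "ennreal (Q x y) \<le> ennreal (2 * Q x z + 2 * Q y z)" using tri by (intro ennreal_leI) blast
      also have "\<dots> = 2 * ennreal (Q x z) + 2 * ennreal (Q y z)"
        using ker.Q0 by (simp add: ennreal_plus ennreal_mult')
      also have "\<dots> \<le> 2 * (ennreal (M / h m ^ ?n) * ?A) + 2 * (ennreal (M / h m ^ ?n) * ?A)"
        unfolding ker.local_energy_def
        using near x y z xz' yz' by (intro add_mono mult_left_mono) auto
      also have "\<dots> = (2 * ennreal (M / h m ^ ?n) + 2 * ennreal (M / h m ^ ?n)) * ?A"
        by (simp add: distrib_right mult.assoc)
      also have "2 * ennreal (M / h m ^ ?n) + 2 * ennreal (M / h m ^ ?n) = ennreal (4 * M / h m ^ ?n)"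
      proof -
        have "2 * ennreal d + 2 * ennreal d = ennreal (4 * d)" if "0 \<le> d" for d
        proof -
          have "2 * ennreal d + 2 * ennreal d = 4 * ennreal d" by (simp add: distrib_right[symmetric])
          then show ?thesis by (simp add: ennreal_mult')
        qed
        from this[of "M / h m ^ ?n"] show ?thesis using M0 hpos[of m] by simp
      qed
      finally show "ennreal (Q x y) \<le> ennreal (4 * M / h m ^ ?n) * ?A" .
    next
      fix K x y z assume *: "K \<in> top_simplices" "x \<in> G" "x \<in> K" "y \<in> G" "y \<in> K" "z \<in> G" "z \<in> K"
      let ?A = "ker.local_energy (R * h m) z"
      have "ennreal (Q x y) \<le> ennreal ((dist x y / h m)\<^sup>2) * (ennreal (M / h m ^ ?n) * ?A)"
        unfolding ker.local_energy_def using lip * by blast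
      also have "\<dots> \<le> ennreal ((dist x y / h m)\<^sup>2) * (ennreal (4 * M / h m ^ ?n) * ?A)"
        using M0 hpos[of m] by (intro mult_left_mono mult_right_mono ennreal_leI divide_right_mono) auto
      finally show "ennreal (Q x y) \<le> ennreal ((dist x y / h m)\<^sup>2) * (ennreal (4 * M / h m ^ ?n) * ?A)" .
    qed (use hpos[of m] C M0 R0 assms(9-11) G AE_top_simplices finite_top_simplices top_simplices_disjoint
          top_simplex_size(3) in \<open>auto simp: L_def\<close>)
    also have "\<dots> \<le> ennreal (K * h m powr (2 * s - 2 * s')) * slobodetskij_energy s Q"
      unfolding K_def by (intro mult_right_mono ennreal_leI max.cobounded2) auto
    finally have "slobodetskij_energy s' Q \<le> ennreal (K * h m powr (2 * s - 2 * s')) * slobodetskij_energy s Q" .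
    moreover have "0 < K * h m powr (2 * s - 2 * s')" using hpos[of m] by (simp add: K_def)
    moreover have "sqrt (K * h m powr (2 * s - 2 * s')) = sqrt K * h m powr (s - s')"
    proof -
      have "h m powr (2 * s - 2 * s') = (h m powr (s - s'))\<^sup>2"
        by (simp add: power2_eq_square powr_add[symmetric])
      then show ?thesis by (simp add: real_sqrt_mult)
    qed
    ultimately show ?thesis
      using slob ennreal_sqrt_le_mult[of "slobodetskij_energy s' Q" "K * h m powr (2 * s - 2 * s')" "slobodetskij_energy s Q"]
      by simp
  qed
  then show ?thesis by blast
qed

end
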